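(* Let $k>1$ be a fixed integer, and let the parameters $\alpha,\beta\in[0,\infty)$ satisfy $(\alpha,\beta)\neq(0,0)$ (infinite parameters are also allowed, by limits, as described in the context). Let $A_n^{(k)}$ be the number of symbols $\alpha$ on the $k$-th diagonal of a random weighted staircase tableau of size $n$, i.e. a random $\alpha/\beta$-staircase tableau of size $n$ distributed according to $\mathbb{P}_{n,\alpha,\beta}$. Then, as $n\to\infty$, $$A_n^{(k)}\ \stackrel{d}{\longrightarrow}\ \mathrm{Pois}\left(\tfrac12\right),$$ where $\mathrm{Pois}(\lambda)$ denotes the Poisson distribution with parameter $\lambda$ and $\stackrel{d}{\to}$ is convergence in distribution.
   Context: An $\alpha/\beta$-staircase tableau of size $n$ is a Young diagram of shape $(n,n-1,\dots,1)$ (rows and columns numbered from the NW corner; box $(i,j)$ is in row $i$, column $j$, with $i,j\ge1$, $i+j\le n+1$) whose boxes are each either empty or filled with one symbol $\alpha$ or $\beta$, such that: (1) every box with $i+j=n+1$ (the first diagonal) contains a symbol; (2) all boxes in the same column as and north of (above) an $\alpha$ are empty; (3) all boxes in the same row as and west of (to the left of) a $\beta$ are empty. $\mathcal{S}_n$ is the set of all such tableaux. For $1\le k\le n$, the $k$-th diagonal is the set of boxes $(i,j)$ with $i+j=n-k+2$; it has $n-k+1$ boxes. The letters $\alpha,\beta$ are also used as numerical weights. For $n\ge1$ and $\alpha,\beta\in[0,\infty)$ with $(\alpha,\beta)\neq(0,0)$, the weight $wt(S)$ of $S\in\mathcal{S}_n$ is the product of all its symbols, i.e. $\alpha^{\#\alpha(S)}\beta^{\#\beta(S)}$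 (with $0^0=1$), where $\#\alpha(S)$ and $\#\beta(S)$ are the numbers of $\alpha$'s and $\beta$'s in $S$, and $\mathbb{P}_{n,\alpha,\beta}(S)=wt(S)/Z_n(\alpha,\beta)$ with $Z_n(\alpha,\beta)=\sum_{S\in\mathcal{S}_n}wt(S)$. Infinite parameters are allowed by taking limits of $\mathbb{P}_{n,\alpha,\beta}$: $\alpha\to\infty$ with $\beta$ fixed, $\beta\to\infty$ with $\alpha$ fixed, or $\alpha=\beta\to\infty$.
   Formalization: The formal theorem assumes both α>0 and β>0 (infinite values allowed) instead of (α,β)≠(0,0): if exactly one parameter is 0, then A_n^{(k)}=0 almost surely for k>1, so the Poisson limit fails there. *)

theory Defs
  imports "HOL-Probability.Probability"
begin

datatype symbol = SymAlpha | SymBeta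

text \<open>A filling of boxes: \<open>None\<close> is an empty box; the box in row \<open>i\<close> and column \<open>j\<close>
  is \<open>(i, j)\<close>, numbered from 1.\<close>

type_synonym filling = "nat \<times> nat \<Rightarrow> symbol option"

definition boxes :: "nat \<Rightarrow> (nat \<times> nat) set" where
  "boxes n = {(i, j). 1 \<le> i \<and> 1 \<le> j \<and> i + j \<le> n + 1}"

text \<open>The condition \<open>i + j = n - k + 2\<close>, written without truncated subtraction.\<close>

definition diagonal :: "nat \<Rightarrow> nat \<Rightarrow> (nat \<times> nat) set" where
  "diagonal n k = {(i, j). 1 \<le> i \<and> 1 \<le> j \<and> i + j + k = n + 2}"

definition staircase_tableaux :: "nat \<Rightarrow> filling set" where
  "staircase_tableaux n = {S.
     dom S \<subseteq> boxes n \<and>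
     diagonal n 1 \<subseteq> dom S \<and>
     (\<forall>i j. S (i, j) = Some SymAlpha \<longrightarrow> (\<forall>i'<i. S (i', j) = None)) \<and>
     (\<forall>i j. S (i, j) = Some SymBeta \<longrightarrow> (\<forall>j'<j. S (i, j') = None))}"

definition num_symbol :: "symbol \<Rightarrow> filling \<Rightarrow> nat" where
  "num_symbol c S = card {x. S x = Some c}"

definition weight :: "real \<Rightarrow> real \<Rightarrow> filling \<Rightarrow> real" where
  "weight a b S = a ^ num_symbol SymAlpha S * b ^ num_symbol SymBeta S"

definition partition_function :: "nat \<Rightarrow> real \<Rightarrow> real \<Rightarrow> real" where
  "partition_function n a b = (\<Sum>S\<in>staircase_tableaux n. weight a b S)"

definition finite_prob :: "nat \<Rightarrow> real \<Rightarrow> real \<Rightarrow> filling \<Rightarrow> real" where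
  "finite_prob n a b S =
     (if S \<in> staircase_tableaux n then weight a b S / partition_function n a b else 0)"

text \<open>Infinite parameters denote limits; two infinite parameters denote the limit along
  \<open>\<alpha> = \<beta> \<rightarrow> \<infinity>\<close>. These limits exist whenever the parameters are not both zero, because
  \<open>finite_prob\<close> is then eventually a quotient of polynomials with nonnegative coefficients
  that lies in \<open>[0, 1]\<close>. If exactly one parameter is \<open>0\<close>, the distribution is degenerate: there is
  almost surely no \<open>\<alpha>\<close> off the first diagonal.\<close>

definition tableau_prob :: "nat \<Rightarrow> ennreal \<Rightarrow> ennreal \<Rightarrow> filling \<Rightarrow> real" where
  "tableau_prob n \<alpha> \<beta> S =
     (if \<alpha> = \<infinity> \<and> \<beta> = \<infinity> then Lim at_top (\<lambda>x. finite_prob n x x S)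
      else if \<alpha> = \<infinity> then Lim at_top (\<lambda>x. finite_prob n x (enn2real \<beta>) S)
      else if \<beta> = \<infinity> then Lim at_top (\<lambda>x. finite_prob n (enn2real \<alpha>) x S)
      else finite_prob n (enn2real \<alpha>) (enn2real \<beta>) S)"

definition random_tableau :: "nat \<Rightarrow> ennreal \<Rightarrow> ennreal \<Rightarrow> filling pmf" where
  "random_tableau n \<alpha> \<beta> = embed_pmf (tableau_prob n \<alpha> \<beta>)"

definition alphas_on_diagonal :: "nat \<Rightarrow> nat \<Rightarrow> filling \<Rightarrow> nat" where
  "alphas_on_diagonal n k S = card {x \<in> diagonal n k. S x = Some SymAlpha}"

end

theory Submission
  imports Defs
begin

text \<open>Build a tableau column by column from the right. How a new column can be filled depends only on
  the set of rows without \<open>\<beta>\<close>, and summing out a column maps \<open>x ^ card F\<close> to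
  \<open>(\<alpha> x + \<beta>) (x + \<beta>) ^ card F\<close>. Demanding an \<open>\<alpha>\<close> on the \<open>k\<close>-th diagonal in a given column
  replaces \<open>k\<close> of these maps by another explicit map, so the joint probability of several such
  columns at mutual distance at least \<open>k\<close> is known exactly. Their generating function satisfies a
  recurrence in the number of columns, which is a perturbation of the differential equation solved by
  \<open>exp (w (x - x\<^sup>2 / 2))\<close>; at \<open>x = 1\<close> this is \<open>exp (w / 2)\<close>, the Poisson limit. With
  probability \<open>1 - O(1 / n)\<close> all the columns in question are at distance at least \<open>k\<close>. The
  estimates are uniform for \<open>1 / \<alpha>\<close> and \<open>1 / \<beta>\<close> in a bounded set, so they pass to infinite weights, and
  Levy's continuity theorem applies.\<close>

section \<open>Removing the leftmost column\<close>

text \<open>An \<alpha> of the leftmost column on the \<open>k\<close>-th diagonal sits in a row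
  whose first-diagonal box lies \<open>k - 1\<close> columns further right. That row must have
  stayed free of \<beta> since then, so the event concerns \<open>k\<close> consecutive columns, and
  its transfer is explicit as long as no second such event falls among them. Hence the sums over
  sets of columns with gaps at least \<open>k\<close>.

  Summing out a column shifts the argument x of x^|F| by \<beta>. With N columns left and argument 1
  + s \<beta>, the number t = s + N is therefore constant along unconstrained columns and drops by
  at most \<open>k\<close> at an event; N / t is the time variable of the limiting equation.

  On tableaux with two events closer than \<open>k\<close>, the sum over separated sets differs from
  the power that counts all \<alpha>'s and can be large. An exponential moment controls it, and this
  moment comes from the same recurrence with a large real \<open>w\<close>. Truncation at sqrt n
  balances the moment against the probability O(1 / n) of such tableaux and gives the error O(1 /
  sqrt n).\<close>

definition drop_column :: "filling \<Rightarrow> filling" where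
  "drop_column S = (\<lambda>(i, j). if j = 0 then None else S (i, Suc j))"

text \<open>Column 0 contains no box. Without the case \<open>j = 0\<close>,
  \<open>drop_column\<close> would leave the removed column at index 0.\<close>

definition add_column :: "(nat \<Rightarrow> symbol option) \<Rightarrow> filling \<Rightarrow> filling" where
  "add_column c S = (\<lambda>(i, j). if j = 0 then None else if j = 1 then c i else S (i, j - 1))"

definition free_rows :: "nat \<Rightarrow> filling \<Rightarrow> nat set" where
  "free_rows n S = {i \<in> {1..n}. \<forall>j. S (i, j) \<noteq> Some SymBeta}"

text \<open>The row condition on \<beta> appears only as the restriction of the domain to
  \<open>F\<close>. Row \<open>Suc n\<close> is created by the new column; its box lies on the first
  diagonal, hence it must be filled.\<close>

definition column_fillings :: "nat \<Rightarrow> nat set \<Rightarrow> (nat \<Rightarrow> symbol option) set" where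
  "column_fillings n F = {c. dom c \<subseteq> insert (Suc n) F \<and> c (Suc n) \<noteq> None \<and>
     (\<forall>i. c i = Some SymAlpha \<longrightarrow> (\<forall>i'<i. c i' = None))}"

lemma free_rows_subset: "free_rows n S \<subseteq> {1..n}"
  by (auto simp: free_rows_def)

lemma tableau_outside:
  assumes "S \<in> staircase_tableaux n" "\<not> (1 \<le> i \<and> 1 \<le> j \<and> i + j \<le> n + 1)"
  shows "S (i, j) = None"
proof -
  have "(i, j) \<notin> dom S"
    using assms unfolding staircase_tableaux_def boxes_def by blast
  thus ?thesis by blast
qed

lemma tableau_inside:
  assumes "S \<in> staircase_tableaux n" "S (i, j) \<noteq> None"
  shows "1 \<le> i" "1 \<le> j" "i + j \<le> n + 1"
  using tableau_outside[OF assms(1), of i j] assms(2) by blast+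

lemma tableau_first_diagonal:
  assumes "S \<in> staircase_tableaux n" "1 \<le> i" "1 \<le> j" "i + j = n + 1"
  shows "S (i, j) \<noteq> None"
proof -
  have "(i, j) \<in> dom S"
  proof -
    have "(i, j) \<in> diagonal n 1" using assms(2-4) by (simp add: diagonal_def)
    thus ?thesis using assms(1) unfolding staircase_tableaux_def by blast
  qed
  thus ?thesis by blast
qed

lemma tableau_above_alpha:
  assumes "S \<in> staircase_tableaux n" "S (i, j) = Some SymAlpha" "i' < i"
  shows "S (i', j) = None"
  using assms unfolding staircase_tableaux_def by blast

lemma tableau_left_of_beta:
  assumes "S \<in> staircase_tableaux n" "S (i, j) = Some SymBeta" "j' < j"
  shows "S (i, j') = None"
  using assms unfolding staircase_tableaux_def by blast

lemma tableauI:
  assumes "\<And>i j. S (i, j) \<noteq> None \<Longrightarrow> 1 \<le> i \<and> 1 \<le> j \<and> i + j \<le> n + 1"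
    and "\<And>i j. 1 \<le> i \<Longrightarrow> 1 \<le> j \<Longrightarrow> i + j = n + 1 \<Longrightarrow> S (i, j) \<noteq> None"
    and "\<And>i j i'. S (i, j) = Some SymAlpha \<Longrightarrow> i' < i \<Longrightarrow> S (i', j) = None"
    and "\<And>i j j'. S (i, j) = Some SymBeta \<Longrightarrow> j' < j \<Longrightarrow> S (i, j') = None"
  shows "S \<in> staircase_tableaux n"
proof -
  have "dom S \<subseteq> boxes n" using assms(1) unfolding boxes_def dom_def by blast
  moreover have "diagonal n 1 \<subseteq> dom S" using assms(2) unfolding diagonal_def dom_def by auto
  ultimately show ?thesis unfolding staircase_tableaux_def using assms(3,4) by blast
qed

lemma drop_add_column:
  assumes "S \<in> staircase_tableaux n"
  shows "drop_column (add_column c S) = S"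
  using tableau_outside[OF assms] by (auto simp: drop_column_def add_column_def fun_eq_iff)

lemma add_column_tableau:
  assumes S: "S \<in> staircase_tableaux n" and c: "c \<in> column_fillings n (free_rows n S)"
  shows "add_column c S \<in> staircase_tableaux (Suc n)"
proof (rule tableauI)
  have dc: "i = Suc n \<or> i \<in> free_rows n S" if "c i \<noteq> None" for i
    using c that by (auto simp: column_fillings_def dom_def)
  show "1 \<le> i \<and> 1 \<le> j \<and> i + j \<le> Suc n + 1" if "add_column c S (i, j) \<noteq> None" for i j
    using that dc[of i] tableau_inside[OF S, of i "j - 1"]
    by (auto simp: add_column_def free_rows_def split: if_splits)
  show "add_column c S (i, j) \<noteq> None" if "1 \<le> i" "1 \<le> j" "i + j = Suc n + 1" for i j
    using that c tableau_first_diagonal[OF S, of i "j - 1"]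
    by (auto simp: add_column_def column_fillings_def)
  show "add_column c S (i', j) = None"
    if "add_column c S (i, j) = Some SymAlpha" "i' < i" for i j i'
    using that c tableau_above_alpha[OF S, of i "j - 1" i']
    by (auto simp: add_column_def column_fillings_def split: if_splits)
  show "add_column c S (i, j') = None"
    if "add_column c S (i, j) = Some SymBeta" "j' < j" for i j j'
  proof -
    have j: "j \<noteq> 0" using that by auto
    show ?thesis
    proof (cases "j = 1")
      case True
      thus ?thesis using that by (auto simp: add_column_def)
    next
      case False
      hence b: "S (i, j - 1) = Some SymBeta" using that j by (auto simp: add_column_def)
      hence "i \<notin> free_rows n S" by (auto simp: free_rows_def)
      moreover have "i \<le> n" using b tableau_inside[OF S, of i "j - 1"] by auto
      ultimately have "c i = None" using dc[of i] by fastforce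
      thus ?thesis using tableau_left_of_beta[OF S b, of "j' - 1"] that
        by (auto simp: add_column_def)
    qed
  qed
qed

lemma drop_column_tableau:
  assumes S: "S \<in> staircase_tableaux (Suc n)"
  shows "drop_column S \<in> staircase_tableaux n"
proof (rule tableauI)
  show "1 \<le> i \<and> 1 \<le> j \<and> i + j \<le> n + 1" if "drop_column S (i, j) \<noteq> None" for i j
    using that tableau_inside[OF S, of i "Suc j"]
    by (auto simp: drop_column_def split: if_splits)
  show "drop_column S (i, j) \<noteq> None" if "1 \<le> i" "1 \<le> j" "i + j = n + 1" for i j
    using that tableau_first_diagonal[OF S, of i "Suc j"] by (auto simp: drop_column_def)
  show "drop_column S (i', j) = None"
    if "drop_column S (i, j) = Some SymAlpha" "i' < i" for i j i'
    using that tableau_above_alpha[OF S, of i "Suc j" i']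
    by (auto simp: drop_column_def split: if_splits)
  show "drop_column S (i, j') = None"
    if "drop_column S (i, j) = Some SymBeta" "j' < j" for i j j'
    using that tableau_left_of_beta[OF S, of i "Suc j" "Suc j'"]
    by (auto simp: drop_column_def split: if_splits)
qed

lemma first_column_in_column_fillings:
  assumes S: "S \<in> staircase_tableaux (Suc n)"
  shows "(\<lambda>i. S (i, 1)) \<in> column_fillings n (free_rows n (drop_column S))"
proof -
  have "i = Suc n \<or> i \<in> free_rows n (drop_column S)" if "S (i, 1) \<noteq> None" for i
  proof -
    have "S (i, Suc j) \<noteq> Some SymBeta" if "j \<noteq> 0" for j
      using tableau_left_of_beta[OF S, of i "Suc j" 1] \<open>S (i, 1) \<noteq> None\<close> that by auto
    moreover have "1 \<le> i" "i \<le> Suc n" using tableau_inside[OF S that] by auto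
    ultimately show ?thesis by (auto simp: free_rows_def drop_column_def)
  qed
  moreover have "S (Suc n, 1) \<noteq> None" using tableau_first_diagonal[OF S] by simp
  ultimately show ?thesis
    using tableau_above_alpha[OF S] by (auto simp: column_fillings_def dom_def)
qed

lemma add_drop_column:
  assumes S: "S \<in> staircase_tableaux (Suc n)"
  shows "add_column (\<lambda>i. S (i, 1)) (drop_column S) = S"
  using tableau_outside[OF S] by (auto simp: drop_column_def add_column_def fun_eq_iff)

lemma staircase_tableaux_0: "staircase_tableaux 0 = {\<lambda>_. None}"
proof -
  have "S = (\<lambda>_. None)" if "S \<in> staircase_tableaux 0" for S
    using tableau_outside[OF that] by (auto simp: fun_eq_iff)
  moreover have "(\<lambda>_. None) \<in> staircase_tableaux 0" by (rule tableauI) auto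
  ultimately show ?thesis by blast
qed

text \<open>A column is determined by the set \<open>D\<close> of its \<open>\<beta>\<close>'s and its optional \<open>\<alpha>\<close>, which lies above \<open>D\<close>.\<close>

definition make_column :: "nat option \<Rightarrow> nat set \<Rightarrow> nat \<Rightarrow> symbol option" where
  "make_column p D = (\<lambda>i. if i \<in> D then Some SymBeta else if p = Some i then Some SymAlpha else None)"

lemma make_column_inj:
  assumes "make_column p D = make_column q E" "set_option p \<inter> D = {}" "set_option q \<inter> E = {}"
  shows "p = q \<and> D = E"
proof -
  have *: "make_column p D i = make_column q E i" for i using assms by simp
  have D: "D = E"
  proof (intro set_eqI)
    fix i show "i \<in> D \<longleftrightarrow> i \<in> E" using *[of i] by (auto simp: make_column_def split: if_splits)
  qed
  have "p = Some i \<longleftrightarrow> q = Some i" for i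
    using *[of i] assms(2,3) D by (auto simp: make_column_def split: if_splits)
  thus ?thesis using D by (metis not_None_eq)
qed

text \<open>The bottom box decides. An \<alpha> there empties the rest of the column. A \<beta>
  there leaves a free choice of further \<beta>'s and of at most one \<alpha>, above which nothing
  stands.\<close>

lemma column_fillings_eq:
  assumes F: "F \<subseteq> {1..n}"
  shows "column_fillings n F = insert (make_column (Some (Suc n)) {})
    ((\<lambda>D. make_column None (insert (Suc n) D)) ` Pow F \<union>
     (\<Union>i\<in>F. (\<lambda>D. make_column (Some i) (insert (Suc n) D)) ` Pow (F \<inter> {i<..})))"
    (is "_ = ?R")
proof
  have "i \<le> n" if "i \<in> F" for i using F that by auto
  thus "?R \<subseteq> column_fillings n F"
    by (force simp: column_fillings_def make_column_def dom_def split: if_splits)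
  show "column_fillings n F \<subseteq> ?R"
  proof
    fix c assume c: "c \<in> column_fillings n F"
    define D where "D = {i \<in> F. c i = Some SymBeta}"
    have nF: "Suc n \<notin> F" using F by auto
    have dom: "i = Suc n \<or> i \<in> F" if "c i \<noteq> None" for i
      using c that by (auto simp: column_fillings_def)
    have ab: "c i' = None" if "c i = Some SymAlpha" "i' < i" for i i'
      using c that by (auto simp: column_fillings_def)
    have cases: "c i = None \<or> c i = Some SymAlpha \<or> c i = Some SymBeta" for i
      by (metis not_Some_eq symbol.exhaust)
    have un: "i = j" if "c i = Some SymAlpha" "c j = Some SymAlpha" for i j
      using ab[OF that(1), of j] ab[OF that(2), of i] that by (cases i j rule: linorder_cases) auto
    show "c \<in> ?R"
    proof (cases "c (Suc n) = Some SymAlpha")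
      case True
      have "c i = make_column (Some (Suc n)) {} i" for i
        using ab[OF True, of i] dom[of i] F True
        by (cases "i = Suc n") (force simp: make_column_def)+
      thus ?thesis by (auto simp: fun_eq_iff)
    next
      case False
      hence bot: "c (Suc n) = Some SymBeta" using c cases[of "Suc n"] by (auto simp: column_fillings_def)
      show ?thesis
      proof (cases "\<exists>i. c i = Some SymAlpha")
        case True
        then obtain i where i: "c i = Some SymAlpha" by auto
        have iF: "i \<in> F" using dom[of i] i False by auto
        have "c = make_column (Some i) (insert (Suc n) D)"
        proof
          fix j show "c j = make_column (Some i) (insert (Suc n) D) j"
            using cases[of j] dom[of j] un[OF i, of j] bot i by (auto simp: make_column_def D_def)
        qed
        moreover have "D \<subseteq> F \<inter> {i<..}"
        proof
          fix j assume "j \<in> D"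
          hence "c j = Some SymBeta" "j \<in> F" by (auto simp: D_def)
          thus "j \<in> F \<inter> {i<..}" using ab[OF i, of j] i by (cases i j rule: linorder_cases) auto
        qed
        ultimately show ?thesis using iF by blast
      next
        case none: False
        have "c = make_column None (insert (Suc n) D)"
        proof
          fix j show "c j = make_column None (insert (Suc n) D) j"
            using cases[of j] dom[of j] none bot by (auto simp: make_column_def D_def)
        qed
        moreover have "D \<subseteq> F" by (auto simp: D_def)
        ultimately show ?thesis by blast
      qed
    qed
  qed
qed

lemma finite_column_fillings:
  assumes "F \<subseteq> {1..n}"
  shows "finite (column_fillings n F)"
  using finite_subset[OF assms] by (simp add: column_fillings_eq[OF assms])

lemma finite_staircase_tableaux: "finite (staircase_tableaux n)"
proof (induction n)
  case 0
  thus ?case by (simp add: staircase_tableaux_0)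
next
  case (Suc n)
  have "staircase_tableaux (Suc n) \<subseteq>
    (\<lambda>(S, c). add_column c S) ` (SIGMA S:staircase_tableaux n. column_fillings n (free_rows n S))"
  proof
    fix S assume S: "S \<in> staircase_tableaux (Suc n)"
    show "S \<in> (\<lambda>(S, c). add_column c S) ` (SIGMA S:staircase_tableaux n. column_fillings n (free_rows n S))"
      using drop_column_tableau[OF S] first_column_in_column_fillings[OF S] add_drop_column[OF S]
      by (intro image_eqI[of _ _ "(drop_column S, \<lambda>i. S (i, 1))"]) auto
  qed
  moreover have "finite (SIGMA S:staircase_tableaux n. column_fillings n (free_rows n S))"
    using Suc by (intro finite_SigmaI finite_column_fillings free_rows_subset)
  ultimately show ?case by (meson finite_imageI finite_subset)
qed

lemma sum_staircase_tableaux_Suc: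
  fixes f :: "filling \<Rightarrow> 'a :: comm_monoid_add"
  shows "(\<Sum>S\<in>staircase_tableaux (Suc n). f S) =
    (\<Sum>S\<in>staircase_tableaux n. \<Sum>c\<in>column_fillings n (free_rows n S). f (add_column c S))"
proof -
  have "(\<Sum>S\<in>staircase_tableaux n. \<Sum>c\<in>column_fillings n (free_rows n S). f (add_column c S)) =
    (\<Sum>(S, c)\<in>(SIGMA S:staircase_tableaux n. column_fillings n (free_rows n S)). f (add_column c S))"
    by (intro sum.Sigma ballI finite_column_fillings free_rows_subset finite_staircase_tableaux)
  also have "\<dots> = (\<Sum>S\<in>staircase_tableaux (Suc n). f S)"
  proof (rule sum.reindex_bij_witness[where j = "\<lambda>(S, c). add_column c S"
        and i = "\<lambda>S. (drop_column S, \<lambda>i. S (i, 1))"])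
  qed (auto simp: drop_add_column add_drop_column drop_column_tableau add_column_tableau
      first_column_in_column_fillings[simplified] add_drop_column[simplified] split del: if_split,
      auto simp: add_column_def)
  finally show ?thesis by simp
qed

lemma sum_column_fillings:
  fixes f :: "(nat \<Rightarrow> symbol option) \<Rightarrow> 'a :: comm_monoid_add"
  assumes F: "F \<subseteq> {1..n}"
  shows "(\<Sum>c\<in>column_fillings n F. f c) = f (make_column (Some (Suc n)) {}) +
    ((\<Sum>D\<in>Pow F. f (make_column None (insert (Suc n) D))) +
     (\<Sum>i\<in>F. \<Sum>D\<in>Pow (F \<inter> {i<..}). f (make_column (Some i) (insert (Suc n) D))))"
proof -
  have fin: "finite F" using F finite_subset by blast
  have ins: "insert (Suc n) D = insert (Suc n) E \<longleftrightarrow> D = E" if "D \<subseteq> F" "E \<subseteq> F" for D E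
    using that F by (metis atLeastAtMost_iff insert_ident not_less_eq_eq order_refl subsetD)
  define A where "A = (\<lambda>D. make_column None (insert (Suc n) D)) ` Pow F"
  define B where "B i = (\<lambda>D. make_column (Some i) (insert (Suc n) D)) ` Pow (F \<inter> {i<..})" for i
  have inj: "p = q \<and> D = E"
    if "make_column p (insert (Suc n) D) = make_column q (insert (Suc n) E)"
      "D \<subseteq> F" "E \<subseteq> F" "set_option p \<subseteq> F - D" "set_option q \<subseteq> F - E" for p q D E
    using make_column_inj[OF that(1)] that F ins[OF that(2,3)] by fastforce
  have top: "make_column (Some (Suc n)) {} \<notin> A \<union> (\<Union>i\<in>F. B i)"
    by (auto simp: A_def B_def make_column_def fun_eq_iff split: if_splits)
  have AB: "A \<inter> (\<Union>i\<in>F. B i) = {}"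
    by (auto simp: A_def B_def dest!: inj)
  have finAB: "finite A" "\<And>i. finite (B i)" using fin by (auto simp: A_def B_def)
  have "(\<Sum>c\<in>column_fillings n F. f c) = f (make_column (Some (Suc n)) {}) + (sum f A + sum f (\<Union>i\<in>F. B i))"
    unfolding column_fillings_eq[OF F] A_def[symmetric] B_def[symmetric]
    using top AB finAB fin by (simp add: sum.union_disjoint)
  also have "sum f A = (\<Sum>D\<in>Pow F. f (make_column None (insert (Suc n) D)))"
    unfolding A_def by (subst sum.reindex) (auto intro!: inj_onI dest!: inj)
  also have "sum f (\<Union>i\<in>F. B i) = (\<Sum>i\<in>F. sum f (B i))"
  proof (rule sum.UNION_disjoint)
    show "\<forall>i\<in>F. \<forall>j\<in>F. i \<noteq> j \<longrightarrow> B i \<inter> B j = {}"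
      by (auto simp: B_def dest!: inj)
  qed (use fin finAB in auto)
  also have "(\<Sum>i\<in>F. sum f (B i)) = (\<Sum>i\<in>F. \<Sum>D\<in>Pow (F \<inter> {i<..}). f (make_column (Some i) (insert (Suc n) D)))"
  proof (rule sum.cong[OF refl])
    fix i assume "i \<in> F"
    have "inj_on (\<lambda>D. make_column (Some i) (insert (Suc n) D)) (Pow (F \<inter> {i<..}))"
      using \<open>i \<in> F\<close> by (intro inj_onI) (auto dest!: inj)
    thus "sum f (B i) = (\<Sum>D\<in>Pow (F \<inter> {i<..}). f (make_column (Some i) (insert (Suc n) D)))"
      unfolding B_def by (simp add: sum.reindex)
  qed
  finally show ?thesis .
qed

section \<open>Transfer operators\<close>

lemma finite_column_alphas:
  assumes "c \<in> column_fillings n F" "F \<subseteq> {1..n}"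
  shows "finite {i. c i = Some s}"
proof -
  have "{i. c i = Some s} \<subseteq> insert (Suc n) F"
    using assms by (auto simp: column_fillings_def)
  thus ?thesis using assms finite_subset by (metis finite_atLeastAtMost finite_insert)
qed

lemma finite_symbol_set:
  assumes "S \<in> staircase_tableaux n"
  shows "finite {x. S x = Some s}"
proof -
  have "{x. S x = Some s} \<subseteq> {1..n} \<times> {1..n}"
    using tableau_inside[OF assms] by force
  thus ?thesis by (rule finite_subset) simp
qed

lemma num_symbol_add_column:
  assumes S: "S \<in> staircase_tableaux n" and c: "c \<in> column_fillings n (free_rows n S)"
  shows "num_symbol s (add_column c S) = card {i. c i = Some s} + num_symbol s S"
proof -
  have eq: "{x. add_column c S x = Some s} =
      (\<lambda>i. (i, 1)) ` {i. c i = Some s} \<union> (\<lambda>(i, j). (i, Suc j)) ` {x. S x = Some s}"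
    (is "?L = ?A \<union> ?B")
  proof (intro equalityI subsetI)
    fix x assume x: "x \<in> ?L"
    obtain i j where ij: "x = (i, j)" by (cases x)
    show "x \<in> ?A \<union> ?B"
    proof (cases "j = 1")
      case True
      thus ?thesis using x by (auto simp: ij add_column_def)
    next
      case False
      hence "j = Suc (j - 1)" "S (i, j - 1) = Some s"
        using x by (auto simp: ij add_column_def split: if_splits)
      hence "x = (\<lambda>(i, j). (i, Suc j)) (i, j - 1)" "(i, j - 1) \<in> {x. S x = Some s}" by (auto simp: ij)
      thus ?thesis by blast
    qed
  next
    fix x assume "x \<in> ?A \<union> ?B"
    thus "x \<in> ?L"
    proof
      assume "x \<in> ?B"
      then obtain i j where "x = (i, Suc j)" "S (i, j) = Some s" by auto
      moreover from this have "1 \<le> j" using tableau_inside(2)[OF S, of i j] by simp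
      ultimately show ?thesis by (auto simp: add_column_def)
    qed (auto simp: add_column_def)
  qed
  have dis: "?A \<inter> ?B = {}"
  proof -
    have "S (i, 0) \<noteq> Some s" for i using tableau_outside[OF S, of i 0] by simp
    thus ?thesis by auto
  qed
  have "finite ?A" "finite ?B"
    using finite_column_alphas[OF c free_rows_subset] finite_symbol_set[OF S] by auto
  hence "num_symbol s (add_column c S) = card ?A + card ?B"
    unfolding num_symbol_def eq using dis by (intro card_Un_disjoint)
  also have "card ?A = card {i. c i = Some s}" by (intro card_image) (auto intro: inj_onI)
  also have "card ?B = num_symbol s S"
    unfolding num_symbol_def by (intro card_image) (auto intro: inj_onI)
  finally show ?thesis .
qed

lemma make_column_SymBeta: "{i. make_column p D i = Some SymBeta} = D"
  by (auto simp: make_column_def)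

lemma make_column_SymAlpha: "{i. make_column p D i = Some SymAlpha} = set_option p - D"
  by (auto simp: make_column_def split: if_splits)

lemma free_rows_add_column:
  assumes S: "S \<in> staircase_tableaux n"
  shows "free_rows (Suc n) (add_column c S) =
    insert (Suc n) (free_rows n S) - {i. c i = Some SymBeta}"
proof -
  have "S (Suc n, j) = None" for j using tableau_outside[OF S, of "Suc n" j] by auto
  moreover have "(\<forall>j. add_column c S (i, j) \<noteq> Some SymBeta) \<longleftrightarrow>
      c i \<noteq> Some SymBeta \<and> (\<forall>j. S (i, j) \<noteq> Some SymBeta)" for i
  proof
    assume L: "\<forall>j. add_column c S (i, j) \<noteq> Some SymBeta"
    have "S (i, j) \<noteq> Some SymBeta" for j
    proof (cases "j = 0")
      case True thus ?thesis using tableau_outside[OF S, of i 0] by simp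
    next
      case False thus ?thesis using L[rule_format, of "Suc j"] by (simp add: add_column_def)
    qed
    moreover have "c i \<noteq> Some SymBeta" using L[rule_format, of 1] by (simp add: add_column_def)
    ultimately show "c i \<noteq> Some SymBeta \<and> (\<forall>j. S (i, j) \<noteq> Some SymBeta)" by simp
  qed (auto simp: add_column_def)
  ultimately show ?thesis unfolding free_rows_def by (auto simp: le_Suc_eq)
qed

section \<open>Binomial and telescoping sums for a single column\<close>

lemma sum_Pow_power:
  fixes x y :: "'a :: comm_semiring_1"
  assumes "finite A"
  shows "(\<Sum>D\<in>Pow A. y ^ card D * x ^ card (A - D)) = (x + y) ^ card A"
  using prod_add[OF assms, of "\<lambda>_. y" "\<lambda>_. x"] by (simp add: add.commute)

text \<open>If \<open>i\<close> has a elements of \<open>A\<close> below it and b above it, its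
  summand is x^a (x + y)^(b + 1) - x^(a + 1) (x + y)^b. The next larger element turns (a, b) into (a
  + 1, b - 1), so the sum telescopes.\<close>

lemma sum_telescope_power:
  fixes x y :: "'a :: comm_ring_1" and A :: "nat set"
  assumes "finite A"
  shows "(\<Sum>i\<in>A. y * x ^ card (A \<inter> {..<i}) * (x + y) ^ card (A \<inter> {i<..})) =
    (x + y) ^ card A - x ^ card A"
  using assms
proof (induction A rule: finite_linorder_max_induct)
  case (insert b A)
  have b: "b \<notin> A" using insert by auto
  have eq: "insert b A \<inter> {..<i} = A \<inter> {..<i}" "insert b A \<inter> {i<..} = insert b (A \<inter> {i<..})"
    if "i \<in> A" for i using that insert by auto
  have eqb: "insert b A \<inter> {..<b} = A" "insert b A \<inter> {b<..} = {}"
    using insert by auto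
  have "(\<Sum>i\<in>insert b A. y * x ^ card (insert b A \<inter> {..<i}) * (x + y) ^ card (insert b A \<inter> {i<..})) =
     y * x ^ card A + (\<Sum>i\<in>A. y * x ^ card (insert b A \<inter> {..<i}) * (x + y) ^ card (insert b A \<inter> {i<..}))"
    using b insert(1) eqb by simp
  also have "(\<Sum>i\<in>A. y * x ^ card (insert b A \<inter> {..<i}) * (x + y) ^ card (insert b A \<inter> {i<..})) =
     (x + y) * (\<Sum>i\<in>A. y * x ^ card (A \<inter> {..<i}) * (x + y) ^ card (A \<inter> {i<..}))"
    unfolding sum_distrib_left
  proof (rule sum.cong[OF refl])
    fix i assume i: "i \<in> A"
    have "card (insert b (A \<inter> {i<..})) = Suc (card (A \<inter> {i<..}))"
      using b insert(1) by (subst card_insert_disjoint) auto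
    thus "y * x ^ card (insert b A \<inter> {..<i}) * (x + y) ^ card (insert b A \<inter> {i<..}) =
      (x + y) * (y * x ^ card (A \<inter> {..<i}) * (x + y) ^ card (A \<inter> {i<..}))"
      by (simp add: eq[OF i] mult_ac)
  qed
  finally have "(\<Sum>i\<in>insert b A. y * x ^ card (insert b A \<inter> {..<i}) * (x + y) ^ card (insert b A \<inter> {i<..})) =
     y * x ^ card A + (x + y) * ((x + y) ^ card A - x ^ card A)"
    unfolding insert.IH .
  thus ?case using b insert(1) by (simp add: algebra_simps)
qed simp

locale staircase_weights =
  fixes al be :: real
  assumes al_pos: "al > 0" and be_pos: "be > 0"
begin

text \<open>Summing out the leftmost column turns a function \<open>g\<close> of the rows without \<open>\<beta>\<close>
  into \<open>transfer n q g\<close>; the factor \<open>q\<close> of that column singles out an event.\<close>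

definition transfer ::
  "nat \<Rightarrow> ((nat \<Rightarrow> symbol option) \<Rightarrow> real) \<Rightarrow> (nat set \<Rightarrow> real) \<Rightarrow> nat set \<Rightarrow> real" where
  "transfer n q g F = (\<Sum>c\<in>column_fillings n F.
     al ^ card {i. c i = Some SymAlpha} * be ^ card {i. c i = Some SymBeta} * q c *
     g (insert (Suc n) F - {i. c i = Some SymBeta}))"

text \<open>\<open>h\<close> sees only the tableau without its leftmost column, so it is constant in
  the sum over that column. Vector values cover real bounds and complex characteristic functions at
  once.\<close>

lemma sum_weight_add_column:
  fixes h :: "filling \<Rightarrow> 'a :: real_vector"
  shows "(\<Sum>S\<in>staircase_tableaux (Suc n).
      (weight al be S * q (\<lambda>i. S (i, 1)) * g (free_rows (Suc n) S)) *\<^sub>R h (drop_column S)) =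
    (\<Sum>S\<in>staircase_tableaux n. (weight al be S * transfer n q g (free_rows n S)) *\<^sub>R h S)"
  unfolding sum_staircase_tableaux_Suc
proof (rule sum.cong[OF refl])
  fix S assume S: "S \<in> staircase_tableaux n"
  let ?C = "column_fillings n (free_rows n S)"
  have "(\<Sum>c\<in>?C. (weight al be (add_column c S) * q (\<lambda>i. add_column c S (i, 1)) *
        g (free_rows (Suc n) (add_column c S))) *\<^sub>R h (drop_column (add_column c S))) =
     (\<Sum>c\<in>?C. (weight al be S * (al ^ card {i. c i = Some SymAlpha} * be ^ card {i. c i = Some SymBeta} * q c *
     g (insert (Suc n) (free_rows n S) - {i. c i = Some SymBeta}))) *\<^sub>R h S)"
  proof (rule sum.cong[OF refl])
    fix c assume c: "c \<in> ?C"
    have "(\<lambda>i. add_column c S (i, 1)) = c" by (simp add: add_column_def)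
    thus "(weight al be (add_column c S) * q (\<lambda>i. add_column c S (i, 1)) *
        g (free_rows (Suc n) (add_column c S))) *\<^sub>R h (drop_column (add_column c S)) =
      (weight al be S * (al ^ card {i. c i = Some SymAlpha} * be ^ card {i. c i = Some SymBeta} * q c *
      g (insert (Suc n) (free_rows n S) - {i. c i = Some SymBeta}))) *\<^sub>R h S"
      by (simp add: weight_def num_symbol_add_column[OF S c] free_rows_add_column[OF S]
          drop_add_column[OF S] power_add mult_ac)
  qed
  also have "\<dots> = (weight al be S * transfer n q g (free_rows n S)) *\<^sub>R h S"
    by (simp add: transfer_def sum_distrib_left scaleR_sum_left)
  finally show "(\<Sum>c\<in>?C. (weight al be (add_column c S) * q (\<lambda>i. add_column c S (i, 1)) *
        g (free_rows (Suc n) (add_column c S))) *\<^sub>R h (drop_column (add_column c S))) = \<dots>" .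
qed

lemma transfer_eq:
  assumes F: "F \<subseteq> {1..n}"
  shows "transfer n q g F = al * q (make_column (Some (Suc n)) {}) * g (insert (Suc n) F) +
    ((\<Sum>D\<in>Pow F. be * be ^ card D * q (make_column None (insert (Suc n) D)) * g (F - D)) +
     (\<Sum>i\<in>F. \<Sum>D\<in>Pow (F \<inter> {i<..}).
        al * be * be ^ card D * q (make_column (Some i) (insert (Suc n) D)) * g (F - D)))"
proof -
  have n: "Suc n \<notin> F" and fin: "finite F" using F finite_subset by auto
  have D: "card (insert (Suc n) D) = Suc (card D)" "insert (Suc n) F - insert (Suc n) D = F - D"
    if "D \<subseteq> F" for D
    using that n finite_subset[OF that fin] by (auto intro!: card_insert_disjoint)
  have 3: "set_option (Some i) - insert (Suc n) D = {i}" if "i \<in> F" "D \<subseteq> F \<inter> {i<..}" for i D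
    using that n by auto
  show ?thesis
    unfolding transfer_def sum_column_fillings[OF F] make_column_SymAlpha make_column_SymBeta
  proof (intro arg_cong2[where f = "(+)"] sum.cong refl)
    fix i D assume "i \<in> F" "D \<in> Pow (F \<inter> {i<..})"
    thus "al ^ card (set_option (Some i) - insert (Suc n) D) * be ^ card (insert (Suc n) D) *
        q (make_column (Some i) (insert (Suc n) D)) * g (insert (Suc n) F - insert (Suc n) D) =
      al * be * be ^ card D * q (make_column (Some i) (insert (Suc n) D)) * g (F - D)"
      using D[of D] 3[of i D] by auto
  qed (use n D in auto)
qed

text \<open>This is the sum over columns with an \<alpha> in row \<open>i\<close>: there is no
  \<beta> above it, so rows up to \<open>i\<close> keep their factor \<open>x\<close>, and only the
  rows below are summed binomially.\<close>

lemma sum_Pow_above: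
  fixes A F :: "nat set"
  assumes "finite F"
  shows "(\<Sum>D\<in>Pow (F \<inter> {i<..}). be ^ card D * x ^ card (F - D)) =
    x ^ card (F \<inter> {..i}) * (x + be) ^ card (F \<inter> {i<..})"
proof -
  have "card (F - D) = card (F \<inter> {..i}) + card (F \<inter> {i<..} - D)" if "D \<subseteq> F \<inter> {i<..}" for D
  proof -
    have eq: "F - D = (F \<inter> {..i}) \<union> (F \<inter> {i<..} - D)" using that by auto
    show ?thesis unfolding eq using assms by (intro card_Un_disjoint) auto
  qed
  hence "(\<Sum>D\<in>Pow (F \<inter> {i<..}). be ^ card D * x ^ card (F - D)) =
    (\<Sum>D\<in>Pow (F \<inter> {i<..}). x ^ card (F \<inter> {..i}) * (be ^ card D * x ^ card (F \<inter> {i<..} - D)))"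
    by (intro sum.cong) (auto simp: power_add)
  also have "\<dots> = x ^ card (F \<inter> {..i}) * (x + be) ^ card (F \<inter> {i<..})"
    unfolding sum_distrib_left[symmetric] using assms by (subst sum_Pow_power) auto
  finally show ?thesis .
qed

lemma card_atMost_inter:
  fixes F :: "nat set"
  assumes "finite F" "i \<in> F"
  shows "card (F \<inter> {..i}) = Suc (card (F \<inter> {..<i}))"
proof -
  have "F \<inter> {..i} = insert i (F \<inter> {..<i})" using assms by auto
  thus ?thesis using assms by simp
qed

text \<open>The sum over the row of the \<alpha> telescopes, and its negative end term cancels the
  contribution of the column whose only symbol is an \<alpha> at the bottom.\<close>

lemma transfer_power:
  assumes F: "F \<subseteq> {1..n}"
  shows "transfer n (\<lambda>_. 1) (\<lambda>F. x ^ card F) F = (al * x + be) * (x + be) ^ card F"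
proof -
  have n: "Suc n \<notin> F" and fin: "finite F" using F finite_subset by auto
  have "(\<Sum>D\<in>Pow F. be * be ^ card D * 1 * x ^ card (F - D)) = be * (x + be) ^ card F"
    using sum_Pow_power[OF fin, of be x] by (simp add: sum_distrib_left[symmetric] mult.assoc)
  moreover have "(\<Sum>i\<in>F. \<Sum>D\<in>Pow (F \<inter> {i<..}). al * be * be ^ card D * 1 * x ^ card (F - D)) =
      al * x * (\<Sum>i\<in>F. be * x ^ card (F \<inter> {..<i}) * (x + be) ^ card (F \<inter> {i<..}))"
    unfolding sum_distrib_left
  proof (rule sum.cong[OF refl])
    fix i assume i: "i \<in> F"
    have "(\<Sum>D\<in>Pow (F \<inter> {i<..}). al * be * be ^ card D * 1 * x ^ card (F - D)) =
      al * be * (\<Sum>D\<in>Pow (F \<inter> {i<..}). be ^ card D * x ^ card (F - D))"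
      by (simp add: sum_distrib_left mult.assoc del: Pow_Int_eq)
    thus "(\<Sum>D\<in>Pow (F \<inter> {i<..}). al * be * be ^ card D * 1 * x ^ card (F - D)) =
      al * x * (be * x ^ card (F \<inter> {..<i}) * (x + be) ^ card (F \<inter> {i<..}))"
      by (simp add: sum_Pow_above[OF fin] card_atMost_inter[OF fin i] del: Pow_Int_eq)
  qed
  ultimately have "transfer n (\<lambda>_. 1) (\<lambda>F. x ^ card F) F =
      al * (x * x ^ card F) + (be * (x + be) ^ card F + al * x * ((x + be) ^ card F - x ^ card F))"
    unfolding transfer_eq[OF F] sum_telescope_power[OF fin] using n fin by simp
  thus ?thesis by (simp add: algebra_simps)
qed

lemma transfer_alpha_power:
  assumes F: "F \<subseteq> {1..n}" and i: "i \<le> n"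
  shows "transfer n (\<lambda>c. of_bool (c i = Some SymAlpha)) (\<lambda>F. x ^ card F) F =
    (if i \<in> F then al * be * x * (x ^ card (F \<inter> {..<i}) * (x + be) ^ card (F \<inter> {i<..})) else 0)"
proof -
  have n: "Suc n \<notin> F" and fin: "finite F" using F finite_subset by auto
  let ?q = "\<lambda>c. of_bool (c i = Some SymAlpha) :: real"
  have q1: "?q (make_column (Some (Suc n)) {}) = 0" "?q (make_column None D) = 0" for D
    using i by (auto simp: make_column_def)
  have q2: "?q (make_column (Some i') (insert (Suc n) D)) = of_bool (i' = i)"
    if "D \<subseteq> F \<inter> {i'<..}" for i' D using i that by (auto simp: make_column_def)
  have "transfer n ?q (\<lambda>F. x ^ card F) F = (\<Sum>i'\<in>F. \<Sum>D\<in>Pow (F \<inter> {i'<..}).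
        al * be * be ^ card D * of_bool (i' = i) * x ^ card (F - D))"
    unfolding transfer_eq[OF F] q1 using q2 by (simp add: q1 del: Pow_Int_eq)
  also have "\<dots> = (\<Sum>i'\<in>F. if i' = i then (\<Sum>D\<in>Pow (F \<inter> {i'<..}).
        al * be * be ^ card D * x ^ card (F - D)) else 0)"
    by (intro sum.cong) auto
  also have "\<dots> = (if i \<in> F then al * be * (\<Sum>D\<in>Pow (F \<inter> {i<..}). be ^ card D * x ^ card (F - D)) else 0)"
    using fin by (simp add: sum_distrib_left mult.assoc del: Pow_Int_eq)
  also have "\<dots> = (if i \<in> F then al * be * x * (x ^ card (F \<inter> {..<i}) * (x + be) ^ card (F \<inter> {i<..})) else 0)"
    by (simp add: sum_Pow_above[OF fin] card_atMost_inter[OF fin] del: Pow_Int_eq)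
  finally show ?thesis .
qed

text \<open>A demanded \<alpha> in row \<open>i\<close> requires \<open>i\<close> to be free and
  makes the factors of the rows above and below it differ (see \<open>transfer_alpha_power\<close>).
  Functions of this form are closed under further columns, until the column that creates row
  \<open>i\<close>.\<close>

definition marked_power :: "nat \<Rightarrow> real \<Rightarrow> real \<Rightarrow> nat set \<Rightarrow> real" where
  "marked_power i x y F =
    (if i \<in> F then x ^ card (F \<inter> {..<i}) * y ^ card (F \<inter> {i<..}) else 0)"

text \<open>The new row stays free only if its first symbol is \<alpha>; that \<alpha> empties the
  column above, so the status of the older rows does not change.\<close>

lemma transfer_marked_power_new:
  assumes F: "F \<subseteq> {1..n}"
  shows "transfer n (\<lambda>_. 1) (marked_power (Suc n) x y) F = al * x ^ card F"
proof -
  have "Suc n \<notin> F" using F by auto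
  moreover have "insert (Suc n) F \<inter> {..<Suc n} = F" "insert (Suc n) F \<inter> {Suc n<..} = {}"
    using F by auto
  ultimately show ?thesis
    unfolding transfer_eq[OF F] by (simp add: marked_power_def)
qed

lemma sum_Pow_marked:
  assumes fin: "finite F" and i: "i \<in> F" and C: "C \<subseteq> F"
  shows "(\<Sum>D\<in>Pow C. be ^ card D * marked_power i x y (F - D)) =
    x ^ card ((F - C) \<inter> {..<i}) * (x + be) ^ card (C \<inter> {..<i}) *
    (y ^ card ((F - C) \<inter> {i<..}) * (y + be) ^ card (C \<inter> {i<..}))"
proof -
  \<comment> \<open>The sum over subsets becomes a product over rows: \<open>u\<close> is the factor
    of a row that stays free, \<open>f\<close> that of a row receiving a \<beta>. Row
    \<open>i\<close> must stay free, hence \<open>f i = 0\<close> and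
    \<open>u i = 1\<close>.\<close>
  define u where "u j = (if j < i then x else if j = i then 1 else y)" for j
  define f where "f j = (if j = i then 0 else be)" for j
  have prod_split: "prod v A = prod v (A \<inter> {..<i}) * prod v (A \<inter> {i<..})"
    if "v i = 1" "A \<subseteq> F" for v :: "nat \<Rightarrow> real" and A
  proof -
    have fA: "finite A" using that fin finite_subset by blast
    have eq: "A - {i} = (A \<inter> {..<i}) \<union> (A \<inter> {i<..})" by auto
    have "prod v (A - {i}) = prod v (A \<inter> {..<i}) * prod v (A \<inter> {i<..})"
      unfolding eq using fA by (intro prod.union_disjoint) auto
    moreover have "prod v A = prod v (A - {i})"
      using fA that by (intro prod.mono_neutral_right) auto
    ultimately show ?thesis by simp
  qed
  have pu: "prod u A = x ^ card (A \<inter> {..<i}) * y ^ card (A \<inter> {i<..})" if "A \<subseteq> F" for A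
  proof -
    have "prod u (A \<inter> {..<i}) = (\<Prod>_\<in>A \<inter> {..<i}. x)" "prod u (A \<inter> {i<..}) = (\<Prod>_\<in>A \<inter> {i<..}. y)"
      by (intro prod.cong; force simp: u_def)+
    thus ?thesis using prod_split[of u A] that by (simp add: u_def)
  qed
  have puf: "(\<Prod>j\<in>A. f j + u j) = (x + be) ^ card (A \<inter> {..<i}) * (y + be) ^ card (A \<inter> {i<..})"
    if "A \<subseteq> F" for A
  proof -
    have "(\<Prod>j\<in>A \<inter> {..<i}. f j + u j) = (\<Prod>_\<in>A \<inter> {..<i}. x + be)"
      "(\<Prod>j\<in>A \<inter> {i<..}. f j + u j) = (\<Prod>_\<in>A \<inter> {i<..}. y + be)"
      by (intro prod.cong; force simp: u_def f_def)+
    thus ?thesis using prod_split[of "\<lambda>j. f j + u j" A] that by (simp add: u_def f_def)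
  qed
  have "be ^ card D * marked_power i x y (F - D) = prod u (F - C) * (prod f D * prod u (C - D))"
    if D: "D \<subseteq> C" for D
  proof -
    have fD: "finite D" using D C fin by (meson finite_subset)
    have FD: "F - D = (F - C) \<union> (C - D)" using D C by auto
    have u: "prod u (F - D) = prod u (F - C) * prod u (C - D)"
      unfolding FD using fin C by (intro prod.union_disjoint) (auto intro: finite_subset)
    show ?thesis
    proof (cases "i \<in> D")
      case True
      hence "prod f D = 0" using fD by (auto simp: f_def)
      thus ?thesis using True by (simp add: marked_power_def)
    next
      case False
      have "prod f D = (\<Prod>_\<in>D. be)" using False by (intro prod.cong) (auto simp: f_def)
      moreover have "marked_power i x y (F - D) = prod u (F - D)"
        using False i pu[of "F - D"] by (simp add: marked_power_def)
      ultimately show ?thesis by (simp add: u)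
    qed
  qed
  hence "(\<Sum>D\<in>Pow C. be ^ card D * marked_power i x y (F - D)) =
      prod u (F - C) * (\<Sum>D\<in>Pow C. prod f D * prod u (C - D))"
    unfolding sum_distrib_left by (intro sum.cong) auto
  also have "(\<Sum>D\<in>Pow C. prod f D * prod u (C - D)) = (\<Prod>j\<in>C. f j + u j)"
    using C fin by (subst prod_add) (auto intro: finite_subset)
  finally show ?thesis using pu[of "F - C"] puf[OF C] by (simp add: mult_ac)
qed

text \<open>The \<alpha> of the column lies above row \<open>k\<close>, in it, or below it. The
  first and last cases telescope separately; the products of two unshifted powers cancel against the
  column with \<alpha> at the bottom, which leaves only the two shapes on the right.\<close>

lemma transfer_marked_power:
  assumes F: "F \<subseteq> {1..n}" and k: "k \<le> n"
  shows "transfer n (\<lambda>_. 1) (marked_power k x y) F =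
    al * (y - x + be) * marked_power k x (y + be) F +
    (al * x + be) * marked_power k (x + be) (y + be) F"
proof (cases "k \<in> F")
  case False
  hence "k \<notin> F - D" "k \<notin> insert (Suc n) F" for D using k by auto
  thus ?thesis using False unfolding transfer_eq[OF F] by (simp add: marked_power_def)
next
  case True
  have n: "Suc n \<notin> F" and fin: "finite F" using F finite_subset by auto
  define A where "A = F \<inter> {..<k}"
  define B where "B = F \<inter> {k<..}"
  have FAB: "F = A \<union> ({k} \<union> B)" "A \<inter> ({k} \<union> B) = {}" "k \<notin> B" and fAB: "finite A" "finite B"
    using True fin by (auto simp: A_def B_def)
  define g where "g = marked_power k x y"
  define X where "X = x ^ card A"
  define X' where "X' = (x + be) ^ card A"
  define Y where "Y = y ^ card B"
  define Y' where "Y' = (y + be) ^ card B"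
  have "insert (Suc n) F \<inter> {..<k} = A" "insert (Suc n) F \<inter> {k<..} = insert (Suc n) B"
    using k by (auto simp: A_def B_def)
  moreover have "card (insert (Suc n) B) = Suc (card B)"
    using n fAB by (intro card_insert_disjoint) (auto simp: B_def)
  ultimately have T1: "g (insert (Suc n) F) = X * (y * Y)"
    using True by (simp add: g_def marked_power_def X_def Y_def)
  have T2: "(\<Sum>D\<in>Pow F. be * be ^ card D * 1 * g (F - D)) = be * (X' * Y')"
    using sum_Pow_marked[OF fin True order_refl, of x y]
    by (simp add: sum_distrib_left[symmetric] mult.assoc g_def X'_def Y'_def A_def B_def)
  define s where "s i = (\<Sum>D\<in>Pow (F \<inter> {i<..}). be ^ card D * g (F - D))" for i
  have s: "s i = x ^ card (F \<inter> {..i} \<inter> {..<k}) * (x + be) ^ card (F \<inter> {i<..} \<inter> {..<k}) *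
     (y ^ card (F \<inter> {..i} \<inter> {k<..}) * (y + be) ^ card (F \<inter> {i<..} \<inter> {k<..}))" for i
  proof -
    have "F - F \<inter> {i<..} = F \<inter> {..i}" by auto
    thus ?thesis using sum_Pow_marked[OF fin True, of "F \<inter> {i<..}" x y]
      by (simp add: s_def g_def del: Pow_Int_eq)
  qed
  have sA: "be * s i = x * Y' * (be * x ^ card (A \<inter> {..<i}) * (x + be) ^ card (A \<inter> {i<..}))"
    if i: "i \<in> A" for i
  proof -
    have "F \<inter> {..i} \<inter> {..<k} = A \<inter> {..i}" "F \<inter> {i<..} \<inter> {..<k} = A \<inter> {i<..}"
      "F \<inter> {..i} \<inter> {k<..} = {}" "F \<inter> {i<..} \<inter> {k<..} = B"
      using i by (auto simp: A_def B_def)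
    thus ?thesis unfolding s using card_atMost_inter[OF fAB(1) i] by (simp add: Y'_def)
  qed
  have sB: "be * s i = y * X * (be * y ^ card (B \<inter> {..<i}) * (y + be) ^ card (B \<inter> {i<..}))"
    if i: "i \<in> B" for i
  proof -
    have "F \<inter> {..i} \<inter> {..<k} = A" "F \<inter> {i<..} \<inter> {..<k} = {}"
      "F \<inter> {..i} \<inter> {k<..} = B \<inter> {..i}" "F \<inter> {i<..} \<inter> {k<..} = B \<inter> {i<..}"
      using i by (auto simp: A_def B_def)
    thus ?thesis unfolding s using card_atMost_inter[OF fAB(2) i] by (simp add: X_def)
  qed
  have sk: "s k = X * Y'"
  proof -
    have "F \<inter> {..k} \<inter> {..<k} = A" "F \<inter> {k<..} \<inter> {..<k} = {}"
      "F \<inter> {..k} \<inter> {k<..} = {}" "F \<inter> {k<..} \<inter> {k<..} = B"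
      by (auto simp: A_def B_def)
    thus ?thesis by (simp only: s X_def Y'_def) simp
  qed
  have "(\<Sum>i\<in>F. \<Sum>D\<in>Pow (F \<inter> {i<..}). al * be * be ^ card D * 1 * g (F - D)) =
      al * (\<Sum>i\<in>F. be * s i)"
    by (simp add: s_def sum_distrib_left mult.assoc del: Pow_Int_eq)
  also have "(\<Sum>i\<in>F. be * s i) = (\<Sum>i\<in>A. be * s i) + (be * s k + (\<Sum>i\<in>B. be * s i))"
    using FAB fAB by (subst FAB(1), subst sum.union_disjoint) auto
  also have "(\<Sum>i\<in>A. be * s i) = x * Y' * (X' - X)"
    using sum_telescope_power[OF fAB(1), of be x]
    by (simp add: sA sum_distrib_left[symmetric] X_def X'_def)
  also have "(\<Sum>i\<in>B. be * s i) = y * X * (Y' - Y)"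
    using sum_telescope_power[OF fAB(2), of be y]
    by (simp add: sB sum_distrib_left[symmetric] Y_def Y'_def)
  finally have T3: "(\<Sum>i\<in>F. \<Sum>D\<in>Pow (F \<inter> {i<..}). al * be * be ^ card D * 1 * g (F - D)) =
    al * (x * Y' * (X' - X) + (be * (X * Y') + y * X * (Y' - Y)))" by (simp add: sk)
  have "transfer n (\<lambda>_. 1) g F = al * (X * (y * Y)) + (be * (X' * Y') +
     al * (x * Y' * (X' - X) + (be * (X * Y') + y * X * (Y' - Y))))"
    unfolding transfer_eq[OF F] T1 T2 T3 by simp
  also have "\<dots> = al * (y - x + be) * (X * Y') + (al * x + be) * (X' * Y')"
    by (simp add: algebra_simps)
  finally show ?thesis using True by (simp add: g_def marked_power_def X_def X'_def Y'_def A_def B_def)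
qed

end

section \<open>Generating functions over separated columns\<close>

text \<open>The normalised effect of \<open>p\<close> columns on a marked power with arguments 1 + s
  \<beta> and 1 + (s + j) \<beta>, where t is s plus the number of remaining columns. A column
  either raises \<open>s\<close> and keeps \<open>j\<close> and \<open>t\<close>, or raises the gap
  \<open>j\<close> and lowers \<open>t\<close>; these are the two terms of
  \<open>transfer_marked_power\<close>.\<close>

primrec window_sum :: "real \<Rightarrow> (nat \<Rightarrow> 'a :: real_vector) \<Rightarrow> nat \<Rightarrow> nat \<Rightarrow> nat \<Rightarrow> 'a" where
  "window_sum \<theta> f 0 j t = f t"
| "window_sum \<theta> f (Suc p) j t = window_sum \<theta> f p j t +
     ((real j + 1) / (real t - 1 + \<theta>)) *\<^sub>R window_sum \<theta> f p (Suc j) (t - 1)"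

context staircase_weights
begin

section \<open>Normalised sums along the arguments 1 + s \<beta>\<close>

definition weighted_sum :: "nat \<Rightarrow> (filling \<Rightarrow> 'a :: real_vector) \<Rightarrow> (nat set \<Rightarrow> real) \<Rightarrow> 'a" where
  "weighted_sum n h g = (\<Sum>S\<in>staircase_tableaux n. (weight al be S * g (free_rows n S)) *\<^sub>R h S)"

text \<open>The orbit of 1 under the shift by \<open>be\<close> that each column causes. It starts
  at 1 because the statistic 1^|F| is trivial and gives plain sums over tableaux.\<close>

definition base :: "nat \<Rightarrow> real" where "base s = 1 + real s * be"

text \<open>Chosen so that the prefactor \<open>al * base s + be\<close> is \<open>al * be\<close>
  times \<open>real s + theta\<close>; successive columns then multiply to a Pochhammer
  symbol.\<close>

definition theta :: real where "theta = 1 / al + 1 / be"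

lemma theta_pos: "theta > 0"
  using al_pos be_pos by (simp add: theta_def add_pos_pos)

lemma base_pos: "base s > 0"
  using be_pos by (simp add: base_def add_pos_nonneg)

lemma base_add: "base s + be = base (Suc s)"
  by (simp add: base_def algebra_simps)

lemma base_eq: "base s = be * (real s + 1 / be)"
  using be_pos by (simp add: base_def field_simps)

lemma al_base: "al * base s + be = al * be * (real s + theta)"
  using al_pos be_pos by (simp add: base_def theta_def field_simps)

lemma weighted_sum_cong:
  assumes "\<And>F. F \<subseteq> {1..n} \<Longrightarrow> g F = g' F"
  shows "weighted_sum n h g = weighted_sum n h g'"
  unfolding weighted_sum_def using assms[OF free_rows_subset] by simp

lemma weighted_sum_linear:
  "weighted_sum n h (\<lambda>F. c * g F + d * g' F) = c *\<^sub>R weighted_sum n h g + d *\<^sub>R weighted_sum n h g'"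
  unfolding weighted_sum_def
  by (simp add: scaleR_sum_right sum.distrib scaleR_add_left distrib_left mult_ac)

lemma weighted_sum_scale: "weighted_sum n h (\<lambda>F. c * g F) = c *\<^sub>R weighted_sum n h g"
  using weighted_sum_linear[of n h c g 0 g] by simp

lemma weighted_sum_Suc:
  "weighted_sum (Suc n) (\<lambda>S. h (drop_column S)) g = weighted_sum n h (transfer n (\<lambda>_. 1) g)"
  using sum_weight_add_column[where q = "\<lambda>_. 1" and g = g and h = h and n = n] by (simp add: weighted_sum_def)

lemma weighted_sum_power:
  "weighted_sum (Suc n) (\<lambda>S. h (drop_column S)) (\<lambda>F. base s ^ card F) =
    (al * be * (real s + theta)) *\<^sub>R weighted_sum n h (\<lambda>F. base (Suc s) ^ card F)"
  unfolding weighted_sum_Suc weighted_sum_scale[symmetric]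
  by (rule weighted_sum_cong) (simp add: transfer_power al_base base_add)

lemma weighted_sum_marked_new:
  "weighted_sum (Suc n) (\<lambda>S. h (drop_column S)) (marked_power (Suc n) (base s) y) =
    al *\<^sub>R weighted_sum n h (\<lambda>F. base s ^ card F)"
  unfolding weighted_sum_Suc weighted_sum_scale[symmetric]
  by (rule weighted_sum_cong) (simp add: transfer_marked_power_new)

lemma weighted_sum_marked:
  assumes "i \<le> n"
  shows "weighted_sum (Suc n) (\<lambda>S. h (drop_column S)) (marked_power i (base s) (base (s + j))) =
    (al * be * (real j + 1)) *\<^sub>R weighted_sum n h (marked_power i (base s) (base (s + Suc j))) +
    (al * be * (real s + theta)) *\<^sub>R weighted_sum n h (marked_power i (base (Suc s)) (base (Suc s + j)))"
  unfolding weighted_sum_Suc weighted_sum_linear[symmetric]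
proof (rule weighted_sum_cong)
  fix F :: "nat set" assume F: "F \<subseteq> {1..n}"
  have "al * (base (s + j) - base s + be) = al * be * (real j + 1)"
    by (simp add: base_def algebra_simps)
  thus "transfer n (\<lambda>_. 1) (marked_power i (base s) (base (s + j))) F =
      al * be * (real j + 1) * marked_power i (base s) (base (s + Suc j)) F +
      al * be * (real s + theta) * marked_power i (base (Suc s)) (base (Suc s + j)) F"
    unfolding transfer_marked_power[OF F assms] al_base by (simp add: base_add)
qed

lemma weighted_sum_alpha_transfer:
  "weighted_sum (Suc n) (\<lambda>S. of_bool (S (i, 1) = Some SymAlpha) *\<^sub>R h (drop_column S)) g =
    weighted_sum n h (transfer n (\<lambda>c. of_bool (c i = Some SymAlpha)) g)"
  using sum_weight_add_column[where q = "\<lambda>c. of_bool (c i = Some SymAlpha)" and g = g and h = h and n = n]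
  by (simp add: weighted_sum_def mult_ac)

lemma weighted_sum_alpha:
  assumes "i \<le> n"
  shows "weighted_sum (Suc n) (\<lambda>S. of_bool (S (i, 1) = Some SymAlpha) *\<^sub>R h (drop_column S))
      (\<lambda>F. base s ^ card F) =
    (al * be * base s) *\<^sub>R weighted_sum n h (marked_power i (base s) (base (Suc s)))"
  unfolding weighted_sum_alpha_transfer weighted_sum_scale[symmetric]
  by (rule weighted_sum_cong)
    (use assms in \<open>simp add: transfer_alpha_power marked_power_def base_add\<close>)

lemma weighted_sum_mono:
  fixes h :: "filling \<Rightarrow> real"
  assumes "\<And>F. F \<subseteq> {1..n} \<Longrightarrow> g F \<le> g' F" "\<And>S. h S \<ge> 0"
  shows "weighted_sum n h g \<le> weighted_sum n h g'"
  unfolding weighted_sum_def real_scaleR_def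
  using assms free_rows_subset al_pos be_pos
  by (intro sum_mono mult_right_mono mult_left_mono) (auto simp: weight_def)

text \<open>Exact evaluation would follow row \<open>i\<close> back to its creation, through columns
  where a second \<alpha> may be demanded. This bound spends a single column: it drops the demand
  that \<open>i\<close> is free and raises the factor of the rows up to \<open>i\<close> from
  \<open>base s\<close> to \<open>base (Suc s)\<close>.\<close>

lemma weighted_sum_alpha_le:
  fixes h :: "filling \<Rightarrow> real"
  assumes i: "i \<le> n" and h: "\<And>S. h S \<ge> 0"
  shows "weighted_sum (Suc n) (\<lambda>S. of_bool (S (i, 1) = Some SymAlpha) *\<^sub>R h (drop_column S))
      (\<lambda>F. base s ^ card F) \<le>
    al * be * weighted_sum n h (\<lambda>F. base (Suc s) ^ card F)"
proof -
  have "base s * marked_power i (base s) (base (Suc s)) F \<le> base (Suc s) ^ card F"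
    if F: "F \<subseteq> {1..n}" for F
  proof (cases "i \<in> F")
    case True
    have fin: "finite F" using F finite_subset by blast
    have le: "base s \<le> base (Suc s)" using be_pos by (simp add: base_def)
    have eq: "(F \<inter> {..i}) \<union> (F \<inter> {i<..}) = F" by auto
    have "card ((F \<inter> {..i}) \<union> (F \<inter> {i<..})) = card (F \<inter> {..i}) + card (F \<inter> {i<..})"
      using fin by (intro card_Un_disjoint) auto
    hence "card F = card (F \<inter> {..i}) + card (F \<inter> {i<..})" unfolding eq .
    hence "base (Suc s) ^ card F = base (Suc s) ^ card (F \<inter> {..i}) * base (Suc s) ^ card (F \<inter> {i<..})"
      by (simp add: power_add)
    also have "\<dots> \<ge> base s ^ card (F \<inter> {..i}) * base (Suc s) ^ card (F \<inter> {i<..})"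
      using base_pos[of s] base_pos[of "Suc s"] le by (intro mult_right_mono power_mono) auto
    finally show ?thesis using True card_atMost_inter[OF fin True] by (simp add: marked_power_def)
  next
    case False
    thus ?thesis using base_pos[of "Suc s"] by (simp add: marked_power_def)
  qed
  hence "al * be * base s * marked_power i (base s) (base (Suc s)) F \<le> al * be * base (Suc s) ^ card F"
    if "F \<subseteq> {1..n}" for F
    unfolding mult.assoc using al_pos be_pos that by (intro mult_left_mono) auto
  hence "weighted_sum n h (\<lambda>F. al * be * base s * marked_power i (base s) (base (Suc s)) F) \<le>
      weighted_sum n h (\<lambda>F. al * be * base (Suc s) ^ card F)"
    by (intro weighted_sum_mono h)
  thus ?thesis
    unfolding weighted_sum_alpha[OF i] weighted_sum_scale by simp
qed

lemma weighted_sum_const: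
  "weighted_sum n (\<lambda>_. c) (\<lambda>F. base s ^ card F) = ((al * be) ^ n * pochhammer (real s + theta) n) *\<^sub>R c"
proof (induction n arbitrary: s)
  case 0
  show ?case
    by (simp add: weighted_sum_def staircase_tableaux_0 weight_def num_symbol_def free_rows_def)
next
  case (Suc n)
  show ?case using weighted_sum_power[of n "\<lambda>_. c" s]
    by (simp add: Suc pochhammer_rec add_ac mult_ac)
qed

lemma partition_function_eq: "partition_function n al be = (al * be) ^ n * pochhammer theta n"
  using weighted_sum_const[of n "1 :: real" 0]
  by (simp add: weighted_sum_def partition_function_def base_def)

lemma weighted_sum_drop:
  "weighted_sum (n + p) (\<lambda>S. h ((drop_column ^^ p) S)) (\<lambda>F. base s ^ card F) =
    ((al * be) ^ p * pochhammer (real s + theta) p) *\<^sub>R weighted_sum n h (\<lambda>F. base (s + p) ^ card F)"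
proof (induction p arbitrary: s)
  case (Suc p)
  have "weighted_sum (n + Suc p) (\<lambda>S. h ((drop_column ^^ Suc p) S)) (\<lambda>F. base s ^ card F) =
    (al * be * (real s + theta)) *\<^sub>R
      weighted_sum (n + p) (\<lambda>S. h ((drop_column ^^ p) S)) (\<lambda>F. base (Suc s) ^ card F)"
    using weighted_sum_power[of "n + p" "\<lambda>S. h ((drop_column ^^ p) S)" s]
    by (simp add: funpow_swap1)
  thus ?case by (simp add: Suc pochhammer_rec add_ac mult_ac)
qed simp

text \<open>Follows the demand that row \<open>Suc n\<close> is free through \<open>p\<close>
  columns to the column creating that row. What remains is a tableau of size \<open>n\<close>, on
  which \<open>h\<close> is evaluated by \<open>f\<close>. The denominators in
  \<open>window_sum\<close> are the Pochhammer factors missing whenever \<open>s\<close> is not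
  raised.\<close>

lemma weighted_sum_window:
  assumes f: "\<And>s. weighted_sum n h (\<lambda>F. base s ^ card F) =
    ((al * be) ^ n * pochhammer (real s + theta) n) *\<^sub>R f (s + n)"
  shows "weighted_sum (n + Suc p) (\<lambda>S. h ((drop_column ^^ Suc p) S))
      (marked_power (Suc n) (base s) (base (s + j))) =
    (al * (al * be) ^ (n + p) * pochhammer (real s + theta) (n + p)) *\<^sub>R
      window_sum theta f p j (s + n + p)"
proof (induction p arbitrary: s j)
  case 0
  show ?case using weighted_sum_marked_new[of n h s "base (s + j)"] by (simp add: f)
next
  case (Suc p)
  define t where "t = s + n + Suc p"
  define q where "q = pochhammer (real s + theta) (n + p)"
  have pos: "real s + theta + real (n + p) \<noteq> 0" using theta_pos by simp
  have q1: "pochhammer (real s + theta) (n + Suc p) = q * (real s + theta + real (n + p))"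
    by (simp add: q_def pochhammer_Suc)
  have q2: "(real s + theta) * pochhammer (real (Suc s) + theta) (n + p) = pochhammer (real s + theta) (n + Suc p)"
    by (simp add: pochhammer_rec add_ac)
  have "weighted_sum (n + Suc (Suc p)) (\<lambda>S. h ((drop_column ^^ Suc (Suc p)) S))
      (marked_power (Suc n) (base s) (base (s + j))) =
    (al * be * (real j + 1)) *\<^sub>R
      ((al * (al * be) ^ (n + p) * q) *\<^sub>R window_sum theta f p (Suc j) (t - 1)) +
    (al * be * (real s + theta)) *\<^sub>R
      ((al * (al * be) ^ (n + p) * pochhammer (real (Suc s) + theta) (n + p)) *\<^sub>R window_sum theta f p j t)"
    using weighted_sum_marked[of "Suc n" "n + Suc p" "\<lambda>S. h ((drop_column ^^ Suc p) S)" s j]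
      Suc[of s "Suc j"] Suc[of "Suc s" j]
    by (simp add: funpow_swap1 t_def q_def)
  also have "\<dots> = (al * (al * be) ^ (n + Suc p) * pochhammer (real s + theta) (n + Suc p)) *\<^sub>R
      (window_sum theta f p j t +
        ((real j + 1) / (real s + theta + real (n + p))) *\<^sub>R window_sum theta f p (Suc j) (t - 1))"
  proof -
    have 1: "al * be * (real j + 1) * (al * (al * be) ^ (n + p) * q) =
        al * (al * be) ^ (n + Suc p) * pochhammer (real s + theta) (n + Suc p) *
        ((real j + 1) / (real s + theta + real (n + p)))"
      using pos unfolding q1 by simp
    have 2: "al * be * (real s + theta) * (al * (al * be) ^ (n + p) * pochhammer (real (Suc s) + theta) (n + p)) =
        al * (al * be) ^ (n + Suc p) * pochhammer (real s + theta) (n + Suc p)"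
      unfolding q2[symmetric] by simp
    show ?thesis unfolding scaleR_add_right scaleR_scaleR 1 2 by (rule add.commute)
  qed
  also have "real s + theta + real (n + p) = real t - 1 + theta" by (simp add: t_def)
  finally show ?case by (simp add: t_def)
qed

text \<open>Of the \<open>k\<close> columns, one carries the \<alpha>, \<open>k - 2\<close> have to
  leave its row free, and the last one creates the row. The gap starts at 1 because the column with
  the \<alpha> shifts only the rows below it.\<close>

lemma weighted_sum_alpha_window:
  assumes f: "\<And>s. weighted_sum n h (\<lambda>F. base s ^ card F) =
    ((al * be) ^ n * pochhammer (real s + theta) n) *\<^sub>R f (s + n)"
    and k: "k \<ge> 2"
  shows "weighted_sum (n + k) (\<lambda>S. of_bool (S (Suc n, 1) = Some SymAlpha) *\<^sub>R h ((drop_column ^^ k) S))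
      (\<lambda>F. base s ^ card F) =
    ((al * be) ^ (n + k) * pochhammer (real s + theta) (n + k)) *\<^sub>R
      (((real s + 1 / be) / ((real (s + n + k) - 1 + theta) * (real (s + n + k) - 2 + theta))) *\<^sub>R
       window_sum theta f (k - 2) 1 (s + n + k - 2))"
proof -
  obtain p where p: "k = Suc (Suc p)" using k by (metis Suc_le_D numeral_2_eq_2 le_Suc_ex add_2_eq_Suc)
  have pos: "real s + theta + real (n + p) \<noteq> 0" "real s + theta + real (n + Suc p) \<noteq> 0"
    using theta_pos by auto
  have q: "pochhammer (real s + theta) (n + k) =
    pochhammer (real s + theta) (n + p) * (real s + theta + real (n + p)) * (real s + theta + real (n + Suc p))"
    by (simp add: p pochhammer_Suc)
  have "weighted_sum (n + k) (\<lambda>S. of_bool (S (Suc n, 1) = Some SymAlpha) *\<^sub>R h ((drop_column ^^ k) S))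
      (\<lambda>F. base s ^ card F) =
    (al * be * base s) *\<^sub>R ((al * (al * be) ^ (n + p) * pochhammer (real s + theta) (n + p)) *\<^sub>R
      window_sum theta f p 1 (s + n + p))"
    using weighted_sum_alpha[of "Suc n" "n + Suc p" "\<lambda>S. h ((drop_column ^^ Suc p) S)" s]
      weighted_sum_window[of n h f p s 1, OF f]
    by (simp add: p funpow_swap1)
  also have "\<dots> = ((al * be) ^ (n + k) * pochhammer (real s + theta) (n + k)) *\<^sub>R
      (((real s + 1 / be) / ((real s + theta + real (n + Suc p)) * (real s + theta + real (n + p)))) *\<^sub>R
       window_sum theta f p 1 (s + n + p))"
  proof -
    have "al * be * base s * (al * (al * be) ^ (n + p) * pochhammer (real s + theta) (n + p)) =
      (al * be) ^ (n + k) * pochhammer (real s + theta) (n + k) *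
      ((real s + 1 / be) / ((real s + theta + real (n + Suc p)) * (real s + theta + real (n + p))))"
      unfolding q base_eq using pos by (simp add: p)
    thus ?thesis unfolding scaleR_scaleR by simp
  qed
  also have "real s + theta + real (n + Suc p) = real (s + n + k) - 1 + theta" by (simp add: p)
  also have "real s + theta + real (n + p) = real (s + n + k) - 2 + theta" by (simp add: p)
  finally show ?thesis by (simp add: p)
qed

end

text \<open>Column \<open>N + 1 - m\<close>, the \<open>m\<close>-th one from the right, meets the \<open>k\<close>-th diagonal in row \<open>m + 1 - k\<close>.\<close>

definition alpha_steps :: "nat \<Rightarrow> nat \<Rightarrow> filling \<Rightarrow> nat set" where
  "alpha_steps k N S = {m \<in> {k..N}. S (m + 1 - k, N + 1 - m) = Some SymAlpha}"

lemma alpha_steps_drop: "alpha_steps k N (drop_column S) = alpha_steps k (Suc N) S \<inter> {..N}"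
  by (auto simp: alpha_steps_def drop_column_def Suc_diff_le)

lemma alpha_steps_drops: "alpha_steps k N ((drop_column ^^ p) S) = alpha_steps k (N + p) S \<inter> {..N}"
proof (induction p arbitrary: S)
  case 0
  show ?case by (auto simp: alpha_steps_def)
next
  case (Suc p)
  have "alpha_steps k N ((drop_column ^^ Suc p) S) = alpha_steps k (N + p) (drop_column S) \<inter> {..N}"
    using Suc[of "drop_column S"] by (simp add: funpow_swap1)
  also have "\<dots> = alpha_steps k (N + Suc p) S \<inter> {..N}"
    unfolding alpha_steps_drop by auto
  finally show ?case .
qed

lemma alphas_on_diagonal_eq:
  assumes "k \<ge> 1"
  shows "alphas_on_diagonal n k S = card (alpha_steps k n S)"
proof -
  have "Suc (Suc n) - (i + k) = j" if "i + j + k = Suc (Suc n)" for i j using that by simp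
  thus ?thesis
    unfolding alphas_on_diagonal_def
    by (intro bij_betw_same_card[of "\<lambda>(i, j). i + k - 1"]
        bij_betw_byWitness[where f' = "\<lambda>m. (m + 1 - k, n + 1 - m)"])
      (use assms in \<open>auto simp: diagonal_def alpha_steps_def\<close>)
qed

text \<open>For a set \<open>R\<close> with gaps at least \<open>k\<close> this is \<open>(1 + w) ^ card R\<close>; in general it is the sum of
  \<open>w ^ card M\<close> over the subsets \<open>M\<close> of \<open>R\<close> (without \<open>k\<close>) with such gaps.
  Leaving out \<open>k\<close> keeps the denominators \<open>t - 1 + \<theta>\<close> in \<open>window_sum\<close> away from \<open>0\<close>.\<close>

function separated_sum :: "nat \<Rightarrow> 'a :: comm_ring_1 \<Rightarrow> nat \<Rightarrow> nat set \<Rightarrow> 'a" where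
  "separated_sum k w N R = (if N \<le> k \<or> k = 0 then 1
     else separated_sum k w (N - 1) R + (if N \<in> R then w * separated_sum k w (N - k) R else 0))"
  by auto
termination by (relation "Wellfounded.measure (\<lambda>(k, w, N, R). N)") auto

declare separated_sum.simps [simp del]

lemma separated_sum_restrict:
  assumes "N \<le> N'"
  shows "separated_sum k w N (R \<inter> {..N'}) = separated_sum k w N R"
  using assms
proof (induction N rule: less_induct)
  case (less N)
  show ?case
  proof (cases "N \<le> k \<or> k = 0")
    case False
    thus ?thesis using less.IH[of "N - 1"] less.IH[of "N - k"] less.prems
      by (subst (1 2) separated_sum.simps) auto
  qed (simp add: separated_sum.simps[of k w N])
qed

lemma card_atMost_step:
  fixes R :: "nat set"
  assumes "N \<ge> 1"
  shows "card (R \<inter> {..N}) = card (R \<inter> {..N - 1}) + (if N \<in> R then 1 else 0)"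
proof -
  have "R \<inter> {..N} = (if N \<in> R then insert N (R \<inter> {..N - 1}) else R \<inter> {..N - 1})"
    using assms by (auto simp: le_less)
  thus ?thesis using assms by auto
qed

lemma separated_sum_separated:
  assumes "k \<ge> 1" "R \<subseteq> {Suc k..}" "\<And>m m'. m \<in> R \<Longrightarrow> m' \<in> R \<Longrightarrow> m < m' \<Longrightarrow> m + k \<le> m'"
  shows "separated_sum k w N R = (1 + w) ^ card (R \<inter> {..N})"
proof (induction N rule: less_induct)
  case (less N)
  show ?case
  proof (cases "N \<le> k")
    case True
    hence "R \<inter> {..N} = {}" using assms by force
    thus ?thesis using True by (simp add: separated_sum.simps[of k w N])
  next
    case False
    have "R \<inter> {..N - 1} = R \<inter> {..N - k}" if "N \<in> R"
      using assms(1) assms(3)[OF _ that] by force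
    thus ?thesis using False assms(1) less.IH[of "N - 1"] less.IH[of "N - k"] card_atMost_step[of N R]
      by (subst separated_sum.simps) (auto simp: algebra_simps)
  qed
qed

lemma norm_separated_sum_le:
  fixes w :: "'a :: {real_normed_algebra_1, comm_ring_1}"
  shows "norm (separated_sum k w N R) \<le> (1 + norm w) ^ card (R \<inter> {..N})"
proof (induction N rule: less_induct)
  case (less N)
  show ?case
  proof (cases "N \<le> k \<or> k = 0")
    case True
    thus ?thesis by (simp add: separated_sum.simps[of k w N] one_le_power)
  next
    case False
    let ?c = "\<lambda>n. card (R \<inter> {..n})"
    have mono: "(1 + norm w) ^ ?c (N - k) \<le> (1 + norm w) ^ ?c (N - 1)"
      using False by (intro power_increasing card_mono) auto
    have "norm (separated_sum k w N R) \<le> norm (separated_sum k w (N - 1) R) +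
        (if N \<in> R then norm w * norm (separated_sum k w (N - k) R) else 0)"
      using False by (subst separated_sum.simps)
        (auto intro!: norm_triangle_le add_mono norm_mult_ineq)
    also have "\<dots> \<le> (1 + norm w) ^ ?c (N - 1) + (if N \<in> R then norm w * (1 + norm w) ^ ?c (N - 1) else 0)"
      using False less.IH[of "N - 1"] less.IH[of "N - k"] mono
      by (auto intro!: add_mono mult_left_mono)
    also have "\<dots> = (1 + norm w) ^ ?c N"
      using False card_atMost_step[of N R] by (auto simp: algebra_simps)
    finally show ?thesis .
  qed
qed

lemma separated_sum_mono:
  fixes w :: real
  assumes "w \<ge> 0" "N \<le> N'"
  shows "separated_sum k w N R \<le> separated_sum k w N' R" "separated_sum k w N R \<ge> 1"
proof -
  have ge: "separated_sum k w N R \<ge> 1" for N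
  proof (induction N rule: less_induct)
    case (less N)
    show ?case
    proof (cases "N \<le> k \<or> k = 0")
      case False
      thus ?thesis using less.IH[of "N - 1"] less.IH[of "N - k"] assms
        by (subst separated_sum.simps) (auto intro!: add_increasing2 mult_nonneg_nonneg)
    qed (simp add: separated_sum.simps[of k w N])
  qed
  show "separated_sum k w N R \<ge> 1" by (rule ge)
  have step: "separated_sum k w N R \<le> separated_sum k w (Suc N) R" for N
  proof (cases "Suc N \<le> k \<or> k = 0")
    case True
    thus ?thesis by (auto simp: separated_sum.simps[of k w N] separated_sum.simps[of k w "Suc N"])
  next
    case False
    have "0 \<le> w * separated_sum k w (Suc N - k) R"
      using assms(1) ge[of "Suc N - k"] by (intro mult_nonneg_nonneg) auto
    thus ?thesis using False by (subst (2) separated_sum.simps) auto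
  qed
  show "separated_sum k w N R \<le> separated_sum k w N' R"
    using assms(2) by (rule lift_Suc_mono_le[of "\<lambda>N. separated_sum k w N R", OF step])
qed

text \<open>Greedy choice from the top: taking the largest element of \<open>R\<close> and skipping
  the next positions accounts for at most \<open>k\<close> elements, which the factor (1 + y)^k = 1
  + w pays for. The initial segment up to \<open>k\<close> costs (1 + y)^(k + 1). This reduces an
  exponential moment of all \<alpha>'s on the diagonal to a separated sum.\<close>

lemma power_card_le_separated_sum:
  fixes y :: real
  assumes "y \<ge> 0" "k \<ge> 1"
  shows "(1 + y) ^ card (R \<inter> {..N}) \<le> (1 + y) ^ Suc k * separated_sum k ((1 + y) ^ k - 1) N R"
proof (induction N rule: less_induct)
  case (less N)
  define w where "w = (1 + y) ^ k - 1"
  have w: "w \<ge> 0" using assms by (simp add: w_def one_le_power)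
  show ?case unfolding w_def[symmetric]
  proof (cases "N \<le> k")
    case True
    have "card (R \<inter> {..N}) \<le> card {..N}" by (intro card_mono) auto
    hence "(1 + y) ^ card (R \<inter> {..N}) \<le> (1 + y) ^ Suc k"
      using assms True by (intro power_increasing) auto
    thus "(1 + y) ^ card (R \<inter> {..N}) \<le> (1 + y) ^ Suc k * separated_sum k w N R"
      using True by (simp add: separated_sum.simps[of k w N])
  next
    case False
    show "(1 + y) ^ card (R \<inter> {..N}) \<le> (1 + y) ^ Suc k * separated_sum k w N R"
    proof (cases "N \<in> R")
      case True
      have "R \<inter> {..N} \<subseteq> (R \<inter> {..N - k}) \<union> {N - k<..N}" by auto
      hence "card (R \<inter> {..N}) \<le> card ((R \<inter> {..N - k}) \<union> {N - k<..N})" by (intro card_mono) auto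
      also have "\<dots> \<le> card (R \<inter> {..N - k}) + card {N - k<..N}" by (rule card_Un_le)
      also have "card {N - k<..N} = k" using False by simp
      finally have "(1 + y) ^ card (R \<inter> {..N}) \<le> (1 + y) ^ (k + card (R \<inter> {..N - k}))"
        using assms by (intro power_increasing) auto
      also have "\<dots> \<le> (1 + y) ^ k * ((1 + y) ^ Suc k * separated_sum k w (N - k) R)"
        unfolding power_add w_def using less.IH[of "N - k"] assms False by (intro mult_left_mono) auto
      also have "\<dots> = (1 + y) ^ Suc k * ((1 + w) * separated_sum k w (N - k) R)"
        by (simp add: w_def mult_ac)
      also have "(1 + w) * separated_sum k w (N - k) R \<le> separated_sum k w N R"
        using separated_sum_mono(1)[OF w, of "N - k" "N - 1" k R] True False assms
        by (subst (2) separated_sum.simps) (auto simp: algebra_simps)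
      finally show ?thesis using assms by (simp add: mult_left_mono)
    next
      case out: False
      have "(1 + y) ^ card (R \<inter> {..N}) \<le> (1 + y) ^ Suc k * separated_sum k w (N - 1) R"
        using less.IH[of "N - 1"] out False card_atMost_step[of N R] by (simp add: w_def)
      also have "\<dots> \<le> (1 + y) ^ Suc k * separated_sum k w N R"
        using assms separated_sum_mono(1)[OF w, of "N - 1" N k R] by (intro mult_left_mono) auto
      finally show ?thesis .
    qed
  qed
qed

text \<open>Here \<open>N\<close> columns remain to be summed out and \<open>t = s + N\<close>, where the current statistic is
  \<open>(1 + s \<beta>) ^ card F\<close>; the parameters \<open>b\<close> and \<open>\<theta>\<close> stand for \<open>1 / \<beta>\<close> and \<open>1 / \<alpha> + 1 / \<beta>\<close>.\<close>

function separated_gf :: "nat \<Rightarrow> real \<Rightarrow> real \<Rightarrow> 'a :: real_normed_field \<Rightarrow> nat \<Rightarrow> nat \<Rightarrow> 'a" where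
  "separated_gf k b \<theta> w N = (if N \<le> k \<or> k = 0 then (\<lambda>_. 1) else
     (\<lambda>t. separated_gf k b \<theta> w (N - 1) t +
        w * (((real t - real N + b) / ((real t - 1 + \<theta>) * (real t - 2 + \<theta>))) *\<^sub>R
          window_sum \<theta> (separated_gf k b \<theta> w (N - k)) (k - 2) 1 (t - 2))))"
  by auto
termination by (relation "Wellfounded.measure (\<lambda>(k, b, \<theta>, w, N). N)") auto

declare separated_gf.simps [simp del]

context staircase_weights
begin

lemma weighted_sum_add:
  "weighted_sum n (\<lambda>S. h S + h' S) g = weighted_sum n h g + weighted_sum n h' g"
  by (simp add: weighted_sum_def scaleR_add_right sum.distrib)

text \<open>Both recursions branch on the leftmost column. If it is not selected, one column is
  summed out; if it is, \<open>k\<close> columns are summed out together, and the separated sum left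
  over depends only on the other columns, as \<open>weighted_sum_alpha_window\<close>
  requires.\<close>

lemma weighted_sum_separated_sum:
  fixes w :: "'a :: real_normed_field"
  assumes k: "k \<ge> 2"
  shows "weighted_sum N (\<lambda>S. separated_sum k w N (alpha_steps k N S)) (\<lambda>F. base s ^ card F) =
    ((al * be) ^ N * pochhammer (real s + theta) N) *\<^sub>R separated_gf k (1 / be) theta w N (s + N)"
proof (induction N arbitrary: s rule: less_induct)
  case (less N)
  show ?case
  proof (cases "N \<le> k")
    case True
    thus ?thesis using weighted_sum_const[of N "1 :: 'a" s]
      by (simp add: separated_sum.simps[of k w N] separated_gf.simps[of k _ _ w N])
  next
    case False
    then obtain n where n: "N = n + k" by (metis le_add_diff_inverse2 nat_le_linear)
    obtain m where m: "N = Suc m" using False by (cases N) auto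
    let ?I = "\<lambda>N S. separated_sum k w N (alpha_steps k N S)"
    have split: "?I N = (\<lambda>S. ?I m (drop_column S) +
        of_bool (S (Suc n, 1) = Some SymAlpha) *\<^sub>R (w * ?I n ((drop_column ^^ k) S)))"
    proof
      fix S
      have "?I m (drop_column S) = separated_sum k w m (alpha_steps k N S)"
        by (simp add: alpha_steps_drop m separated_sum_restrict)
      moreover have "?I n ((drop_column ^^ k) S) = separated_sum k w n (alpha_steps k N S)"
        by (simp add: alpha_steps_drops n separated_sum_restrict)
      moreover have "N \<in> alpha_steps k N S \<longleftrightarrow> S (Suc n, 1) = Some SymAlpha"
        using False by (simp add: alpha_steps_def n Suc_diff_le)
      moreover have "N - 1 = m" "N - k = n" by (simp_all add: m, simp add: m[symmetric] n)
      ultimately show "?I N S = ?I m (drop_column S) +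
        of_bool (S (Suc n, 1) = Some SymAlpha) *\<^sub>R (w * ?I n ((drop_column ^^ k) S))"
        using False k by (subst separated_sum.simps) auto
    qed
    have 1: "weighted_sum N (\<lambda>S. ?I m (drop_column S)) (\<lambda>F. base s ^ card F) =
       ((al * be) ^ N * pochhammer (real s + theta) N) *\<^sub>R separated_gf k (1 / be) theta w (N - 1) (s + N)"
      using weighted_sum_power[of m "?I m" s] less[of m "Suc s"]
      by (simp add: m pochhammer_rec add_ac mult_ac)
    have f: "weighted_sum n (\<lambda>S. w * ?I n S) (\<lambda>F. base s ^ card F) =
      ((al * be) ^ n * pochhammer (real s + theta) n) *\<^sub>R (w * separated_gf k (1 / be) theta w n (s + n))" for s
    proof -
      have "weighted_sum n (\<lambda>S. w * ?I n S) (\<lambda>F. base s ^ card F) =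
        w * weighted_sum n (?I n) (\<lambda>F. base s ^ card F)"
        by (simp add: weighted_sum_def sum_distrib_left)
      thus ?thesis using less[of n s] n k by simp
    qed
    have wm: "window_sum theta (\<lambda>t. w * g t) p j t = w * window_sum theta g p j t"
      for g :: "nat \<Rightarrow> 'a" and p j t
      by (induction p arbitrary: j t) (auto simp: algebra_simps)
    have 2: "weighted_sum N (\<lambda>S. of_bool (S (Suc n, 1) = Some SymAlpha) *\<^sub>R (w * ?I n ((drop_column ^^ k) S)))
        (\<lambda>F. base s ^ card F) =
      ((al * be) ^ N * pochhammer (real s + theta) N) *\<^sub>R
        (w * (((real (s + N) - real N + 1 / be) / ((real (s + N) - 1 + theta) * (real (s + N) - 2 + theta))) *\<^sub>R
          window_sum theta (separated_gf k (1 / be) theta w (N - k)) (k - 2) 1 (s + N - 2)))"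
      using weighted_sum_alpha_window[of n "\<lambda>S. w * ?I n S" "\<lambda>t. w * separated_gf k (1 / be) theta w n t" k s,
        OF f k] by (simp add: wm n add.assoc)
    show ?thesis
      unfolding split weighted_sum_add 1 2
      using False k by (subst (3) separated_gf.simps) (simp add: scaleR_add_right)
  qed
qed

end

section \<open>Asymptotics of the generating functions\<close>

text \<open>A multiple of exp (D N / t) is a supersolution: the delay does not raise the ratio,
  since (N - k) / (t - p) \<le> N / t for p \<le> k and N \<le> t. The constant is chosen before
  \<open>u\<close>, which later makes the estimates uniform in the weights.\<close>

lemma delayed_gronwall:
  fixes C c0 :: real
  assumes k: "k \<ge> 2" and C: "C \<ge> 0" and c0: "c0 \<ge> 0"
  shows "\<exists>K. \<forall>u :: nat \<Rightarrow> nat \<Rightarrow> real.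
    (\<forall>N t. N \<le> k \<longrightarrow> N \<le> t \<longrightarrow> u N t \<le> c0) \<longrightarrow>
    (\<forall>N t. k < N \<longrightarrow> N \<le> t \<longrightarrow> (\<exists>p. 2 \<le> p \<and> p \<le> k \<and> u N t \<le> u (N - 1) t + C / t * u (N - k) (t - p))) \<longrightarrow>
    (\<forall>N t. N \<le> t \<longrightarrow> u N t \<le> K)"
proof -
  \<comment> \<open>The factor e absorbs exp (D / t), which is at most e once t exceeds
    \<open>T\<close>; smaller t are covered by the crude bound c0 (1 + C)^N.\<close>
  define D where "D = C * exp 1"
  define T where "T = nat \<lceil>D\<rceil>"
  define K0 where "K0 = c0 * (1 + C) ^ T"
  have D: "D \<ge> 0" "D \<le> real T" using C by (auto simp: D_def T_def)
  have K0: "K0 \<ge> c0" "K0 \<ge> 0" using C c0 by (auto simp: K0_def mult_le_cancel_left1)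
  have "u N t \<le> K0 * exp D"
    if small: "\<And>N t. N \<le> k \<Longrightarrow> N \<le> t \<Longrightarrow> u N t \<le> c0"
      and step: "\<And>N t. k < N \<Longrightarrow> N \<le> t \<Longrightarrow>
        \<exists>p. 2 \<le> p \<and> p \<le> k \<and> u N t \<le> u (N - 1) t + C / t * u (N - k) (t - p)"
      and Nt: "N \<le> t" for u :: "nat \<Rightarrow> nat \<Rightarrow> real" and N t
  proof -
    have crude: "u N t \<le> c0 * (1 + C) ^ N" if "N \<le> t" for N t
      using that
    proof (induction N arbitrary: t rule: less_induct)
      case (less N)
      show ?case
      proof (cases "N \<le> k")
        case True
        have "c0 * 1 \<le> c0 * (1 + C) ^ N" using C c0 by (intro mult_left_mono) auto
        thus ?thesis using small[OF True less.prems] by simp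
      next
        case False
        then obtain p where p: "2 \<le> p" "p \<le> k" "u N t \<le> u (N - 1) t + C / t * u (N - k) (t - p)"
          using step[of N t] less.prems by auto
        have "u (N - k) (t - p) \<le> c0 * (1 + C) ^ (N - k)"
          using False p k less.prems by (intro less.IH) auto
        also have "\<dots> \<le> c0 * (1 + C) ^ (N - 1)"
          using C c0 k by (intro mult_left_mono power_increasing) auto
        finally have "C / t * u (N - k) (t - p) \<le> C / t * (c0 * (1 + C) ^ (N - 1))"
          using C by (intro mult_left_mono) auto
        also have "\<dots> \<le> C * (c0 * (1 + C) ^ (N - 1))"
        proof (rule mult_right_mono)
          have "C * 1 \<le> C * real t" using False less.prems C by (intro mult_left_mono) auto
          thus "C / real t \<le> C" using False less.prems by (simp add: divide_le_eq)
        qed (use C c0 in auto)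
        finally have "C / t * u (N - k) (t - p) \<le> C * (c0 * (1 + C) ^ (N - 1))" .
        moreover have "u (N - 1) t \<le> c0 * (1 + C) ^ (N - 1)"
          using False less.prems by (intro less.IH) auto
        ultimately have "u N t \<le> c0 * (1 + C) ^ (N - 1) + C * (c0 * (1 + C) ^ (N - 1))"
          using p(3) by linarith
        also have "\<dots> = c0 * (1 + C) ^ N"
          using False by (cases N) (auto simp: algebra_simps)
        finally show ?thesis .
      qed
    qed
    have "u N t \<le> K0 * exp (D * N / t)" if "N \<le> t" for N t
      using that
    proof (induction N arbitrary: t rule: less_induct)
      case (less N)
      have ge1: "K0 * 1 \<le> K0 * exp (D * N / t)" using K0 D by (intro mult_left_mono) auto
      show ?case
      proof (cases "N \<le> k \<or> t \<le> T")
        case True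
        hence "u N t \<le> K0"
        proof
          assume "t \<le> T"
          hence "c0 * (1 + C) ^ N \<le> K0"
            unfolding K0_def using C c0 less.prems by (intro mult_left_mono power_increasing) auto
          thus ?thesis using crude[OF less.prems] by simp
        qed (use small[of N t] less.prems K0 in auto)
        thus ?thesis using ge1 by simp
      next
        case False
        then obtain p where p: "2 \<le> p" "p \<le> k" "u N t \<le> u (N - 1) t + C / t * u (N - k) (t - p)"
          using step[of N t] less.prems by auto
        have t: "real t > 0" "D / t \<le> 1" using False less.prems D by (auto simp: divide_le_eq)
        define x where "x = exp (D * real (N - 1) / t)"
        have eN: "exp (D * N / t) = x * exp (D / t)"
          using False by (simp add: x_def exp_add[symmetric] add_divide_distrib[symmetric] of_nat_diff algebra_simps)
        have "real (N - k) / real (t - p) \<le> real N / real t"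
        proof -
          have "real N * real p \<le> real t * real k"
            using less.prems p by (intro mult_mono) auto
          thus ?thesis using False less.prems p by (simp add: of_nat_diff field_simps)
        qed
        hence "D * (real (N - k) / real (t - p)) \<le> D * (real N / real t)"
          using D by (intro mult_left_mono) auto
        hence "exp (D * real (N - k) / real (t - p)) \<le> x * exp (D / t)"
          unfolding eN[symmetric] by simp
        also have "\<dots> \<le> x * exp 1" using t by (intro mult_left_mono) (auto simp: x_def)
        finally have "K0 * exp (D * real (N - k) / real (t - p)) \<le> K0 * (x * exp 1)"
          using K0 by (intro mult_left_mono) auto
        moreover have "u (N - k) (t - p) \<le> K0 * exp (D * real (N - k) / real (t - p))"
          using False p k less.prems by (intro less.IH) auto
        ultimately have "C / t * u (N - k) (t - p) \<le> C / t * (K0 * (x * exp 1))"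
          using C by (intro mult_left_mono) auto
        also have "\<dots> = K0 * x * (D / t)" by (simp add: D_def)
        finally have "C / t * u (N - k) (t - p) \<le> K0 * x * (D / t)" .
        moreover have "u (N - 1) t \<le> K0 * x"
          unfolding x_def using False less.prems by (intro less.IH) auto
        ultimately have "u N t \<le> K0 * x + K0 * x * (D / t)" using p(3) by linarith
        also have "\<dots> = K0 * x * (1 + D / t)" by (simp add: algebra_simps)
        also have "\<dots> \<le> K0 * x * exp (D / t)"
          using K0 by (intro mult_left_mono exp_ge_add_one_self) (auto simp: x_def)
        finally show ?thesis by (simp add: eN mult.assoc)
      qed
    qed
    from this[OF Nt] have "u N t \<le> K0 * exp (D * N / t)" .
    also have "\<dots> \<le> K0 * exp D"
    proof -
      have "D * (N / t) \<le> D * 1" using D Nt by (intro mult_left_mono) (auto simp: divide_le_eq)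
      thus ?thesis using K0 by (intro mult_left_mono) auto
    qed
    finally show ?thesis .
  qed
  thus ?thesis by blast
qed

section \<open>Uniform bounds for window sums and generating functions\<close>

lemma window_sum_bound:
  fixes f :: "nat \<Rightarrow> 'a :: real_normed_vector"
  assumes "\<theta> \<ge> 0" "p < t" "\<And>q. q \<le> p \<Longrightarrow> norm (f (t - q)) \<le> c"
  shows "norm (window_sum \<theta> f p j t) \<le> real (1 + j + p) ^ p * c"
  using assms(2,3)
proof (induction p arbitrary: j t)
  case (Suc p)
  have "norm (f (t - 0)) \<le> c" by (rule Suc.prems) simp
  hence c: "c \<ge> 0" using norm_ge_zero order_trans by blast
  have 1: "norm (window_sum \<theta> f p j t) \<le> real (2 + j + p) ^ p * c"
  proof -
    have "norm (window_sum \<theta> f p j t) \<le> real (1 + j + p) ^ p * c" using Suc by auto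
    also have "\<dots> \<le> real (2 + j + p) ^ p * c" using c by (intro mult_right_mono power_mono) auto
    finally show ?thesis .
  qed
  have "norm (f (t - 1 - q)) \<le> c" if "q \<le> p" for q using Suc.prems(2)[of "Suc q"] that by simp
  hence 2: "norm (window_sum \<theta> f p (Suc j) (t - 1)) \<le> real (2 + j + p) ^ p * c"
    using Suc.IH[of "t - 1" "Suc j"] Suc.prems by simp
  have co: "0 \<le> (real j + 1) / (real t - 1 + \<theta>)" "(real j + 1) / (real t - 1 + \<theta>) \<le> real j + 1"
    using Suc.prems assms(1) by (auto simp: divide_le_eq mult_le_cancel_left1)
  have 3: "norm (((real j + 1) / (real t - 1 + \<theta>)) *\<^sub>R window_sum \<theta> f p (Suc j) (t - 1)) \<le>
      (real j + 1) * (real (2 + j + p) ^ p * c)"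
    unfolding norm_scaleR abs_of_nonneg[OF co(1)] by (intro mult_mono co(2) 2) auto
  have "norm (window_sum \<theta> f (Suc p) j t) \<le>
    real (2 + j + p) ^ p * c + (real j + 1) * (real (2 + j + p) ^ p * c)"
    unfolding window_sum.simps by (intro norm_triangle_le add_mono 1 3)
  also have "\<dots> = (real j + 2) * (real (2 + j + p) ^ p * c)" by (simp add: algebra_simps)
  also have "\<dots> \<le> real (2 + j + p) * (real (2 + j + p) ^ p * c)"
    using c by (intro mult_right_mono) auto
  finally show ?case by (simp add: add_ac mult_ac)
qed (use assms in auto)

text \<open>Only the path that never lowers \<open>t\<close> has no denominator, and it contributes
  exactly \<open>f t\<close>; every other path carries a factor of order 1 / t.\<close>

lemma window_sum_near:
  fixes f :: "nat \<Rightarrow> 'a :: real_normed_vector"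
  assumes "\<theta> \<ge> 0" "p < t" "\<And>q. q \<le> p \<Longrightarrow> norm (f (t - q)) \<le> c"
  shows "norm (window_sum \<theta> f p j t - f t) \<le> real (1 + j + p) ^ p * c * (2 / t)"
  using assms(2,3)
proof (induction p arbitrary: j)
  case 0
  have "norm (f (t - 0)) \<le> c" by (rule 0) simp
  hence "0 \<le> c" using norm_ge_zero order_trans by blast
  thus ?case by simp
next
  case (Suc p)
  have "norm (f (t - 0)) \<le> c" by (rule Suc.prems) simp
  hence c: "c \<ge> 0" using norm_ge_zero order_trans by blast
  define X where "X = real (2 + j + p) ^ p * c"
  have X: "X \<ge> 0" using c by (simp add: X_def)
  have 1: "norm (window_sum \<theta> f p j t - f t) \<le> X * (2 / t)"
  proof -
    have "norm (window_sum \<theta> f p j t - f t) \<le> real (1 + j + p) ^ p * c * (2 / t)" using Suc by auto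
    also have "\<dots> \<le> X * (2 / t)" unfolding X_def using c by (intro mult_right_mono power_mono) auto
    finally show ?thesis .
  qed
  have "norm (f (t - 1 - q)) \<le> c" if "q \<le> p" for q using Suc.prems(2)[of "Suc q"] that by simp
  hence 2: "norm (window_sum \<theta> f p (Suc j) (t - 1)) \<le> X"
    using window_sum_bound[of \<theta> p "t - 1" f c "Suc j"] assms(1) Suc.prems by (simp add: X_def)
  have t: "real t \<ge> 2" using Suc.prems by simp
  have co: "(real j + 1) / (real t - 1 + \<theta>) \<le> (real j + 1) * (2 / t)"
  proof -
    have "1 / (real t - 1 + \<theta>) \<le> 2 / t" using t assms(1) by (simp add: field_simps)
    hence "(real j + 1) * (1 / (real t - 1 + \<theta>)) \<le> (real j + 1) * (2 / t)" by (intro mult_left_mono) auto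
    thus ?thesis by simp
  qed
  have co0: "0 \<le> (real j + 1) / (real t - 1 + \<theta>)" using t assms(1) by auto
  have 3: "norm (((real j + 1) / (real t - 1 + \<theta>)) *\<^sub>R window_sum \<theta> f p (Suc j) (t - 1)) \<le>
      (real j + 1) * (2 / t) * X"
    unfolding norm_scaleR abs_of_nonneg[OF co0] by (intro mult_mono co 2) auto
  have "norm (window_sum \<theta> f (Suc p) j t - f t) =
    norm ((window_sum \<theta> f p j t - f t) + ((real j + 1) / (real t - 1 + \<theta>)) *\<^sub>R window_sum \<theta> f p (Suc j) (t - 1))"
    by (simp add: algebra_simps)
  also have "\<dots> \<le> X * (2 / t) + (real j + 1) * (2 / t) * X"
    by (intro norm_triangle_le add_mono 1 3)
  also have "\<dots> = (real j + 2) * (X * (2 / t))" using t by (simp add: field_simps)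
  also have "\<dots> \<le> real (2 + j + p) * (X * (2 / t))" using X by (intro mult_right_mono) auto
  finally show ?case by (simp add: X_def add_ac mult_ac)
qed

lemma separated_gf_coefficient:
  assumes "b \<ge> 0" "b \<le> \<theta>" "2 < N" "N \<le> t"
  shows "0 \<le> (real t - real N + b) / ((real t - 1 + \<theta>) * (real t - 2 + \<theta>))"
    "(real t - real N + b) / ((real t - 1 + \<theta>) * (real t - 2 + \<theta>)) \<le> 2 / t"
proof -
  have t: "real t \<ge> 3" using assms by simp
  have 1: "(real t - real N + b) / (real t - 2 + \<theta>) \<le> 1" using assms t by simp
  have 0: "0 \<le> (real t - real N + b) / (real t - 2 + \<theta>)" using assms t by simp
  have 2: "1 / (real t - 1 + \<theta>) \<le> 2 / t" using t assms by (simp add: field_simps)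
  have "(real t - real N + b) / (real t - 2 + \<theta>) * (1 / (real t - 1 + \<theta>)) \<le> 1 * (2 / t)"
    using 0 1 2 t assms by (intro mult_mono) auto
  thus "(real t - real N + b) / ((real t - 1 + \<theta>) * (real t - 2 + \<theta>)) \<le> 2 / t"
    by (simp add: mult.commute)
  show "0 \<le> (real t - real N + b) / ((real t - 1 + \<theta>) * (real t - 2 + \<theta>))"
    using assms t by (intro divide_nonneg_nonneg mult_nonneg_nonneg) auto
qed

lemma separated_gf_bounded:
  fixes w :: "'a :: real_normed_field"
  assumes k: "k \<ge> 2"
  shows "\<exists>K. \<forall>b \<theta> N t. 0 \<le> b \<longrightarrow> b \<le> \<theta> \<longrightarrow> N \<le> t \<longrightarrow> norm (separated_gf k b \<theta> w N t) \<le> K"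
proof -
  define W where "W = real k ^ (k - 2)"
  define C where "C = norm w * (2 * W)"
  have C: "C \<ge> 0" by (simp add: C_def W_def)
  obtain K where K: "\<forall>u :: nat \<Rightarrow> nat \<Rightarrow> real.
    (\<forall>N t. N \<le> k \<longrightarrow> N \<le> t \<longrightarrow> u N t \<le> 1) \<longrightarrow>
    (\<forall>N t. k < N \<longrightarrow> N \<le> t \<longrightarrow> (\<exists>p. 2 \<le> p \<and> p \<le> k \<and> u N t \<le> u (N - 1) t + C / t * u (N - k) (t - p))) \<longrightarrow>
    (\<forall>N t. N \<le> t \<longrightarrow> u N t \<le> K)"
    using delayed_gronwall[OF k C, of 1] by auto
  have "norm (separated_gf k b \<theta> w N t) \<le> K" if b: "0 \<le> b" "b \<le> \<theta>" and Nt: "N \<le> t" for b \<theta> N t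
  proof (rule K[rule_format, of "\<lambda>N t. norm (separated_gf k b \<theta> w N t)", OF _ _ Nt])
    show "norm (separated_gf k b \<theta> w N t) \<le> 1" if "N \<le> k" for N t
      using that by (simp add: separated_gf.simps[of k b \<theta> w N])
    fix N t :: nat assume N: "k < N" "N \<le> t"
    let ?g = "separated_gf k b \<theta> w"
    define c where "c = (real t - real N + b) / ((real t - 1 + \<theta>) * (real t - 2 + \<theta>))"
    have c: "0 \<le> c" "c \<le> 2 / t" unfolding c_def using separated_gf_coefficient[of b \<theta> N t] b N k by auto
    \<comment> \<open>The window mixes the values at t - 2, ..., t - k, while
      \<open>delayed_gronwall\<close> admits one delayed value. The largest of them serves, and its
      position supplies \<open>p\<close>.\<close>
    define M where "M = Max ((\<lambda>q. norm (?g (N - k) (t - 2 - q))) ` {..k - 2})"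
    have "M \<in> (\<lambda>q. norm (?g (N - k) (t - 2 - q))) ` {..k - 2}" unfolding M_def by (intro Max_in) auto
    then obtain q where q: "q \<le> k - 2" "M = norm (?g (N - k) (t - 2 - q))" by auto
    have Mge: "norm (?g (N - k) (t - 2 - q)) \<le> M" if "q \<le> k - 2" for q
      unfolding M_def using that by (intro Max_ge) auto
    have M0: "M \<ge> 0" unfolding q(2) by simp
    have "norm (window_sum \<theta> (?g (N - k)) (k - 2) 1 (t - 2)) \<le> real (1 + 1 + (k - 2)) ^ (k - 2) * M"
      using b N k Mge by (intro window_sum_bound) auto
    also have "1 + 1 + (k - 2) = k" using k by simp
    finally have win: "norm (window_sum \<theta> (?g (N - k)) (k - 2) 1 (t - 2)) \<le> W * M" by (simp add: W_def)
    have "?g N t = ?g (N - 1) t + w * (c *\<^sub>R window_sum \<theta> (?g (N - k)) (k - 2) 1 (t - 2))"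
      using N k by (subst separated_gf.simps) (simp add: c_def)
    hence "norm (?g N t) \<le> norm (?g (N - 1) t) + norm w * (c * norm (window_sum \<theta> (?g (N - k)) (k - 2) 1 (t - 2)))"
      using norm_triangle_ineq[of "?g (N - 1) t"
          "w * (c *\<^sub>R window_sum \<theta> (?g (N - k)) (k - 2) 1 (t - 2))"] c
      by (simp add: norm_mult mult.left_commute)
    also have "norm w * (c * norm (window_sum \<theta> (?g (N - k)) (k - 2) 1 (t - 2))) \<le> norm w * (2 / t * (W * M))"
      using win c M0 by (intro mult_left_mono mult_mono) auto
    also have "\<dots> = C / t * norm (?g (N - k) (t - (2 + q)))" unfolding q(2) C_def by simp
    finally show "\<exists>p. 2 \<le> p \<and> p \<le> k \<and> norm (?g N t) \<le> norm (?g (N - 1) t) + C / t * norm (?g (N - k) (t - p))"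
      using q(1) k by (intro exI[of _ "2 + q"]) auto
  qed
  thus ?thesis by blast
qed

text \<open>With x = N / t, a step in N has length 1 / t and the recurrence coefficient is about (1
  - x) / t. The exponent therefore solves p' = 1 - x, p(0) = 0, that is p(x) = x - x^2 / 2.
  Expectations use s = 0, so N = t and the exponent is 1 / 2.\<close>

definition profile :: "nat \<Rightarrow> nat \<Rightarrow> real" where
  "profile N t = N / t - (N / t) ^ 2 / 2"

lemma profile_bounds:
  assumes "N \<le> t"
  shows "0 \<le> profile N t" "profile N t \<le> N / t" "profile N t \<le> 1"
proof -
  have x: "0 \<le> N / t" "N / t \<le> (1 :: real)" using assms by (auto simp: divide_le_eq)
  have "x ^ 2 \<le> x" if "0 \<le> x" "x \<le> 1" for x :: real
    using that by (simp add: power2_eq_square mult_left_le)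
  from this[OF x] have "(N / t) ^ 2 \<le> N / t" .
  thus "0 \<le> profile N t" using x unfolding profile_def by linarith
  show "profile N t \<le> N / t" by (simp add: profile_def)
  thus "profile N t \<le> 1" using x by simp
qed

lemma norm_exp_profile_le:
  fixes w :: complex
  assumes "N \<le> t"
  shows "norm (exp (w * profile N t)) \<le> exp (norm w)"
proof -
  have "norm (exp (w * profile N t)) \<le> exp (norm (w * profile N t))" by (rule norm_exp)
  also have "\<dots> \<le> exp (norm w)"
    using profile_bounds[OF assms] by (simp add: norm_mult mult_left_le)
  finally show ?thesis .
qed

lemma norm_exp_minus_1_le:
  fixes z :: complex
  assumes "norm z \<le> c"
  shows "norm (exp z - 1) \<le> exp c * norm z"
proof -
  have "norm (exp z - (\<Sum>k\<le>0. z ^ k / fact k)) \<le> exp \<bar>Re z\<bar> * norm z ^ Suc 0 / fact 0"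
    by (rule Taylor_exp)
  also have "\<dots> \<le> exp c * norm z"
    using abs_Re_le_cmod[of z] assms by (auto intro!: mult_right_mono)
  finally show ?thesis by simp
qed

lemma norm_exp_minus_linear_le:
  fixes z :: complex
  assumes "norm z \<le> c"
  shows "norm (exp z - 1 - z) \<le> exp c * (norm z) ^ 2"
proof -
  have "norm (exp z - (\<Sum>k\<le>1. z ^ k / fact k)) \<le> exp \<bar>Re z\<bar> * norm z ^ Suc 1 / fact 1"
    by (rule Taylor_exp)
  also have "\<dots> \<le> exp c * norm z ^ 2"
    using abs_Re_le_cmod[of z] assms by (auto intro!: mult_right_mono simp: numeral_2_eq_2)
  finally show ?thesis by (simp add: algebra_simps)
qed

lemma profile_diff:
  assumes "1 \<le> N" "N \<le> t"
  shows "profile N t - profile (N - 1) t = (real t - real N + 1 / 2) / (real t) ^ 2"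
  using assms by (simp add: profile_def of_nat_diff field_simps power2_eq_square)

lemma profile_shift:
  assumes k: "2 \<le> k" and N: "k < N" "N \<le> t"
  shows "\<bar>profile (N - k) (t - 2) - profile (N - 1) t\<bar> \<le> 3 * (real k + 1) / t"
proof -
  define x where "x = real (N - k) / real (t - 2)"
  define y where "y = real (N - 1) / real t"
  have t: "real t \<ge> 3" using assms by simp
  have x: "0 \<le> x" "x \<le> 1" using assms by (auto simp: x_def divide_le_eq)
  have y: "0 \<le> y" "y \<le> 1" using assms by (auto simp: y_def divide_le_eq)
  have "profile (N - k) (t - 2) - profile (N - 1) t = (x - y) * (1 - (x + y) / 2)"
    unfolding profile_def x_def[symmetric] y_def[symmetric]
    by (simp add: field_simps power2_eq_square)
  hence "\<bar>profile (N - k) (t - 2) - profile (N - 1) t\<bar> = \<bar>x - y\<bar> * \<bar>1 - (x + y) / 2\<bar>"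
    by (simp add: abs_mult)
  also have "\<dots> \<le> \<bar>x - y\<bar> * 1" using x y by (intro mult_left_mono) auto
  also have "x - y = (2 * (real N - 1) - (real k - 1) * t) / (t * (real t - 2))"
    using assms t by (simp add: x_def y_def of_nat_diff field_simps)
  also have "\<bar>\<dots>\<bar> * 1 = \<bar>2 * (real N - 1) - (real k - 1) * t\<bar> / (t * (real t - 2))"
    using t by (simp add: abs_mult)
  also have "\<dots> \<le> ((real k + 1) * t) / (t * (real t - 2))"
  proof (rule divide_right_mono)
    have "0 \<le> (real k - 1) * t" using k by simp
    moreover have "2 * (real N - 1) \<le> 2 * real t" using N by simp
    moreover have "2 * (real N - 1) \<ge> 0" using N by simp
    ultimately show "\<bar>2 * (real N - 1) - (real k - 1) * t\<bar> \<le> (real k + 1) * t"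
      by (auto simp: abs_le_iff algebra_simps)
  qed (use t in auto)
  also have "\<dots> = (real k + 1) / (real t - 2)" using t by simp
  also have "\<dots> \<le> (real k + 1) / (t / 3)" using t by (intro divide_left_mono) auto
  finally show ?thesis by (simp add: mult.commute)
qed

text \<open>The second fraction is the exact increment of \<open>profile\<close> by
  \<open>profile_diff\<close>. The parameters \<open>b\<close> and \<open>\<theta>\<close> perturb
  the coefficient only to order 1 / t^2, so they leave no trace in the limit.\<close>

lemma separated_gf_coefficient_near:
  assumes b: "0 \<le> b" "b \<le> \<theta>" "\<theta> \<le> B" and N: "2 < N" "N \<le> t"
  shows "\<bar>(real t - real N + b) / ((real t - 1 + \<theta>) * (real t - 2 + \<theta>)) -
      (real t - real N + 1 / 2) / (real t) ^ 2\<bar> \<le> 9 * (4 * B + 7 + B ^ 2) / (real t) ^ 2"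
proof -
  define s where "s = real t - real N"
  define q where "q = (real t - 1 + \<theta>) * (real t - 2 + \<theta>)"
  define r where "r = (2 * \<theta> - 3) * t + (\<theta> - 1) * (\<theta> - 2)"
  define M where "M = 2 * (4 * B + 7 + B ^ 2)"
  have t: "real t \<ge> 3" using N by simp
  have s: "0 \<le> s" "s + 1 / 2 \<le> t" using N by (auto simp: s_def)
  have B: "B \<ge> 0" using b by simp
  have q: "q \<ge> (real t) ^ 2 * (2 / 9)"
  proof -
    \<comment> \<open>From t \<ge> 3: then t - 1 \<ge> 2 t / 3 and t - 2 \<ge> t / 3.\<close>
    have "(2 / 3 * t) * (1 / 3 * t) \<le> (real t - 1 + \<theta>) * (real t - 2 + \<theta>)"
      using t b by (intro mult_mono) auto
    thus ?thesis by (simp add: q_def power2_eq_square)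
  qed
  have q0: "q > 0" using q t by (smt (verit) mult_pos_pos zero_less_power divide_pos_pos)
  have "\<bar>r\<bar> \<le> (2 * B + 3) * t + (B + 1) * (B + 2) * 1"
  proof -
    have "\<bar>r\<bar> \<le> \<bar>2 * \<theta> - 3\<bar> * t + \<bar>\<theta> - 1\<bar> * \<bar>\<theta> - 2\<bar>"
      unfolding r_def using abs_triangle_ineq[of "(2 * \<theta> - 3) * t" "(\<theta> - 1) * (\<theta> - 2)"]
      by (simp add: abs_mult)
    also have "\<dots> \<le> (2 * B + 3) * t + (B + 1) * (B + 2)"
      using b by (intro add_mono mult_mono) (auto simp: abs_le_iff)
    finally show ?thesis by simp
  qed
  also have "\<dots> \<le> (2 * B + 3) * t + (B + 1) * (B + 2) * t"
    using t B by (intro add_mono mult_left_mono) auto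
  finally have r: "\<bar>r\<bar> \<le> (2 * B + 3 + (B + 1) * (B + 2)) * t" by (simp add: algebra_simps)
  have "\<bar>(b - 1 / 2) * (real t) ^ 2 - (s + 1 / 2) * r\<bar> \<le> \<bar>b - 1 / 2\<bar> * (real t) ^ 2 + (s + 1 / 2) * \<bar>r\<bar>"
    using abs_triangle_ineq4[of "(b - 1 / 2) * (real t) ^ 2" "(s + 1 / 2) * r"] s by (simp add: abs_mult)
  also have "\<dots> \<le> (B + 1) * (real t) ^ 2 + t * ((2 * B + 3 + (B + 1) * (B + 2)) * t)"
    using b s r B by (intro add_mono mult_mono mult_right_mono) (auto simp: abs_le_iff)
  also have "\<dots> \<le> M * (real t) ^ 2"
  proof -
    have "(B + 1) * (real t) ^ 2 + t * ((2 * B + 3 + (B + 1) * (B + 2)) * t) =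
      (B ^ 2 + 6 * B + 6) * (real t) ^ 2" by (simp add: algebra_simps power2_eq_square)
    also have "\<dots> \<le> M * (real t) ^ 2" using B by (intro mult_right_mono) (auto simp: M_def)
    finally show ?thesis .
  qed
  finally have num: "\<bar>(b - 1 / 2) * (real t) ^ 2 - (s + 1 / 2) * r\<bar> \<le> M * (real t) ^ 2" .
  have "q = (real t) ^ 2 + r" by (simp add: q_def r_def algebra_simps power2_eq_square)
  hence "(s + b) * (real t) ^ 2 - (s + 1 / 2) * q = (b - 1 / 2) * (real t) ^ 2 - (s + 1 / 2) * r"
    by (simp add: algebra_simps)
  moreover have "(s + b) / q - (s + 1 / 2) / (real t) ^ 2 =
      ((s + b) * (real t) ^ 2 - (s + 1 / 2) * q) / (q * (real t) ^ 2)"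
    using t q0 by (intro diff_frac_eq) auto
  ultimately have "(s + b) / q - (s + 1 / 2) / (real t) ^ 2 =
      ((b - 1 / 2) * (real t) ^ 2 - (s + 1 / 2) * r) / ((real t) ^ 2 * q)"
    by (simp add: mult.commute)
  hence "\<bar>(s + b) / q - (s + 1 / 2) / (real t) ^ 2\<bar> =
      \<bar>(b - 1 / 2) * (real t) ^ 2 - (s + 1 / 2) * r\<bar> / ((real t) ^ 2 * q)"
    using q0 by (simp add: abs_mult)
  also have "\<dots> \<le> (M * (real t) ^ 2) / ((real t) ^ 2 * q)"
    using num q0 by (intro divide_right_mono) auto
  also have "\<dots> = M / q" using t by simp
  also have "\<dots> \<le> M / ((real t) ^ 2 * (2 / 9))"
    using q q0 t B by (intro divide_left_mono mult_pos_pos) (auto simp: M_def)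
  also have "\<dots> = 9 * (4 * B + 7 + B ^ 2) / (real t) ^ 2" using t by (simp add: M_def field_simps)
  finally show ?thesis unfolding s_def q_def .
qed

text \<open>With e the error, t e satisfies the delayed inequality up to an inhomogeneity G / t.
  Applying \<open>delayed_gronwall\<close> to t e + 1 removes it, because C / t times the added 1
  dominates G / t.\<close>

lemma separated_gf_asymp:
  fixes w :: complex
  assumes k: "k \<ge> 2" and B0: "B \<ge> 0"
  shows "\<exists>K. \<forall>b \<theta> N t. 0 \<le> b \<longrightarrow> b \<le> \<theta> \<longrightarrow> \<theta> \<le> B \<longrightarrow> N \<le> t \<longrightarrow>
    real t * norm (separated_gf k b \<theta> w N t - exp (w * profile N t)) \<le> K"
proof -
  obtain K where K: "\<And>b \<theta> N t. 0 \<le> b \<Longrightarrow> b \<le> \<theta> \<Longrightarrow> N \<le> t \<Longrightarrow> norm (separated_gf k b \<theta> w N t) \<le> K"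
    using separated_gf_bounded[OF k, of w] by blast
  have "norm (separated_gf k 0 0 w 0 0) \<le> K" by (rule K) auto
  hence K0: "K \<ge> 0" using norm_ge_zero order_trans by blast
  define W where "W = real k ^ (k - 2)"
  define V where "V = norm w"
  \<comment> \<open>Four local errors of order 1 / t^2: the window replaced by its value at t - 2,
    the exponential replaced by its linear part, the coefficient replaced by the increment of the
    profile, and the profile shifted from (N - 1, t) to (N - k, t - 2).\<close>
  define G1 where "G1 = 12 * V * W * K"
  define G2 where "G2 = exp V * exp V * V ^ 2"
  define G3 where "G3 = V * (9 * (4 * B + 7 + B ^ 2) * exp V)"
  define G4 where "G4 = V * (exp V * (exp V * (V * (3 * (real k + 1)))))"
  define G where "G = G1 + G2 + G3 + G4"
  \<comment> \<open>The coefficient bound 2 / t becomes 6 / t because the delayed error is scaled by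
    t - 2 instead of t, and t \<le> 3 (t - 2) for t \<ge> 3.\<close>
  define C where "C = 6 * V + G"
  \<comment> \<open>For N \<le> k the generating function is 1, and the exponential differs from 1
    by at most V exp V N / t; multiplication by t leaves N \<le> k.\<close>
  define c0 where "c0 = real k * (V * exp V) + 1"
  have V: "V \<ge> 0" by (simp add: V_def)
  have G: "G \<ge> 0" using K0 V B0 by (simp add: G_def G1_def G2_def G3_def G4_def W_def)
  have C: "C \<ge> 0" using V G by (simp add: C_def)
  have c0: "c0 \<ge> 0" using V by (simp add: c0_def)
  obtain K' where K': "\<forall>u :: nat \<Rightarrow> nat \<Rightarrow> real.
    (\<forall>N t. N \<le> k \<longrightarrow> N \<le> t \<longrightarrow> u N t \<le> c0) \<longrightarrow>
    (\<forall>N t. k < N \<longrightarrow> N \<le> t \<longrightarrow> (\<exists>p. 2 \<le> p \<and> p \<le> k \<and> u N t \<le> u (N - 1) t + C / t * u (N - k) (t - p))) \<longrightarrow>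
    (\<forall>N t. N \<le> t \<longrightarrow> u N t \<le> K')"
    using delayed_gronwall[OF k C c0] by auto
  have "real t * norm (separated_gf k b \<theta> w N t - exp (w * profile N t)) \<le> K'"
    if b: "0 \<le> b" "b \<le> \<theta>" "\<theta> \<le> B" and Nt: "N \<le> t" for b \<theta> N t
  proof -
    let ?g = "separated_gf k b \<theta> w"
    let ?E = "\<lambda>N t. exp (w * profile N t)"
    define e where "e N t = norm (?g N t - ?E N t)" for N t
    have "real t * e N t + 1 \<le> K'"
    proof (rule K'[rule_format, of "\<lambda>N t. real t * e N t + 1", OF _ _ Nt])
      show "real t * e N t + 1 \<le> c0" if N: "N \<le> k" "N \<le> t" for N t
      proof -
        have p: "norm (w * profile N t) = V * profile N t" "V * profile N t \<le> V"
          using profile_bounds[OF N(2)] V by (simp_all add: norm_mult V_def mult_left_le)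
        have "e N t = norm (exp (w * profile N t) - 1)"
          using N by (simp add: e_def separated_gf.simps[of k b \<theta> w N] norm_minus_commute)
        also have "\<dots> \<le> exp V * (V * profile N t)"
          using norm_exp_minus_1_le[of "w * profile N t" V] p by simp
        also have "\<dots> \<le> exp V * (V * (N / t))"
          using profile_bounds[OF N(2)] V by (intro mult_left_mono) auto
        finally have "real t * e N t \<le> real t * (exp V * (V * (N / t)))" by (intro mult_left_mono) auto
        also have "\<dots> \<le> real N * (V * exp V)" using V by (cases "t = 0") auto
        also have "\<dots> \<le> real k * (V * exp V)" using V N by (intro mult_right_mono) auto
        finally show ?thesis by (simp add: c0_def)
      qed
      fix N t :: nat assume N: "k < N" "N \<le> t"
      have t: "real t \<ge> 3" "t > 0" using N k by auto
      define c where "c = (real t - real N + b) / ((real t - 1 + \<theta>) * (real t - 2 + \<theta>))"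
      define \<Delta> where "\<Delta> = (real t - real N + 1 / 2) / (real t) ^ 2"
      define v where "v = window_sum \<theta> (?g (N - k)) (k - 2) 1 (t - 2)"
      define E1 where "E1 = ?E (N - 1) t"
      define E2 where "E2 = ?E (N - k) (t - 2)"
      have c: "0 \<le> c" "c \<le> 2 / t" unfolding c_def using separated_gf_coefficient[of b \<theta> N t] b N k by auto
      have \<Delta>: "0 \<le> \<Delta>" "\<Delta> \<le> 1 / t"
      proof -
        show "0 \<le> \<Delta>" using N by (simp add: \<Delta>_def)
        have "(real t - real N + 1 / 2) / (real t) ^ 2 \<le> real t / (real t) ^ 2"
          using N by (intro divide_right_mono) auto
        also have "\<dots> = 1 / t" using t by (simp add: power2_eq_square)
        finally show "\<Delta> \<le> 1 / t" by (simp add: \<Delta>_def)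
      qed
      have nE: "norm E1 \<le> exp V" "norm E2 \<le> exp V"
        unfolding E1_def E2_def V_def using N k by (intro norm_exp_profile_le; simp)+
      have 1: "norm (w * (c *\<^sub>R (v - ?g (N - k) (t - 2)))) \<le> G1 / (real t) ^ 2"
      proof -
        have "norm (v - ?g (N - k) (t - 2)) \<le> real (1 + 1 + (k - 2)) ^ (k - 2) * K * (2 / real (t - 2))"
          unfolding v_def using b N k by (intro window_sum_near K) auto
        also have "1 + 1 + (k - 2) = k" using k by simp
        also have "2 / real (t - 2) \<le> 6 / t" using t N k by (simp add: of_nat_diff field_simps)
        finally have "norm (v - ?g (N - k) (t - 2)) \<le> W * K * (6 / t)"
          using K0 by (simp add: W_def mult_left_mono)
        hence "V * (c * norm (v - ?g (N - k) (t - 2))) \<le> V * (2 / t * (W * K * (6 / t)))"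
          using c V by (intro mult_left_mono mult_mono) auto
        also have "\<dots> = G1 / (real t) ^ 2" by (simp add: G1_def power2_eq_square)
        finally show ?thesis using c by (simp add: norm_mult V_def mult.left_commute)
      qed
      have 2: "norm (E1 * (exp (w * \<Delta>) - 1 - w * \<Delta>)) \<le> G2 / (real t) ^ 2"
      proof -
        have n: "norm (w * \<Delta>) = V * \<Delta>" using \<Delta> by (simp add: norm_mult V_def)
        have "V * \<Delta> \<le> V * 1" using \<Delta> t V by (intro mult_left_mono order_trans[OF \<Delta>(2)]) auto
        hence "norm (exp (w * \<Delta>) - 1 - w * \<Delta>) \<le> exp V * (V * \<Delta>) ^ 2"
          using norm_exp_minus_linear_le[of "w * \<Delta>" V] n by simp
        also have "\<dots> \<le> exp V * (V * (1 / t)) ^ 2"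
          using \<Delta> V by (intro mult_left_mono power_mono) auto
        finally have "norm E1 * norm (exp (w * \<Delta>) - 1 - w * \<Delta>) \<le> exp V * (exp V * (V * (1 / t)) ^ 2)"
          using nE(1) by (intro mult_mono) auto
        thus ?thesis by (simp add: norm_mult G2_def power_divide)
      qed
      have 3: "norm (w * ((c - \<Delta>) *\<^sub>R E2)) \<le> G3 / (real t) ^ 2"
      proof -
        have "\<bar>c - \<Delta>\<bar> \<le> 9 * (4 * B + 7 + B ^ 2) / (real t) ^ 2"
          unfolding c_def \<Delta>_def using b N k by (intro separated_gf_coefficient_near) auto
        hence "V * (\<bar>c - \<Delta>\<bar> * norm E2) \<le> V * (9 * (4 * B + 7 + B ^ 2) / (real t) ^ 2 * exp V)"
          using nE(2) V B0 by (intro mult_left_mono mult_mono) auto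
        thus ?thesis by (simp add: norm_mult V_def G3_def mult.left_commute)
      qed
      have 4: "norm (w * (\<Delta> *\<^sub>R (E2 - E1))) \<le> G4 / (real t) ^ 2"
      proof -
        define d where "d = profile (N - k) (t - 2) - profile (N - 1) t"
        have d: "\<bar>d\<bar> \<le> 3 * (real k + 1) / t" unfolding d_def using profile_shift[OF k N] .
        have le: "N - k \<le> t - 2" "N - 1 \<le> t" using N k by auto
        have "\<bar>d\<bar> \<le> 1"
          using profile_bounds(1,3)[OF le(1)] profile_bounds(1,3)[OF le(2)] unfolding d_def by linarith
        hence "norm (w * d) \<le> V" using V by (simp add: norm_mult V_def mult_left_le)
        hence "norm (exp (w * d) - 1) \<le> exp V * norm (w * d)" by (rule norm_exp_minus_1_le)
        also have "\<dots> \<le> exp V * (V * (3 * (real k + 1) / t))"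
          using d V by (simp only: norm_mult V_def[symmetric] norm_of_real) (intro mult_left_mono, auto)
        finally have ed: "norm (exp (w * d) - 1) \<le> exp V * (V * (3 * (real k + 1) / t))" .
        have E21: "E2 - E1 = E1 * (exp (w * d) - 1)"
        proof -
          have "w * profile (N - k) (t - 2) = w * profile (N - 1) t + w * d"
            by (simp add: d_def algebra_simps)
          thus ?thesis by (simp add: E1_def E2_def exp_add algebra_simps)
        qed
        have "norm (E2 - E1) \<le> exp V * (exp V * (V * (3 * (real k + 1) / t)))"
          unfolding E21 norm_mult by (intro mult_mono nE(1) ed) auto
        hence "V * (\<Delta> * norm (E2 - E1)) \<le> V * (1 / t * (exp V * (exp V * (V * (3 * (real k + 1) / t)))))"
          using \<Delta> V by (intro mult_left_mono mult_mono) auto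
        also have "\<dots> = G4 / (real t) ^ 2" by (simp add: G4_def power2_eq_square)
        finally show ?thesis using \<Delta> by (simp add: norm_mult V_def mult.left_commute)
      qed
      have EN: "?E N t = E1 * exp (w * \<Delta>)"
      proof -
        have "profile N t = profile (N - 1) t + \<Delta>"
          using profile_diff[of N t] N by (simp add: \<Delta>_def)
        thus ?thesis by (simp add: E1_def distrib_left exp_add)
      qed
      have gN: "?g N t = ?g (N - 1) t + w * (c *\<^sub>R v)"
        using N k by (subst separated_gf.simps) (simp add: c_def v_def)
      \<comment> \<open>The first two terms propagate earlier errors, the other four are the local
        ones bounded by \<open>G1\<close> to \<open>G4\<close>. The products
        \<open>c *\<^sub>R E2\<close>, \<open>\<Delta> *\<^sub>R E2\<close> and
        \<open>\<Delta> *\<^sub>R E1\<close> cancel in between.\<close>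
      have decomp: "?g N t - ?E N t = (?g (N - 1) t - E1) + (w * (c *\<^sub>R (?g (N - k) (t - 2) - E2)) +
          (w * (c *\<^sub>R (v - ?g (N - k) (t - 2))) + (- (E1 * (exp (w * \<Delta>) - 1 - w * \<Delta>)) +
          (w * ((c - \<Delta>) *\<^sub>R E2) + w * (\<Delta> *\<^sub>R (E2 - E1))))))"
        unfolding gN EN by (simp add: scaleR_conv_of_real algebra_simps)
      have "e N t \<le> e (N - 1) t + (V * (2 / t * e (N - k) (t - 2)) +
          (G1 / (real t) ^ 2 + (G2 / (real t) ^ 2 + (G3 / (real t) ^ 2 + G4 / (real t) ^ 2))))"
        unfolding e_def[of N t] decomp
      proof (intro norm_triangle_le add_mono 1 3 4)
        show "norm (?g (N - 1) t - E1) \<le> e (N - 1) t" by (simp add: e_def E1_def)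
        have "V * (c * norm (?g (N - k) (t - 2) - E2)) \<le> V * (2 / t * e (N - k) (t - 2))"
          using c V by (intro mult_left_mono mult_mono) (auto simp: e_def E2_def)
        thus "norm (w * (c *\<^sub>R (?g (N - k) (t - 2) - E2))) \<le> V * (2 / t * e (N - k) (t - 2))"
          using c by (simp add: norm_mult V_def mult.left_commute)
        show "norm (- (E1 * (exp (w * \<Delta>) - 1 - w * \<Delta>))) \<le> G2 / (real t) ^ 2"
          using 2 by (simp only: norm_minus_cancel)
      qed
      also have "\<dots> = e (N - 1) t + V * (2 / t * e (N - k) (t - 2)) + G / (real t) ^ 2"
        by (simp add: G_def add_divide_distrib)
      finally have "real t * e N t \<le> real t * (e (N - 1) t + V * (2 / t * e (N - k) (t - 2)) + G / (real t) ^ 2)"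
        by (intro mult_left_mono) auto
      also have "\<dots> = real t * e (N - 1) t + 2 * V * e (N - k) (t - 2) + G / t"
        using t by (simp add: field_simps power2_eq_square)
      also have "2 * V * e (N - k) (t - 2) \<le> 6 * V / t * (real (t - 2) * e (N - k) (t - 2))"
      proof -
        have one: "1 \<le> 3 / t * real (t - 2)" using t by (simp add: of_nat_diff field_simps)
        have "2 * V * e (N - k) (t - 2) * 1 \<le> 2 * V * e (N - k) (t - 2) * (3 / t * real (t - 2))"
          using V by (intro mult_left_mono one) (auto simp: e_def)
        thus ?thesis by (simp add: mult_ac)
      qed
      finally have "real t * e N t + 1 \<le> real t * e (N - 1) t + 1 +
          (6 * V / t * (real (t - 2) * e (N - k) (t - 2)) + G / t)" by simp
      also have "6 * V / t * (real (t - 2) * e (N - k) (t - 2)) + G / t \<le>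
          C / t * (real (t - 2) * e (N - k) (t - 2) + 1)"
      proof -
        have "0 \<le> G / t * (real (t - 2) * e (N - k) (t - 2)) + 6 * V / t"
          using G V by (simp add: e_def)
        thus ?thesis by (simp add: C_def algebra_simps add_divide_distrib)
      qed
      finally show "\<exists>p. 2 \<le> p \<and> p \<le> k \<and>
          real t * e N t + 1 \<le> real t * e (N - 1) t + 1 + C / t * (real (t - p) * e (N - k) (t - p) + 1)"
        using k by (intro exI[of _ 2]) auto
    qed
    thus ?thesis by (simp add: e_def)
  qed
  thus ?thesis by blast
qed

section \<open>Clustered columns\<close>

definition finite_expectation :: "nat \<Rightarrow> real \<Rightarrow> real \<Rightarrow> (filling \<Rightarrow> 'a :: real_vector) \<Rightarrow> 'a" where
  "finite_expectation n a b h = (\<Sum>S\<in>staircase_tableaux n. finite_prob n a b S *\<^sub>R h S)"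

lemma drop_columns_steps:
  assumes "m \<le> n"
  shows "alpha_steps k m ((drop_column ^^ (n - m)) S) = alpha_steps k n S \<inter> {..m}"
  using alpha_steps_drops[of k m "n - m" S] assms by simp

context staircase_weights
begin

lemma normalizer_pos: "(al * be) ^ n * pochhammer theta n > 0"
  using al_pos be_pos theta_pos by (simp add: pochhammer_pos)

lemma finite_prob_nonneg: "finite_prob n al be S \<ge> 0"
  using al_pos be_pos normalizer_pos[of n]
  by (simp add: finite_prob_def partition_function_eq weight_def)

lemma weighted_sum_eq_expectation:
  "weighted_sum n h (\<lambda>F. base 0 ^ card F) =
    ((al * be) ^ n * pochhammer theta n) *\<^sub>R finite_expectation n al be h"
proof -
  define Z where "Z = (al * be) ^ n * pochhammer theta n"
  have "Z \<noteq> 0" using normalizer_pos[of n] by (simp only: Z_def)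
  moreover have "partition_function n al be = Z" by (simp only: Z_def partition_function_eq)
  ultimately show ?thesis unfolding Z_def[symmetric]
    by (simp add: weighted_sum_def finite_expectation_def scaleR_sum_right finite_prob_def base_def)
qed

lemma expectation_eqI:
  assumes "weighted_sum n h (\<lambda>F. base 0 ^ card F) = ((al * be) ^ n * pochhammer theta n) *\<^sub>R x"
  shows "finite_expectation n al be h = x"
proof (rule scaleR_left_imp_eq)
  show "(al * be) ^ n * pochhammer theta n \<noteq> 0" using normalizer_pos[of n] by (rule less_imp_neq[symmetric])
qed (use assms in \<open>simp only: weighted_sum_eq_expectation\<close>)

lemma expectation_const: "finite_expectation n al be (\<lambda>_. c) = c"
  using weighted_sum_const[of n c 0] by (intro expectation_eqI) simp

lemma expectation_mono:
  fixes h h' :: "filling \<Rightarrow> real"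
  assumes "\<And>S. h S \<le> h' S"
  shows "finite_expectation n al be h \<le> finite_expectation n al be h'"
  unfolding finite_expectation_def using assms finite_prob_nonneg
  by (intro sum_mono) (auto intro: mult_left_mono)

lemma expectation_add:
  "finite_expectation n al be (\<lambda>S. h S + h' S) =
    finite_expectation n al be h + finite_expectation n al be h'"
  by (simp add: finite_expectation_def scaleR_add_right sum.distrib)

lemma expectation_diff:
  "finite_expectation n al be (\<lambda>S. h S - h' S) =
    finite_expectation n al be h - finite_expectation n al be h'"
  by (simp add: finite_expectation_def scaleR_diff_right sum_subtractf)

lemma expectation_scale:
  fixes h :: "filling \<Rightarrow> real"
  shows "finite_expectation n al be (\<lambda>S. c * h S) = c * finite_expectation n al be h"
  by (simp add: finite_expectation_def sum_distrib_left mult_ac)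

lemma expectation_sum:
  "finite_expectation n al be (\<lambda>S. \<Sum>i\<in>I. h i S) = (\<Sum>i\<in>I. finite_expectation n al be (h i))"
  unfolding finite_expectation_def scaleR_sum_right by (rule sum.swap)

lemma norm_expectation_le:
  fixes h :: "filling \<Rightarrow> 'a :: real_normed_vector"
  shows "norm (finite_expectation n al be h) \<le> finite_expectation n al be (\<lambda>S. norm (h S))"
  unfolding finite_expectation_def
  by (rule order_trans[OF norm_sum]) (simp add: finite_prob_nonneg)

lemma expectation_separated_sum:
  fixes w :: "'a :: real_normed_field"
  assumes "k \<ge> 2"
  shows "finite_expectation n al be (\<lambda>S. separated_sum k w n (alpha_steps k n S)) =
    separated_gf k (1 / be) theta w n n"
  using weighted_sum_separated_sum[OF assms, of n w 0] by (intro expectation_eqI) simp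

lemma weighted_sum_alpha_step:
  assumes k: "k \<ge> 2" and m: "k \<le> m"
  shows "weighted_sum m (\<lambda>S. of_bool (m \<in> alpha_steps k m S) :: real) (\<lambda>F. base s ^ card F) =
    ((al * be) ^ m * pochhammer (real s + theta) m) *
      ((real s + 1 / be) / ((real (s + m) - 1 + theta) * (real (s + m) - 2 + theta)) *
       window_sum theta (\<lambda>_. 1) (k - 2) 1 (s + m - 2))"
proof -
  have "m - k + k = m" "Suc (m - k) = m + 1 - k" using m by auto
  moreover have "m \<in> alpha_steps k m S \<longleftrightarrow> S (m + 1 - k, 1) = Some SymAlpha" for S
    using m by (simp add: alpha_steps_def)
  ultimately show ?thesis
    using weighted_sum_alpha_window[of "m - k" "\<lambda>_. 1 :: real" "\<lambda>_. 1" k s, OF _ k]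
      weighted_sum_const[of "m - k" "1 :: real"]
    by (simp add: add.assoc)
qed

text \<open>The n - m columns to the left are summed out first and raise \<open>s\<close> from 0 to
  n - m, which is where the factor n - m comes from; the two Pochhammer symbols recombine to the
  normaliser.\<close>

lemma probability_alpha_step:
  assumes k: "k \<ge> 2" and m: "k \<le> m" "m \<le> n"
  shows "finite_expectation n al be (\<lambda>S. of_bool (m \<in> alpha_steps k n S) :: real) =
      (real n - real m + 1 / be) / ((real n - 1 + theta) * (real n - 2 + theta)) *
       window_sum theta (\<lambda>_. 1) (k - 2) 1 (n - 2)"
proof (rule expectation_eqI)
  have eq: "m \<in> alpha_steps k m ((drop_column ^^ (n - m)) S) \<longleftrightarrow> m \<in> alpha_steps k n S" for S
    unfolding drop_columns_steps[OF m(2)] by simp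
  have poch: "pochhammer theta (n - m) * pochhammer (real (n - m) + theta) m = pochhammer theta n"
    using pochhammer_product'[of theta "n - m" m] m by (simp add: add.commute)
  have pw: "(al * be) ^ (n - m) * (al * be) ^ m = (al * be) ^ n"
    using m by (simp add: power_add[symmetric])
  have "weighted_sum n (\<lambda>S. of_bool (m \<in> alpha_steps k n S) :: real) (\<lambda>F. base 0 ^ card F) =
    ((al * be) ^ (n - m) * pochhammer theta (n - m)) *
    (((al * be) ^ m * pochhammer (real (n - m) + theta) m) *
      ((real (n - m) + 1 / be) / ((real n - 1 + theta) * (real n - 2 + theta)) *
       window_sum theta (\<lambda>_. 1) (k - 2) 1 (n - 2)))"
    using weighted_sum_drop[of m "n - m" "\<lambda>S. of_bool (m \<in> alpha_steps k m S) :: real" 0]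
      weighted_sum_alpha_step[OF k m(1), of "n - m"] m by (simp add: eq)
  also have "\<dots> = ((al * be) ^ (n - m) * (al * be) ^ m) *
     (pochhammer theta (n - m) * pochhammer (real (n - m) + theta) m) *
      ((real (n - m) + 1 / be) / ((real n - 1 + theta) * (real n - 2 + theta)) *
       window_sum theta (\<lambda>_. 1) (k - 2) 1 (n - 2))" by (simp only: mult_ac)
  finally show "weighted_sum n (\<lambda>S. of_bool (m \<in> alpha_steps k n S) :: real) (\<lambda>F. base 0 ^ card F) =
    ((al * be) ^ n * pochhammer theta n) *\<^sub>R
      ((real n - real m + 1 / be) / ((real n - 1 + theta) * (real n - 2 + theta)) *
       window_sum theta (\<lambda>_. 1) (k - 2) 1 (n - 2))"
    unfolding poch pw using m by (simp add: of_nat_diff)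
qed

text \<open>With p = n - m', the column of \<open>m'\<close> contributes the factor al be (p +
  theta) when unconstrained, and at most al be when its \<alpha> is demanded, with the same
  statistic afterwards. The quotient of these factors is the gain.\<close>

lemma probability_two_alpha_steps:
  assumes k: "k \<ge> 2" and m: "k \<le> m" "m < m'" "m' \<le> n"
  shows "finite_expectation n al be
      (\<lambda>S. of_bool (m \<in> alpha_steps k n S) * of_bool (m' \<in> alpha_steps k n S) :: real) \<le>
    finite_expectation n al be (\<lambda>S. of_bool (m \<in> alpha_steps k n S)) / (real (n - m') + theta)"
proof -
  obtain l where l: "m' = Suc l" using m by (cases m') auto
  define p where "p = n - m'"
  define h where "h S = (of_bool (m \<in> alpha_steps k l S) :: real)" for S
  define E where "E = weighted_sum l h (\<lambda>F. base (Suc p) ^ card F)"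
  define Q where "Q = (al * be) ^ p * pochhammer theta p"
  have Q: "Q > 0" unfolding Q_def by (rule normalizer_pos)
  have n: "n = m' + p" "n = l + Suc p" using m by (auto simp: p_def l)
  have eq1: "m \<in> alpha_steps k l ((drop_column ^^ Suc p) S) \<longleftrightarrow> m \<in> alpha_steps k n S" for S
    using m unfolding alpha_steps_drops n(2)[symmetric] by (simp add: l)
  have eq2: "m \<in> alpha_steps k m' ((drop_column ^^ p) S) \<longleftrightarrow> m \<in> alpha_steps k n S"
    "m' \<in> alpha_steps k m' ((drop_column ^^ p) S) \<longleftrightarrow> m' \<in> alpha_steps k n S" for S
    using m unfolding alpha_steps_drops n(1)[symmetric] by simp_all
  have eq3: "m \<in> alpha_steps k l (drop_column S) \<longleftrightarrow> m \<in> alpha_steps k m' S" for S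
    using m unfolding alpha_steps_drop l[symmetric] by (simp add: l)
  have eq4: "m' \<in> alpha_steps k m' S \<longleftrightarrow> S (m' + 1 - k, 1) = Some SymAlpha" for S
    using m by (simp add: alpha_steps_def)
  have "weighted_sum n (\<lambda>S. h ((drop_column ^^ Suc p) S)) (\<lambda>F. base 0 ^ card F) =
      ((al * be) ^ Suc p * pochhammer theta (Suc p)) * E"
    using weighted_sum_drop[of l "Suc p" h 0] unfolding n(2)[symmetric] by (simp add: E_def)
  hence 1: "weighted_sum n (\<lambda>S. of_bool (m \<in> alpha_steps k n S)) (\<lambda>F. base 0 ^ card F) =
      al * be * (real p + theta) * Q * E"
    unfolding h_def eq1 by (simp add: pochhammer_Suc Q_def mult_ac add.commute)
  have "weighted_sum n (\<lambda>S. of_bool (m \<in> alpha_steps k n S) * of_bool (m' \<in> alpha_steps k n S) :: real)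
      (\<lambda>F. base 0 ^ card F) =
    Q * weighted_sum m' (\<lambda>S. of_bool (S (m' + 1 - k, 1) = Some SymAlpha) *\<^sub>R h (drop_column S)) (\<lambda>F. base p ^ card F)"
    using weighted_sum_drop[of m' p "\<lambda>S. of_bool (S (m' + 1 - k, 1) = Some SymAlpha) *\<^sub>R h (drop_column S)" 0]
    unfolding n(1)[symmetric] eq4[symmetric] h_def eq3 eq2
    by (simp add: Q_def mult.commute)
  also have "\<dots> \<le> Q * (al * be * E)"
    using weighted_sum_alpha_le[of "m' + 1 - k" l h p] Q k m
    unfolding E_def l by (intro mult_left_mono) (auto simp: h_def)
  also have "\<dots> = (al * be * (real p + theta) * Q * E) / (real p + theta)"
    using theta_pos by simp
  finally show ?thesis
    unfolding 1[symmetric] weighted_sum_eq_expectation p_def[symmetric] real_scaleR_def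
      times_divide_eq_right[symmetric]
    using normalizer_pos[of n] by (simp only: mult_le_cancel_left_pos)
qed

end

text \<open>\<open>k \<in> R\<close> is included because \<open>separated_sum\<close> ignores the
  column with index \<open>k\<close>.\<close>

definition clustered :: "nat \<Rightarrow> nat set \<Rightarrow> bool" where
  "clustered k R \<longleftrightarrow> k \<in> R \<or> (\<exists>m\<in>R. \<exists>m'\<in>R. m < m' \<and> m' < m + k)"

lemma of_bool_clustered_le:
  assumes "R \<subseteq> {k..n}"
  shows "(of_bool (clustered k R) :: real) \<le> of_bool (k \<in> R) +
    (\<Sum>m\<in>{k..n}. \<Sum>d\<in>{1..<k}. of_bool (m \<in> R) * of_bool (m + d \<in> R))"
proof (cases "clustered k R \<and> k \<notin> R")
  case True
  then obtain m m' where m: "m \<in> R" "m' \<in> R" "m < m'" "m' < m + k"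
    by (auto simp: clustered_def)
  have "(1 :: real) = of_bool (m \<in> R) * of_bool (m + (m' - m) \<in> R)" using m by simp
  also have "\<dots> \<le> (\<Sum>d\<in>{1..<k}. of_bool (m \<in> R) * of_bool (m + d \<in> R))"
    using m by (intro member_le_sum) auto
  also have "\<dots> \<le> (\<Sum>m\<in>{k..n}. \<Sum>d\<in>{1..<k}. of_bool (m \<in> R) * of_bool (m + d \<in> R))"
    using m assms by (intro member_le_sum[of m]) (auto intro!: sum_nonneg)
  finally show ?thesis using True by simp
next
  case False
  have "(0 :: real) \<le> (\<Sum>m\<in>{k..n}. \<Sum>d\<in>{1..<k}. of_bool (m \<in> R) * of_bool (m + d \<in> R))"
    by (intro sum_nonneg) auto
  thus ?thesis using False by (auto simp: clustered_def)
qed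

text \<open>Union bound over O(n) pairs at distance below \<open>k\<close>. A single \<alpha> has
  probability of order (n - m + B) / n^2, and the numerator compensates the denominator n - m'
  gained from the second one, so each pair costs O(1 / n^2).\<close>

lemma probability_clustered:
  assumes k: "k \<ge> 2" and B: "B \<ge> 0"
  shows "\<exists>K. \<forall>a b n. a > 0 \<longrightarrow> b > 0 \<longrightarrow> 1 / a \<le> B \<longrightarrow> 1 / b \<le> B \<longrightarrow> n \<ge> 2 * k \<longrightarrow>
    finite_expectation n a b (\<lambda>S. of_bool (clustered k (alpha_steps k n S)) :: real) \<le> K / n"
proof -
  define W where "W = real k ^ (k - 2)"
  \<comment> \<open>5 comes from (n - 1) (n - 2) \<ge> n^2 / 5 for n \<ge> 4, \<open>W\<close>
    bounds the window sum of 1, and 1 + k + B bounds (n - m + B) / p for p = n - m - d \<ge>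
    1.\<close>
  define c where "c = 5 * W * (1 + real k + B)"
  have W: "W \<ge> 0" by (simp add: W_def)
  have c: "c \<ge> 0" using W B by (simp add: c_def)
  have "finite_expectation n a b (\<lambda>S. of_bool (clustered k (alpha_steps k n S)) :: real) \<le>
      (c + k * c) / n"
    if a: "a > 0" and b: "b > 0" and bB: "1 / b \<le> B" and n: "n \<ge> 2 * k" for a b n
  proof -
    interpret staircase_weights a b by unfold_locales (use a b in auto)
    have n4: "real n \<ge> 4" using n k by simp
    let ?E = "finite_expectation n a b :: (filling \<Rightarrow> real) \<Rightarrow> real"
    let ?R = "alpha_steps k n"
    have one: "?E (\<lambda>S. of_bool (m \<in> ?R S)) \<le> 5 * W * (real n - real m + B) / (real n) ^ 2"
      if m: "k \<le> m" "m \<le> n" for m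
    proof -
      have "norm (window_sum theta (\<lambda>_. 1 :: real) (k - 2) 1 (n - 2)) \<le> real (1 + 1 + (k - 2)) ^ (k - 2) * 1"
        using theta_pos n k by (intro window_sum_bound) auto
      also have "1 + 1 + (k - 2) = k" using k by simp
      finally have win: "window_sum theta (\<lambda>_. 1 :: real) (k - 2) 1 (n - 2) \<le> W"
        by (simp add: W_def)
      have "(real n) ^ 2 / 5 \<le> (real n - 1) * (real n - 2)"
      proof -
        have "(3 / 4 * real n) * (1 / 2 * real n) \<le> (real n - 1) * (real n - 2)"
          using n4 by (intro mult_mono) auto
        moreover have "(real n) ^ 2 / 5 \<le> (3 / 4 * real n) * (1 / 2 * real n)"
          by (simp add: power2_eq_square)
        ultimately show ?thesis by linarith
      qed
      also have "\<dots> \<le> (real n - 1 + theta) * (real n - 2 + theta)"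
        using n4 theta_pos by (intro mult_mono) auto
      finally have den: "(real n) ^ 2 / 5 \<le> (real n - 1 + theta) * (real n - 2 + theta)" .
      have num: "0 \<le> real n - real m + 1 / b" "real n - real m + 1 / b \<le> real n - real m + B"
        using m b bB by auto
      have "(real n - real m + 1 / b) / ((real n - 1 + theta) * (real n - 2 + theta)) \<le>
          (real n - real m + B) / ((real n) ^ 2 / 5)"
        using num den n4 m B by (intro frac_le) auto
      hence "?E (\<lambda>S. of_bool (m \<in> ?R S)) \<le> (real n - real m + B) / ((real n) ^ 2 / 5) * W"
        unfolding probability_alpha_step[OF k m]
      proof (intro mult_mono win)
        show "0 \<le> window_sum theta (\<lambda>_. 1 :: real) (k - 2) 1 (n - 2)"
        proof -
          have "0 \<le> window_sum theta (\<lambda>_. 1 :: real) p j t" if "p < t" for p j t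
            using that
          proof (induction p arbitrary: j t)
            case (Suc p)
            have "0 \<le> window_sum theta (\<lambda>_. 1 :: real) p j t"
              "0 \<le> window_sum theta (\<lambda>_. 1 :: real) p (Suc j) (t - 1)"
              using Suc by auto
            moreover have "0 \<le> (real j + 1) / (real t - 1 + theta)" using Suc.prems theta_pos by auto
            ultimately show ?case
              unfolding window_sum.simps real_scaleR_def by (intro add_nonneg_nonneg mult_nonneg_nonneg)
          qed auto
          thus ?thesis using n k by simp
        qed
      qed (use m B n4 in auto)
      thus ?thesis by (simp add: field_simps)
    qed
    have pair: "?E (\<lambda>S. of_bool (m \<in> ?R S) * of_bool (m + d \<in> ?R S)) \<le> c / (real n) ^ 2"
      if m: "k \<le> m" "m \<le> n" and d: "1 \<le> d" "d < k" for m d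
    proof (cases "m + d < n")
      case True
      define p where "p = real n - real m - real d"
      have p: "p \<ge> 1" using True by (simp add: p_def)
      have "?E (\<lambda>S. of_bool (m \<in> ?R S) * of_bool (m + d \<in> ?R S)) \<le>
          ?E (\<lambda>S. of_bool (m \<in> ?R S)) / (real (n - (m + d)) + theta)"
        using probability_two_alpha_steps[OF k, of m "m + d" n] True m d by simp
      also have "real (n - (m + d)) = p" using True by (simp add: p_def of_nat_diff)
      also have "?E (\<lambda>S. of_bool (m \<in> ?R S)) / (p + theta) \<le>
          (5 * W * (real n - real m + B) / (real n) ^ 2) / p"
        using one[OF m] p theta_pos W m B by (intro frac_le) auto
      also have "\<dots> = 5 * W * ((real n - real m + B) / p) / (real n) ^ 2" by simp
      also have "\<dots> \<le> 5 * W * (1 + real k + B) / (real n) ^ 2"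
      proof -
        have "real n - real m \<le> p + k" using d by (simp add: p_def)
        moreover have "1 * (k + B) \<le> p * (k + B)" using p B by (intro mult_right_mono) auto
        ultimately have "real n - real m + B \<le> p * (1 + real k + B)" using p by (simp add: algebra_simps)
        hence "(real n - real m + B) / p \<le> 1 + real k + B" using p by (simp add: divide_le_eq mult.commute)
        thus ?thesis using W by (intro divide_right_mono mult_left_mono) auto
      qed
      finally show ?thesis by (simp add: c_def)
    next
      case False
      show ?thesis
      proof (cases "m + d = n")
        \<comment> \<open>Here the second column is leftmost and only 1 / theta would be gained,
          which has no uniform bound. The first \<alpha> alone suffices, since n - m = d <
          k.\<close>
        case True
        have "?E (\<lambda>S. of_bool (m \<in> ?R S) * of_bool (m + d \<in> ?R S)) \<le> ?E (\<lambda>S. of_bool (m \<in> ?R S))"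
          by (intro expectation_mono) auto
        also have "\<dots> \<le> 5 * W * (real n - real m + B) / (real n) ^ 2" by (rule one[OF m])
        also have "\<dots> \<le> c / (real n) ^ 2"
          unfolding c_def using True d W by (intro divide_right_mono mult_left_mono) auto
        finally show ?thesis .
      next
        case out: False
        have "m + d \<notin> ?R S" for S using False out by (auto simp: alpha_steps_def)
        thus ?thesis using expectation_const[of n "0 :: real"] c by simp
      qed
    qed
    have "?E (\<lambda>S. of_bool (clustered k (?R S))) \<le> ?E (\<lambda>S. of_bool (k \<in> ?R S) +
      (\<Sum>m\<in>{k..n}. \<Sum>d\<in>{1..<k}. of_bool (m \<in> ?R S) * of_bool (m + d \<in> ?R S)))"
      by (intro expectation_mono of_bool_clustered_le) (auto simp: alpha_steps_def)
    also have "\<dots> = ?E (\<lambda>S. of_bool (k \<in> ?R S)) +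
      (\<Sum>m\<in>{k..n}. \<Sum>d\<in>{1..<k}. ?E (\<lambda>S. of_bool (m \<in> ?R S) * of_bool (m + d \<in> ?R S)))"
      by (simp only: expectation_add expectation_sum)
    also have "\<dots> \<le> c / n + (\<Sum>m\<in>{k..n}. \<Sum>d\<in>{1..<k}. c / (real n) ^ 2)"
    proof (intro add_mono sum_mono pair)
      have "?E (\<lambda>S. of_bool (k \<in> ?R S)) \<le> 5 * W * (real n - real k + B) / (real n) ^ 2"
        using n k by (intro one) auto
      also have "\<dots> \<le> 5 * W * ((1 + real k + B) * n) / (real n) ^ 2"
      proof (intro divide_right_mono mult_left_mono)
        have "B * 1 \<le> B * n" using B n4 by (intro mult_left_mono) auto
        moreover have "0 \<le> real k * real n" by simp
        ultimately have "B \<le> real k + (B * real n + real k * real n)" by linarith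
        thus "real n - real k + B \<le> (1 + real k + B) * real n" by (simp add: algebra_simps)
      qed (use W in auto)
      also have "\<dots> = c / n" using n4 by (simp add: c_def power2_eq_square)
      finally show "?E (\<lambda>S. of_bool (k \<in> ?R S)) \<le> c / n" .
    qed auto
    also have "(\<Sum>m\<in>{k..n}. \<Sum>d\<in>{1..<k}. c / (real n) ^ 2) = real (Suc n - k) * (real (k - 1) * (c / (real n) ^ 2))"
      by simp
    also have "\<dots> \<le> real n * (real k * (c / (real n) ^ 2))"
      using c k n by (intro mult_mono) auto
    also have "\<dots> = k * c / n" using n4 by (simp add: power2_eq_square)
    finally show ?thesis by (simp add: add_divide_distrib)
  qed
  thus ?thesis by blast
qed

text \<open>The power of \<open>z\<close> equals the separated sum with w = z - 1 except on
  clustered tableaux. There both are at most 3^A, where A counts the \<alpha>'s; splitting 3^A at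
  sqrt n bounds the expected difference by a multiple of 1 / sqrt n.\<close>

lemma expectation_power_alphas:
  fixes z :: complex
  assumes k: "k \<ge> 2" and B: "B \<ge> 0" and z: "norm z \<le> 1"
  shows "\<exists>K. \<forall>a b n. a > 0 \<longrightarrow> b > 0 \<longrightarrow> 1 / a \<le> B \<longrightarrow> 1 / b \<le> B \<longrightarrow> n \<ge> 2 * k \<longrightarrow>
    norm (finite_expectation n a b (\<lambda>S. z ^ alphas_on_diagonal n k S) - exp ((z - 1) / 2)) \<le> K / sqrt n"
proof -
  obtain K1 where K1: "\<And>b \<theta> N t. 0 \<le> b \<Longrightarrow> b \<le> \<theta> \<Longrightarrow> \<theta> \<le> 2 * B \<Longrightarrow> N \<le> t \<Longrightarrow>
      real t * norm (separated_gf k b \<theta> (z - 1) N t - exp ((z - 1) * profile N t)) \<le> K1"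
  proof -
    have "2 * B \<ge> 0" using B by simp
    from separated_gf_asymp[OF k this, of "z - 1"] show ?thesis using that by blast
  qed
  obtain K2 where K2: "\<And>a b n. a > 0 \<Longrightarrow> b > 0 \<Longrightarrow> 1 / a \<le> B \<Longrightarrow> 1 / b \<le> B \<Longrightarrow> n \<ge> 2 * k \<Longrightarrow>
      finite_expectation n a b (\<lambda>S. of_bool (clustered k (alpha_steps k n S)) :: real) \<le> K2 / n"
    using probability_clustered[OF k B] by blast
  \<comment> \<open>Gives a bounded moment of 9^A through \<open>power_card_le_separated_sum\<close>
    with y = 8. Here 9 is the square of 3, and 3 bounds 1 + |z - 1|.\<close>
  obtain K3 where K3: "\<And>b \<theta> N t. 0 \<le> b \<Longrightarrow> b \<le> \<theta> \<Longrightarrow> N \<le> t \<Longrightarrow>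
      norm (separated_gf k b \<theta> (9 ^ k - 1 :: real) N t) \<le> K3"
    using separated_gf_bounded[OF k] by blast
  define K where "K = \<bar>K1\<bar> + 2 * (9 ^ Suc k * \<bar>K3\<bar> + \<bar>K2\<bar>)"
  have "norm (finite_expectation n a b (\<lambda>S. z ^ alphas_on_diagonal n k S) - exp ((z - 1) / 2)) \<le> K / sqrt n"
    if ab: "a > 0" "b > 0" and aB: "1 / a \<le> B" "1 / b \<le> B" and n: "n \<ge> 2 * k" for a b n
  proof -
    interpret staircase_weights a b by unfold_locales (use ab in auto)
    have n0: "real n \<ge> 1" "n > 0" using n k by auto
    define L where "L = sqrt n"
    have L: "L \<ge> 1" "L * L = n" using n0 by (auto simp: L_def)
    have th: "1 / b \<le> theta" "theta \<le> 2 * B" "0 \<le> 1 / b" using ab aB by (auto simp: theta_def)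
    let ?R = "alpha_steps k n"
    define A where "A S = card (?R S)" for S
    define w where "w = z - 1"
    have w: "norm w \<le> 2" using norm_triangle_ineq4[of z 1] z by (simp add: w_def)
    have R: "?R S \<inter> {..n} = ?R S" for S by (auto simp: alpha_steps_def)
    have pt: "norm (z ^ A S - separated_sum k w n (?R S)) \<le>
        2 * (9 ^ A S / L + L * of_bool (clustered k (?R S)))" for S
    proof (cases "clustered k (?R S)")
      case False
      have sub: "?R S \<subseteq> {Suc k..}"
      proof
        fix m assume m: "m \<in> ?R S"
        hence "m \<noteq> k" using False by (auto simp: clustered_def)
        thus "m \<in> {Suc k..}" using m by (auto simp: alpha_steps_def)
      qed
      have "m + k \<le> m'" if "m \<in> ?R S" "m' \<in> ?R S" "m < m'" for m m'
        using False that by (meson clustered_def not_le)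
      hence "separated_sum k w n (?R S) = (1 + w) ^ card (?R S \<inter> {..n})"
        using k sub by (intro separated_sum_separated) auto
      hence "separated_sum k w n (?R S) = z ^ A S" by (simp add: R A_def w_def)
      thus ?thesis using False L by simp
    next
      case True
      have "norm (separated_sum k w n (?R S)) \<le> (1 + norm w) ^ A S"
        using norm_separated_sum_le[of k w n "?R S"] by (simp add: R A_def)
      also have "\<dots> \<le> 3 ^ A S" using w by (intro power_mono) auto
      finally have 1: "norm (separated_sum k w n (?R S)) \<le> 3 ^ A S" .
      have "norm (z ^ A S) \<le> 1" using z by (simp add: norm_power power_le_one)
      also have "(1 :: real) \<le> 3 ^ A S" by simp
      finally have 2: "norm (z ^ A S) \<le> 3 ^ A S" .
      \<comment> \<open>Either 3^A \<le> L, or 3^A > L and then 3^A = 9^A / 3^A \<le> 9^A /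
        L.\<close>
      have 3: "3 ^ A S \<le> 9 ^ A S / L + L"
      proof (cases "3 ^ A S \<le> L")
        case False
        have "L * 3 ^ A S \<le> 3 ^ A S * 3 ^ A S" using False by (intro mult_right_mono) auto
        also have "\<dots> = 9 ^ A S" by (simp add: power_mult_distrib[symmetric])
        finally have "3 ^ A S \<le> 9 ^ A S / L" using L by (simp add: le_divide_eq mult.commute)
        thus ?thesis using L by simp
      qed (use L in \<open>simp add: add_increasing\<close>)
      show ?thesis using norm_triangle_ineq4[of "z ^ A S" "separated_sum k w n (?R S)"] 1 2 3 True by simp
    qed
    have "9 ^ A S \<le> 9 ^ Suc k * separated_sum k (9 ^ k - 1 :: real) n (?R S)" for S
      using power_card_le_separated_sum[of 8 k "?R S" n] k by (simp add: A_def R)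
    hence "finite_expectation n a b (\<lambda>S. 9 ^ A S :: real) \<le>
        finite_expectation n a b (\<lambda>S. 9 ^ Suc k * separated_sum k (9 ^ k - 1) n (?R S))"
      by (intro expectation_mono)
    also have "\<dots> = 9 ^ Suc k * separated_gf k (1 / b) theta (9 ^ k - 1) n n"
      unfolding expectation_scale expectation_separated_sum[OF k] ..
    also have "\<dots> \<le> 9 ^ Suc k * \<bar>K3\<bar>"
      using K3[OF th(3,1), of n n] by (intro mult_left_mono) auto
    finally have E9: "finite_expectation n a b (\<lambda>S. 9 ^ A S :: real) \<le> 9 ^ Suc k * \<bar>K3\<bar>" .
    have Ec: "finite_expectation n a b (\<lambda>S. of_bool (clustered k (?R S)) :: real) \<le> \<bar>K2\<bar> / n"
      by (rule order_trans[OF K2[OF ab aB n]]) (intro divide_right_mono, auto)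
    have "norm (finite_expectation n a b (\<lambda>S. z ^ A S) - separated_gf k (1 / b) theta w n n) =
        norm (finite_expectation n a b (\<lambda>S. z ^ A S - separated_sum k w n (?R S)))"
      unfolding expectation_diff expectation_separated_sum[OF k] ..
    also have "\<dots> \<le> finite_expectation n a b (\<lambda>S. norm (z ^ A S - separated_sum k w n (?R S)))"
      by (rule norm_expectation_le)
    also have "\<dots> \<le> finite_expectation n a b (\<lambda>S. 2 * (1 / L * 9 ^ A S + L * of_bool (clustered k (?R S))))"
      using pt by (intro expectation_mono) simp
    also have "\<dots> = 2 * (1 / L * finite_expectation n a b (\<lambda>S. 9 ^ A S) +
        L * finite_expectation n a b (\<lambda>S. of_bool (clustered k (?R S))))"
      unfolding expectation_scale expectation_add ..
    also have "\<dots> \<le> 2 * (1 / L * (9 ^ Suc k * \<bar>K3\<bar>) + L * (\<bar>K2\<bar> / n))"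
      using E9 Ec L by (intro mult_left_mono add_mono) auto
    also have "L * (\<bar>K2\<bar> / n) = \<bar>K2\<bar> / L"
      unfolding L(2)[symmetric] using L(1) by simp
    finally have D1: "norm (finite_expectation n a b (\<lambda>S. z ^ A S) - separated_gf k (1 / b) theta w n n) \<le>
        2 * (9 ^ Suc k * \<bar>K3\<bar> + \<bar>K2\<bar>) / L" by (simp add: add_divide_distrib)
    have pr: "(z - 1) * profile n n = (z - 1) / 2" using n0 by (simp add: profile_def)
    have "real n * norm (separated_gf k (1 / b) theta w n n - exp ((z - 1) / 2)) \<le> K1"
      using K1[OF th(3,1,2), of n n] unfolding pr w_def by simp
    hence "norm (separated_gf k (1 / b) theta w n n - exp ((z - 1) / 2)) \<le> K1 / n"
      using n0 by (simp add: le_divide_eq mult.commute)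
    also have "\<dots> \<le> \<bar>K1\<bar> / L"
    proof (rule frac_le)
      have "L * 1 \<le> L * L" using L by (intro mult_left_mono) auto
      thus "L \<le> n" using L by simp
    qed (use L in auto)
    finally have D2: "norm (separated_gf k (1 / b) theta w n n - exp ((z - 1) / 2)) \<le> \<bar>K1\<bar> / L" .
    have "alphas_on_diagonal n k S = A S" for S using alphas_on_diagonal_eq[of k n S] k by (simp add: A_def)
    hence "norm (finite_expectation n a b (\<lambda>S. z ^ alphas_on_diagonal n k S) - exp ((z - 1) / 2)) =
        norm ((finite_expectation n a b (\<lambda>S. z ^ A S) - separated_gf k (1 / b) theta w n n) +
          (separated_gf k (1 / b) theta w n n - exp ((z - 1) / 2)))" by simp
    also have "\<dots> \<le> 2 * (9 ^ Suc k * \<bar>K3\<bar> + \<bar>K2\<bar>) / L + \<bar>K1\<bar> / L"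
      by (intro norm_triangle_le add_mono D1 D2)
    also have "\<dots> = K / L" by (simp add: K_def add_divide_distrib)
    finally show ?thesis by (simp add: L_def)
  qed
  thus ?thesis by blast
qed

section \<open>Infinite weights and convergence in distribution\<close>

text \<open>A column holds at most one \<alpha> and a row at most one \<beta>, so columns and rows
  count the symbols injectively; equality means that every column, respectively every row, is
  hit.\<close>

lemma num_symbol_le:
  assumes S: "S \<in> staircase_tableaux n"
  shows "num_symbol s S \<le> n"
    and "num_symbol SymAlpha S = n \<Longrightarrow> j \<in> {1..n} \<Longrightarrow> \<exists>i. S (i, j) = Some SymAlpha"
    and "num_symbol SymBeta S = n \<Longrightarrow> i \<in> {1..n} \<Longrightarrow> \<exists>j. S (i, j) = Some SymBeta"
proof -
  let ?A = "{x. S x = Some SymAlpha}" and ?B = "{x. S x = Some SymBeta}"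
  have injA: "inj_on snd ?A"
  proof (rule inj_onI, clarsimp)
    fix i i' j assume "S (i, j) = Some SymAlpha" "S (i', j) = Some SymAlpha"
    thus "i = i'" using tableau_above_alpha[OF S, of i j i'] tableau_above_alpha[OF S, of i' j i]
      by (cases i i' rule: linorder_cases) auto
  qed
  have injB: "inj_on fst ?B"
  proof (rule inj_onI, clarsimp)
    fix i j j' assume "S (i, j) = Some SymBeta" "S (i, j') = Some SymBeta"
    thus "j = j'" using tableau_left_of_beta[OF S, of i j j'] tableau_left_of_beta[OF S, of i j' j]
      by (cases j j' rule: linorder_cases) auto
  qed
  have sub: "snd ` ?A \<subseteq> {1..n}" "fst ` ?B \<subseteq> {1..n}"
    using tableau_inside[OF S] by force+
  have card: "num_symbol SymAlpha S = card (snd ` ?A)" "num_symbol SymBeta S = card (fst ` ?B)"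
    using card_image[OF injA] card_image[OF injB] by (simp_all add: num_symbol_def)
  have "card (snd ` ?A) \<le> n" "card (fst ` ?B) \<le> n"
    using card_mono[OF _ sub(1)] card_mono[OF _ sub(2)] by auto
  thus "num_symbol s S \<le> n" using card by (cases s) simp_all
  show "\<exists>i. S (i, j) = Some SymAlpha" if "num_symbol SymAlpha S = n" "j \<in> {1..n}"
  proof -
    have "snd ` ?A = {1..n}" using that card by (intro card_subset_eq sub) auto
    hence "j \<in> snd ` ?A" using that by simp
    thus ?thesis by force
  qed
  show "\<exists>j. S (i, j) = Some SymBeta" if "num_symbol SymBeta S = n" "i \<in> {1..n}"
  proof -
    have "fst ` ?B = {1..n}" using that card by (intro card_subset_eq sub) auto
    hence "i \<in> fst ` ?B" using that by simp
    thus ?thesis by force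
  qed
qed

text \<open>If both counts were \<open>n\<close>, the \<beta> of row 1 would share its column with
  an \<alpha>, either in the same box or below it, and both are impossible. This cancels a pole when
  both weights are infinite.\<close>

lemma num_symbols_less:
  assumes S: "S \<in> staircase_tableaux n" and n: "n \<ge> 1"
  shows "num_symbol SymAlpha S + num_symbol SymBeta S < 2 * n"
proof (rule ccontr)
  assume "\<not> ?thesis"
  hence full: "num_symbol SymAlpha S = n" "num_symbol SymBeta S = n"
    using num_symbol_le(1)[OF S, of SymAlpha] num_symbol_le(1)[OF S, of SymBeta] by linarith+
  obtain j where j: "S (1, j) = Some SymBeta" using num_symbol_le(3)[OF S full(2), of 1] n by auto
  hence "j \<in> {1..n}" using tableau_inside[OF S, of 1 j] by auto
  then obtain i where i: "S (i, j) = Some SymAlpha" using num_symbol_le(2)[OF S full(1)] by blast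
  hence "1 \<le> i" using tableau_inside(1)[OF S, of i j] by simp
  thus False using i j tableau_above_alpha[OF S i, of 1] by (cases "i = 1") auto
qed

text \<open>In the reciprocal weights all exponents are nonnegative, so an infinite weight is simply
  the value 0 of a reciprocal.\<close>

lemma finite_prob_eq:
  assumes ab: "a > 0" "b > 0" and S: "S \<in> staircase_tableaux n"
  shows "finite_prob n a b S = (1 / a) ^ (n - num_symbol SymAlpha S) *
    (1 / b) ^ (n - num_symbol SymBeta S) / pochhammer (1 / a + 1 / b) n"
proof -
  interpret staircase_weights a b by unfold_locales (use ab in auto)
  have "a ^ p / a ^ n = (1 / a) ^ (n - p)" if "p \<le> n" "a > 0" for a :: real and p
    using that by (simp add: power_diff power_divide)
  from this[OF num_symbol_le(1)[OF S] ab(1)] this[OF num_symbol_le(1)[OF S] ab(2)]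
  have "(1 / a) ^ (n - num_symbol SymAlpha S) = a ^ num_symbol SymAlpha S / a ^ n"
    "(1 / b) ^ (n - num_symbol SymBeta S) = b ^ num_symbol SymBeta S / b ^ n" by simp_all
  thus ?thesis using S
    by (simp add: finite_prob_def weight_def partition_function_eq theta_def power_mult_distrib)
qed

lemma tendsto_pochhammer [tendsto_intros]:
  fixes f :: "'b \<Rightarrow> real"
  assumes "(f \<longlongrightarrow> c) F"
  shows "((\<lambda>x. pochhammer (f x) n) \<longlongrightarrow> pochhammer c n) F"
  unfolding pochhammer_prod by (intro tendsto_intros assms)

text \<open>Finite weights become constant nets, so the four cases of \<open>tableau_prob\<close>
  are one limit; two infinite weights share the path \<open>x\<close>, as the definition
  demands.\<close>

definition weight_net :: "ennreal \<Rightarrow> real \<Rightarrow> real" where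
  "weight_net \<alpha> x = (if \<alpha> = \<infinity> then x else enn2real \<alpha>)"

lemma weight_net:
  assumes "\<alpha> > 0"
  shows "\<forall>\<^sub>F x in at_top. weight_net \<alpha> x > 0"
    and "\<exists>l\<ge>0. (l = 0 \<longleftrightarrow> \<alpha> = \<infinity>) \<and> ((\<lambda>x. 1 / weight_net \<alpha> x) \<longlongrightarrow> l) at_top"
proof -
  have fin: "enn2real \<alpha> > 0" if "\<alpha> \<noteq> \<infinity>"
    using assms that by (simp add: enn2real_positive_iff top.not_eq_extremum)
  show "\<forall>\<^sub>F x in at_top. weight_net \<alpha> x > 0"
    using fin by (auto simp: weight_net_def intro: eventually_gt_at_top)
  show "\<exists>l\<ge>0. (l = 0 \<longleftrightarrow> \<alpha> = \<infinity>) \<and> ((\<lambda>x. 1 / weight_net \<alpha> x) \<longlongrightarrow> l) at_top"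
  proof (cases "\<alpha> = \<infinity>")
    case True
    have "((\<lambda>x :: real. 1 / x) \<longlongrightarrow> 0) at_top"
      using tendsto_inverse_0_at_top[OF filterlim_ident] by (simp add: inverse_eq_divide)
    thus ?thesis using True by (intro exI[of _ 0]) (simp add: weight_net_def)
  next
    case False
    thus ?thesis using fin by (intro exI[of _ "1 / enn2real \<alpha>"]) (auto simp: weight_net_def)
  qed
qed

lemma Lim_at_top_const: "Lim (at_top :: real filter) (\<lambda>_. c :: real) = c"
  by (rule tendsto_Lim) simp_all

lemma tableau_prob_eq_Lim:
  "tableau_prob n \<alpha> \<beta> S = Lim at_top (\<lambda>x. finite_prob n (weight_net \<alpha> x) (weight_net \<beta> x) S)"
  by (simp add: tableau_prob_def weight_net_def Lim_at_top_const)

lemma finite_prob_convergent: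
  assumes "\<alpha> > 0" "\<beta> > 0"
  shows "\<exists>l. ((\<lambda>x. finite_prob n (weight_net \<alpha> x) (weight_net \<beta> x) S) \<longlongrightarrow> l) at_top"
proof (cases "S \<in> staircase_tableaux n")
  case False
  thus ?thesis by (intro exI[of _ 0]) (simp add: finite_prob_def)
next
  case S: True
  define p where "p = n - num_symbol SymAlpha S"
  define q where "q = n - num_symbol SymBeta S"
  let ?f = "\<lambda>x. finite_prob n (weight_net \<alpha> x) (weight_net \<beta> x) S"
  let ?g = "\<lambda>x. (1 / weight_net \<alpha> x) ^ p * (1 / weight_net \<beta> x) ^ q /
    pochhammer (1 / weight_net \<alpha> x + 1 / weight_net \<beta> x) n"
  have ev: "\<forall>\<^sub>F x in at_top. ?g x = ?f x"
    using weight_net(1)[OF assms(1)] weight_net(1)[OF assms(2)]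
    by eventually_elim (simp add: finite_prob_eq[OF _ _ S] p_def q_def)
  obtain a where a: "a \<ge> 0" "a = 0 \<longleftrightarrow> \<alpha> = \<infinity>" "((\<lambda>x. 1 / weight_net \<alpha> x) \<longlongrightarrow> a) at_top"
    using weight_net(2)[OF assms(1)] by blast
  obtain b where b: "b \<ge> 0" "b = 0 \<longleftrightarrow> \<beta> = \<infinity>" "((\<lambda>x. 1 / weight_net \<beta> x) \<longlongrightarrow> b) at_top"
    using weight_net(2)[OF assms(2)] by blast
  have "\<exists>l. (?g \<longlongrightarrow> l) at_top"
  proof (cases "\<alpha> = \<infinity> \<and> \<beta> = \<infinity> \<and> n \<ge> 1")
    case False
    have "pochhammer (a + b) n \<noteq> 0"
    proof (cases "n = 0")
      case False
      hence "a \<noteq> 0 \<or> b \<noteq> 0" using \<open>\<not> (\<alpha> = \<infinity> \<and> \<beta> = \<infinity> \<and> n \<ge> 1)\<close> a(2) b(2) by simp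
      hence "a + b > 0" using a(1) b(1) by linarith
      hence "pochhammer (a + b) n > 0" by (rule pochhammer_pos)
      thus ?thesis by simp
    qed auto
    hence "(?g \<longlongrightarrow> a ^ p * b ^ q / pochhammer (a + b) n) at_top"
      by (intro tendsto_intros a b)
    thus ?thesis by blast
  next
    case True
    then obtain m where m: "n = Suc m" by (cases n) auto
    \<comment> \<open>Both reciprocals tend to 0 here, and so does the denominator, to first order:
      its first Pochhammer factor is 2 y. The numerator contains a factor y, which cancels it before
      the limit is taken.\<close>
    have "p + q \<ge> 1"
      using num_symbols_less[OF S] num_symbol_le(1)[OF S, of SymAlpha] num_symbol_le(1)[OF S, of SymBeta] True
      unfolding p_def q_def by linarith
    then obtain r where r: "p + q = Suc r" by (cases "p + q") auto
    let ?h = "\<lambda>x :: real. (1 / x) ^ r / (2 * pochhammer (1 / x + 1 / x + 1) m)"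
    have net: "weight_net \<alpha> = (\<lambda>x. x)" "weight_net \<beta> = (\<lambda>x. x)"
      using True by (auto simp: weight_net_def fun_eq_iff)
    have cancel: "y ^ p * y ^ q / pochhammer (y + y) n = y ^ r / (2 * pochhammer (y + y + 1) m)"
      if "y \<noteq> 0" for y :: real
    proof -
      have "y ^ p * y ^ q = y * y ^ r" by (simp only: power_add[symmetric] r power_Suc)
      moreover have "pochhammer (y + y) n = y * (2 * pochhammer (y + y + 1) m)"
        by (simp only: m pochhammer_rec) (simp add: algebra_simps)
      ultimately show ?thesis using that by (simp only: nonzero_mult_divide_mult_cancel_left not_False_eq_True)
    qed
    have "\<forall>\<^sub>F x in at_top. ?h x = ?g x"
      using eventually_gt_at_top[of 0] unfolding net
    proof eventually_elim
      case (elim x)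
      hence "1 / x \<noteq> 0" by simp
      from cancel[OF this] show ?case by (rule sym)
    qed
    moreover have "(?h \<longlongrightarrow> 0 ^ r / (2 * pochhammer (0 + 0 + 1) m)) at_top"
    proof -
      have "pochhammer (0 + 0 + 1 :: real) m > 0" by (rule pochhammer_pos) simp
      moreover have "((\<lambda>x :: real. 1 / x) \<longlongrightarrow> 0) at_top"
        using tendsto_inverse_0_at_top[OF filterlim_ident] by (simp add: inverse_eq_divide)
      ultimately show ?thesis by (intro tendsto_intros) auto
    qed
    ultimately have "(?g \<longlongrightarrow> 0 ^ r / (2 * pochhammer (0 + 0 + 1) m)) at_top"
      by (rule Lim_transform_eventually[rotated])
    thus ?thesis by blast
  qed
  then obtain l where "(?g \<longlongrightarrow> l) at_top" by blast
  hence "(?f \<longlongrightarrow> l) at_top" using ev by (rule Lim_transform_eventually)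
  thus ?thesis by blast
qed

lemma tendsto_tableau_prob:
  assumes "\<alpha> > 0" "\<beta> > 0"
  shows "((\<lambda>x. finite_prob n (weight_net \<alpha> x) (weight_net \<beta> x) S) \<longlongrightarrow> tableau_prob n \<alpha> \<beta> S) at_top"
proof -
  obtain l where l: "((\<lambda>x. finite_prob n (weight_net \<alpha> x) (weight_net \<beta> x) S) \<longlongrightarrow> l) at_top"
    using finite_prob_convergent[OF assms] by blast
  have "Lim at_top (\<lambda>x. finite_prob n (weight_net \<alpha> x) (weight_net \<beta> x) S) = l"
    by (rule tendsto_Lim[OF _ l]) simp
  thus ?thesis using l by (simp only: tableau_prob_eq_Lim)
qed

section \<open>The distribution for positive, possibly infinite weights\<close>

context
  fixes \<alpha> \<beta> :: ennreal
  assumes pos: "\<alpha> > 0" "\<beta> > 0"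
begin

lemma tendsto_expectation:
  fixes h :: "filling \<Rightarrow> 'a :: real_normed_vector"
  shows "((\<lambda>x. finite_expectation n (weight_net \<alpha> x) (weight_net \<beta> x) h) \<longlongrightarrow>
    (\<Sum>S\<in>staircase_tableaux n. tableau_prob n \<alpha> \<beta> S *\<^sub>R h S)) at_top"
  unfolding finite_expectation_def by (intro tendsto_intros tendsto_tableau_prob pos)

lemma tableau_prob_nonneg: "tableau_prob n \<alpha> \<beta> S \<ge> 0"
proof (rule tendsto_lowerbound[OF tendsto_tableau_prob[OF pos]])
  show "\<forall>\<^sub>F x in at_top. 0 \<le> finite_prob n (weight_net \<alpha> x) (weight_net \<beta> x) S"
    using weight_net(1)[OF pos(1)] weight_net(1)[OF pos(2)]
    by eventually_elim (intro staircase_weights.finite_prob_nonneg staircase_weights.intro)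
qed simp

lemma sum_tableau_prob: "(\<Sum>S\<in>staircase_tableaux n. tableau_prob n \<alpha> \<beta> S) = 1"
proof -
  have "\<forall>\<^sub>F x in at_top. finite_expectation n (weight_net \<alpha> x) (weight_net \<beta> x) (\<lambda>_. 1 :: real) = 1"
    using weight_net(1)[OF pos(1)] weight_net(1)[OF pos(2)]
    by eventually_elim (intro staircase_weights.expectation_const staircase_weights.intro)
  hence "((\<lambda>x. finite_expectation n (weight_net \<alpha> x) (weight_net \<beta> x) (\<lambda>_. 1 :: real)) \<longlongrightarrow> 1) at_top"
    by (rule tendsto_eventually)
  from tendsto_unique[OF _ tendsto_expectation this] show ?thesis by simp
qed

lemma tableau_prob_outside: "S \<notin> staircase_tableaux n \<Longrightarrow> tableau_prob n \<alpha> \<beta> S = 0"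
  by (simp add: tableau_prob_eq_Lim finite_prob_def Lim_at_top_const)

lemma pmf_random_tableau: "pmf (random_tableau n \<alpha> \<beta>) S = tableau_prob n \<alpha> \<beta> S"
  unfolding random_tableau_def
proof (rule pmf_embed_pmf)
  have "(\<integral>\<^sup>+ S. ennreal (tableau_prob n \<alpha> \<beta> S) \<partial>count_space UNIV) =
    (\<Sum>S\<in>staircase_tableaux n. ennreal (tableau_prob n \<alpha> \<beta> S))"
    by (intro nn_integral_count_space') (auto simp: tableau_prob_outside finite_staircase_tableaux)
  also have "\<dots> = ennreal (\<Sum>S\<in>staircase_tableaux n. tableau_prob n \<alpha> \<beta> S)"
    by (intro sum_ennreal tableau_prob_nonneg)
  finally show "(\<integral>\<^sup>+ S. ennreal (tableau_prob n \<alpha> \<beta> S) \<partial>count_space UNIV) = 1"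
    by (simp add: sum_tableau_prob)
qed (rule tableau_prob_nonneg)

lemma integral_random_tableau:
  fixes h :: "filling \<Rightarrow> complex"
  shows "(CLINT S|measure_pmf (random_tableau n \<alpha> \<beta>). h S) =
    (\<Sum>S\<in>staircase_tableaux n. tableau_prob n \<alpha> \<beta> S *\<^sub>R h S)"
  unfolding pmf_random_tableau[symmetric]
proof (rule integral_measure_pmf)
  show "S \<in> staircase_tableaux n" if "S \<in> set_pmf (random_tableau n \<alpha> \<beta>)" for S
    using that tableau_prob_outside[of S n] by (auto simp: set_pmf_iff pmf_random_tableau)
qed (rule finite_staircase_tableaux)

text \<open>The bound K / sqrt n depends on the weights only through an upper bound for their
  reciprocals. For fixed \<open>n\<close> it therefore survives the limit of the weights, and only
  afterwards does \<open>n\<close> grow.\<close>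

lemma expectation_power_alphas_tendsto:
  fixes z :: complex
  assumes k: "k \<ge> 2" and z: "norm z \<le> 1"
  shows "(\<lambda>n. \<Sum>S\<in>staircase_tableaux n. tableau_prob n \<alpha> \<beta> S *\<^sub>R z ^ alphas_on_diagonal n k S)
    \<longlonglongrightarrow> exp ((z - 1) / 2)"
proof -
  obtain a b where a: "((\<lambda>x. 1 / weight_net \<alpha> x) \<longlongrightarrow> a) at_top"
    and b: "((\<lambda>x. 1 / weight_net \<beta> x) \<longlongrightarrow> b) at_top" and ab: "a \<ge> 0" "b \<ge> 0"
    using weight_net(2)[OF pos(1)] weight_net(2)[OF pos(2)] by blast
  \<comment> \<open>The added 1 makes \<open>B\<close> strictly larger than both limits, so the
    reciprocals eventually lie below it.\<close>
  define B where "B = a + b + 1"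
  have B: "B \<ge> 0" "a < B" "b < B" using ab by (auto simp: B_def)
  obtain K where K: "\<And>a b n. a > 0 \<Longrightarrow> b > 0 \<Longrightarrow> 1 / a \<le> B \<Longrightarrow> 1 / b \<le> B \<Longrightarrow> n \<ge> 2 * k \<Longrightarrow>
    norm (finite_expectation n a b (\<lambda>S. z ^ alphas_on_diagonal n k S) - exp ((z - 1) / 2)) \<le> K / sqrt n"
    using expectation_power_alphas[OF k B(1) z] by blast
  have le: "norm ((\<Sum>S\<in>staircase_tableaux n. tableau_prob n \<alpha> \<beta> S *\<^sub>R z ^ alphas_on_diagonal n k S) -
      exp ((z - 1) / 2)) \<le> K / sqrt n" if n: "n \<ge> 2 * k" for n
  proof (rule tendsto_upperbound)
    show "((\<lambda>x. norm (finite_expectation n (weight_net \<alpha> x) (weight_net \<beta> x) (\<lambda>S. z ^ alphas_on_diagonal n k S) -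
        exp ((z - 1) / 2))) \<longlongrightarrow>
      norm ((\<Sum>S\<in>staircase_tableaux n. tableau_prob n \<alpha> \<beta> S *\<^sub>R z ^ alphas_on_diagonal n k S) -
        exp ((z - 1) / 2))) at_top"
      by (intro tendsto_intros tendsto_expectation)
    show "\<forall>\<^sub>F x in at_top. norm (finite_expectation n (weight_net \<alpha> x) (weight_net \<beta> x)
        (\<lambda>S. z ^ alphas_on_diagonal n k S) - exp ((z - 1) / 2)) \<le> K / sqrt n"
      using weight_net(1)[OF pos(1)] weight_net(1)[OF pos(2)] order_tendstoD(2)[OF a B(2)] order_tendstoD(2)[OF b B(3)]
      by eventually_elim (intro K n, auto)
  qed simp
  have "(\<lambda>n. (\<Sum>S\<in>staircase_tableaux n. tableau_prob n \<alpha> \<beta> S *\<^sub>R z ^ alphas_on_diagonal n k S) -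
      exp ((z - 1) / 2)) \<longlonglongrightarrow> 0"
  proof (rule Lim_null_comparison)
    show "\<forall>\<^sub>F n in sequentially. norm ((\<Sum>S\<in>staircase_tableaux n. tableau_prob n \<alpha> \<beta> S *\<^sub>R z ^ alphas_on_diagonal n k S) -
      exp ((z - 1) / 2)) \<le> K / sqrt n"
      using eventually_ge_at_top[of "2 * k"] by eventually_elim (rule le)
    show "(\<lambda>n. K / sqrt (real n)) \<longlonglongrightarrow> 0"
      by (intro tendsto_divide_0[OF tendsto_const] filterlim_at_top_imp_at_infinity
          filterlim_compose[OF sqrt_at_top filterlim_real_sequentially])
  qed
  thus ?thesis by (simp add: LIM_zero_iff)
qed

end

section \<open>Characteristic functions and the Poisson limit\<close>

lemma iexp_of_nat: "iexp (t * real n) = iexp t ^ n"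
  by (simp add: exp_of_nat_mult[symmetric] mult_ac)

lemma char_distr_pmf:
  fixes f :: "'a \<Rightarrow> nat"
  shows "char (distr (measure_pmf p) borel (\<lambda>x. real (f x))) t = (CLINT x|measure_pmf p. iexp t ^ f x)"
  unfolding char_def by (subst integral_distr) (simp_all only: iexp_of_nat, simp_all)

lemma char_poisson:
  assumes "r > 0"
  shows "char (distr (measure_pmf (poisson_pmf r)) borel real) t = exp (r * (iexp t - 1))"
proof -
  let ?z = "iexp t"
  let ?f = "\<lambda>n. (r ^ n / fact n * exp (- r)) *\<^sub>R ?z ^ n"
  have f: "?f n = exp (- r) * ((r * ?z) ^ n /\<^sub>R fact n)" for n
    by (simp add: scaleR_conv_of_real power_mult_distrib field_simps)
  have sums: "?f sums (exp (- r) * exp (r * ?z))"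
    unfolding f using exp_converges[of "r * ?z"] by (intro sums_mult) simp
  have nf: "norm (?f n) = exp (- r) * (r ^ n /\<^sub>R fact n)" for n
    using assms by (simp add: norm_power field_simps)
  have int: "integrable (count_space UNIV) ?f"
    unfolding integrable_count_space_nat_iff nf
    using exp_converges[of r] by (intro summable_mult) (rule sums_summable)
  have "char (distr (measure_pmf (poisson_pmf r)) borel real) t = (CLINT n|measure_pmf (poisson_pmf r). ?z ^ n)"
    using char_distr_pmf[of "poisson_pmf r" "\<lambda>n. n" t] by simp
  also have "\<dots> = (CLINT n|count_space UNIV. ?f n)"
    unfolding measure_pmf_eq_density using assms by (subst integral_density) auto
  also have "\<dots> = exp (- r) * exp (r * ?z)"
    using integral_count_space_nat[OF int] sums_unique[OF sums] by simp
  also have "\<dots> = exp (r * (?z - 1))"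
    by (simp add: exp_add[symmetric] exp_of_real[symmetric] algebra_simps)
  finally show ?thesis .
qed

theorem theorem5:
  fixes k :: nat and \<alpha> \<beta> :: ennreal
  assumes "k > 1" and "\<alpha> > 0" and "\<beta> > 0"
  shows "weak_conv_m
    (\<lambda>n. distr (measure_pmf (random_tableau n \<alpha> \<beta>)) borel
            (\<lambda>S. real (alphas_on_diagonal n k S)))
    (distr (measure_pmf (poisson_pmf (1/2))) borel real)"
proof (rule levy_continuity)
  show "real_distribution (distr (measure_pmf (random_tableau n \<alpha> \<beta>)) borel
      (\<lambda>S. real (alphas_on_diagonal n k S)))" for n
    by (rule prob_space.real_distribution_distr) (auto intro: measure_pmf.prob_space_axioms)
  show "real_distribution (distr (measure_pmf (poisson_pmf (1/2))) borel real)"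
    by (rule prob_space.real_distribution_distr) (auto intro: measure_pmf.prob_space_axioms)
  show "(\<lambda>n. char (distr (measure_pmf (random_tableau n \<alpha> \<beta>)) borel
      (\<lambda>S. real (alphas_on_diagonal n k S))) t) \<longlonglongrightarrow>
    char (distr (measure_pmf (poisson_pmf (1/2))) borel real) t" for t
  proof -
    have poisson: "char (distr (measure_pmf (poisson_pmf (1/2))) borel real) t = exp ((iexp t - 1) / 2)"
      using char_poisson[of "1/2" t] by simp
    show ?thesis
      unfolding poisson unfolding char_distr_pmf integral_random_tableau[OF assms(2,3)]
      using assms(1) by (intro expectation_power_alphas_tendsto[OF assms(2,3)]) auto
  qed
qed

end
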